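(* Let $\mathfrak{A}=\{\mathfrak{A}_k\}_k$ be a holomorphy type and let $E$ be a complex Banach space with separable dual such that finite type polynomials are dense in $\mathfrak{A}_k(E)$ for every $k$. Suppose that $\mathfrak{A}$ is weakly differentiable at $E$ with constants $c_{k,l}$ satisfying $$c_{k,l}\le\frac{(k+l)^{k+l}}{(k+l)!}\,\frac{k!}{k^k}\,\frac{l!}{l^l}\quad\text{for every } k,l.$$ Let $T:\mathcal{H}_{b\mathfrak{A}}(E)\to\mathcal{H}_{b\mathfrak{A}}(E)$ be a non-trivial convolution operator and let $$\alpha_T=\inf\{\|\gamma\| : \gamma\in E',\ |T(e^\gamma)(0)|=1\}.$$ Then, for any $\varepsilon>0$, $T$ admits a frequently hypercyclic function $f\in Exp_{\mathfrak{A}}^{\alpha_T+\varepsilon}(E)$.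
   Context: All Banach spaces are complex. For a Banach space $E$, $\mathcal{P}(^kE)$ is the Banach space of continuous $k$-homogeneous polynomials $P:E\to\mathbb{C}$ with norm $\sup_{\|z\|=1}|P(z)|$ (and $\mathcal{P}(^0E)=\mathbb{C}$); $\overset{\vee}{P}$ is the symmetric $k$-linear form associated to $P$. The finite type polynomials of degree $k$ are the elements of the linear span of $\{\gamma(\cdot)^k:\gamma\in E'\}$, where $E'$ is the dual of $E$. $\mathcal{H}(E)$ is the space of holomorphic functions $E\to\mathbb{C}$; for $f\in\mathcal{H}(E)$, $\frac{d^kf(0)}{k!}$ is the $k$-homogeneous polynomial that is the $k$-th term of the Taylor series of $f$ at $0$. For $P\in\mathcal{P}(^kE)$, $a\in E$, $0\le j\le k$, let $P_{a^j}\in\mathcal{P}(^{k-j}E)$ be $P_{a^j}(x)=\overset{\vee}{P}(a,\dots,a,x,\dots,x)$ with $a$ repeated $j$ times and $x$ repeated $k-j$ times. For $\gamma\in E'$, $e^\gamma$ is the function $x\mapsto e^{\gamma(x)}$. A Banach ideal of scalar-valued continuous $k$-homogeneous polynomials ($k\ge 0$) is a pair $(\mathfrak{A}_k,\|\cdot\|_{\mathfrak{A}_k})$ such that: (i) for every Banach space $E$, $\mathfrak{A}_k(E)=\mathfrak{A}_k\cap\mathcal{P}(^kE)$ is a linear subspace of $\mathcal{P}(^kE)$ and $\|\cdot\|_{\mathfrak{A}_k(E)}$ is a norm making it a Banach space; (ii) if $R:E_1\to E$ is bounded and linear and $P\in\mathfrak{A}_k(E)$ then $P\circ R\in\mathfrak{A}_k(E_1)$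 and $\|P\circ R\|_{\mathfrak{A}_k(E_1)}\le\|P\|_{\mathfrak{A}_k(E)}\|R\|^k$; (iii) $z\mapsto z^k$ belongs to $\mathfrak{A}_k(\mathbb{C})$ and has norm $1$. A holomorphy type is a sequence $\mathfrak{A}=\{\mathfrak{A}_k\}_{k=0}^\infty$, where each $\mathfrak{A}_k$ is a Banach ideal of $k$-homogeneous polynomials, for which there exist constants $c$ and $C_{k,l}$ with $C_{k,l}\le c^k$ for all $0\le l\le k$ such that for every Banach space $E$, $P\in\mathfrak{A}_k(E)$ and $a\in E$: $P_{a^l}\in\mathfrak{A}_{k-l}(E)$ and $\|P_{a^l}\|_{\mathfrak{A}_{k-l}(E)}\le C_{k,l}\|P\|_{\mathfrak{A}_k(E)}\|a\|^l$. $\mathfrak{A}$ is weakly differentiable at $E$ with constants $c_{k,l}>0$ if for $0\le l\le k$, $P\in\mathfrak{A}_k(E)$ and $\varphi\in\mathfrak{A}_{k-l}(E)'$, the mapping $x\mapsto\varphi(P_{x^l})$ belongs to $\mathfrak{A}_l(E)$ and $\|x\mapsto\varphi(P_{x^l})\|_{\mathfrak{A}_l(E)}\le c_{k,l}\|\varphi\|_{\mathfrak{A}_{k-l}(E)'}\|P\|_{\mathfrak{A}_k(E)}$. (Convention $0^0=1$.) $\mathcal{H}_{b\mathfrak{A}}(E)$ is the set of $f\in\mathcal{H}(E)$ such that $d^kf(0)\in\mathfrak{A}_k(E)$ for every $k$ and $\lim_{k\to\infty}\left\|\frac{d^kf(0)}{k!}\right\|_{\mathfrak{A}_k}^{1/k}=0$;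 it is a Fréchet space with the seminorms $p_s(f)=\sum_{k=0}^\infty s^k\left\|\frac{d^kf(0)}{k!}\right\|_{\mathfrak{A}_k}$, $s>0$. For $p>0$, $Exp_{\mathfrak{A}}^p(E)=\{f\in\mathcal{H}_{b\mathfrak{A}}(E):\limsup_{k\to\infty}\|d^kf(0)\|_{\mathfrak{A}_k}^{1/k}\le p\}$. For $x\in E$, $\tau_x f=f(x+\cdot)$ is the translation operator, which is a continuous linear operator on $\mathcal{H}_{b\mathfrak{A}}(E)$. A convolution operator is a continuous linear operator $T$ on $\mathcal{H}_{b\mathfrak{A}}(E)$ with $T\circ\tau_x=\tau_x\circ T$ for every $x\in E$. It is trivial if it is a scalar multiple of the identity. A vector $f\in X$ is frequently hypercyclic for a continuous linear operator $T:X\to X$ if for every non-empty open set $U\subset X$ the set $\{n\ge0:T^nf\in U\}$ has positive lower density. Here "frequently hypercyclic function for $T$" refers to $T$ acting on $X=\mathcal{H}_{b\mathfrak{A}}(E)$. *)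

theory Defs
  imports "HOL-Analysis.Analysis" "HOL-Library.Function_Algebras"
begin

section \<open>Complex Banach spaces with explicit carriers\<close>

text \<open>
  An ideal of polynomials and a holomorphy type speak about all Banach spaces at once. Since one
  cannot quantify over types inside a formula, a Banach space is a structure carried by a subset of
  a type \<open>'u\<close>. The type \<open>'u\<close> is arbitrary and plays the role of a universe: "every Banach space"
  means every Banach space carried by a subset of \<open>'u\<close>.
\<close>

record 'a vspace =
  vcarrier :: "'a set"
  vadd :: "'a \<Rightarrow> 'a \<Rightarrow> 'a"
  vzero :: 'a
  vscale :: "complex \<Rightarrow> 'a \<Rightarrow> 'a"

record 'a nspace = "'a vspace" +
  vnorm :: "'a \<Rightarrow> real"

locale complex_vector_space =
  fixes X :: "('a, 'm) vspace_scheme"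
  assumes add_closed: "\<lbrakk>x \<in> vcarrier X; y \<in> vcarrier X\<rbrakk> \<Longrightarrow> vadd X x y \<in> vcarrier X"
    and zero_closed: "vzero X \<in> vcarrier X"
    and scale_closed: "x \<in> vcarrier X \<Longrightarrow> vscale X c x \<in> vcarrier X"
    and add_assoc: "\<lbrakk>x \<in> vcarrier X; y \<in> vcarrier X; z \<in> vcarrier X\<rbrakk>
          \<Longrightarrow> vadd X (vadd X x y) z = vadd X x (vadd X y z)"
    and add_commute: "\<lbrakk>x \<in> vcarrier X; y \<in> vcarrier X\<rbrakk> \<Longrightarrow> vadd X x y = vadd X y x"
    and add_zero: "x \<in> vcarrier X \<Longrightarrow> vadd X x (vzero X) = x"
    and add_inverse: "x \<in> vcarrier X \<Longrightarrow> \<exists>y\<in>vcarrier X. vadd X x y = vzero X"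
    and scale_add_right: "\<lbrakk>x \<in> vcarrier X; y \<in> vcarrier X\<rbrakk>
          \<Longrightarrow> vscale X c (vadd X x y) = vadd X (vscale X c x) (vscale X c y)"
    and scale_add_left: "x \<in> vcarrier X
          \<Longrightarrow> vscale X (c + d) x = vadd X (vscale X c x) (vscale X d x)"
    and scale_scale: "x \<in> vcarrier X \<Longrightarrow> vscale X c (vscale X d x) = vscale X (c * d) x"
    and scale_one: "x \<in> vcarrier X \<Longrightarrow> vscale X 1 x = x"

locale complex_normed_space = complex_vector_space X
  for X :: "'a nspace" +
  assumes norm_nonneg: "x \<in> vcarrier X \<Longrightarrow> 0 \<le> vnorm X x"
    and norm_eq_zero: "x \<in> vcarrier X \<Longrightarrow> vnorm X x = 0 \<longleftrightarrow> x = vzero X"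
    and norm_triangle: "\<lbrakk>x \<in> vcarrier X; y \<in> vcarrier X\<rbrakk>
          \<Longrightarrow> vnorm X (vadd X x y) \<le> vnorm X x + vnorm X y"
    and norm_scale: "x \<in> vcarrier X \<Longrightarrow> vnorm X (vscale X c x) = cmod c * vnorm X x"

definition vdiff :: "('a, 'm) vspace_scheme \<Rightarrow> 'a \<Rightarrow> 'a \<Rightarrow> 'a" where
  "vdiff X x y = vadd X x (vscale X (-1) y)"

text \<open>
  The value \<open>0\<close> off the carrier is needed because the locale \<^locale>\<open>Metric_space\<close> requires
  nonnegativity and symmetry on the whole type.
\<close>

definition vdist :: "'a nspace \<Rightarrow> 'a \<Rightarrow> 'a \<Rightarrow> real" where
  "vdist X x y = (if x \<in> vcarrier X \<and> y \<in> vcarrier X then vnorm X (vdiff X x y) else 0)"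

abbreviation vtopology :: "'a nspace \<Rightarrow> 'a topology" where
  "vtopology X \<equiv> Metric_space.mtopology (vcarrier X) (vdist X)"

abbreviation vball :: "'a nspace \<Rightarrow> 'a \<Rightarrow> real \<Rightarrow> 'a set" where
  "vball X \<equiv> Metric_space.mball (vcarrier X) (vdist X)"

locale complex_banach_space = complex_normed_space X
  for X :: "'a nspace" +
  assumes complete: "Metric_space.mcomplete (vcarrier X) (vdist X)"

definition complex_space :: "complex nspace" where
  "complex_space = \<lparr>vcarrier = UNIV, vadd = (+), vzero = 0, vscale = (*), vnorm = cmod\<rparr>"

definition linear_map ::
    "('a, 'm) vspace_scheme \<Rightarrow> ('b, 'n) vspace_scheme \<Rightarrow> ('a \<Rightarrow> 'b) \<Rightarrow> bool" where
  "linear_map X Y R \<longleftrightarrow>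
     (\<forall>x\<in>vcarrier X. R x \<in> vcarrier Y) \<and>
     (\<forall>x\<in>vcarrier X. \<forall>y\<in>vcarrier X. R (vadd X x y) = vadd Y (R x) (R y)) \<and>
     (\<forall>c. \<forall>x\<in>vcarrier X. R (vscale X c x) = vscale Y c (R x))"

definition bounded_linear_map :: "'a nspace \<Rightarrow> 'b nspace \<Rightarrow> ('a \<Rightarrow> 'b) \<Rightarrow> bool" where
  "bounded_linear_map X Y R \<longleftrightarrow>
     linear_map X Y R \<and> (\<exists>B. \<forall>x\<in>vcarrier X. vnorm Y (R x) \<le> B * vnorm X x)"

definition op_norm :: "'a nspace \<Rightarrow> 'b nspace \<Rightarrow> ('a \<Rightarrow> 'b) \<Rightarrow> real" where
  "op_norm X Y R = Sup {vnorm Y (R x) | x. x \<in> vcarrier X \<and> vnorm X x \<le> 1}"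

definition isometric_iso :: "'a nspace \<Rightarrow> 'b nspace \<Rightarrow> ('a \<Rightarrow> 'b) \<Rightarrow> bool" where
  "isometric_iso X Y R \<longleftrightarrow>
     linear_map X Y R \<and> bij_betw R (vcarrier X) (vcarrier Y) \<and>
     (\<forall>x\<in>vcarrier X. vnorm Y (R x) = vnorm X x)"


section \<open>Scalar functions on a Banach space\<close>

text \<open>
  A function from \<open>X\<close> to the complex numbers is represented by the total function that agrees with
  it on the carrier and vanishes elsewhere, so that equality and the vector space operations are the
  pointwise ones of \<open>'a \<Rightarrow> complex\<close>.
\<close>

definition scalar_funs :: "('a, 'm) vspace_scheme \<Rightarrow> ('a \<Rightarrow> complex) set" where
  "scalar_funs X = {f. \<forall>x. x \<notin> vcarrier X \<longrightarrow> f x = 0}"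

definition restr :: "('a, 'm) vspace_scheme \<Rightarrow> ('a \<Rightarrow> complex) \<Rightarrow> ('a \<Rightarrow> complex)" where
  "restr X f = (\<lambda>x. if x \<in> vcarrier X then f x else 0)"

definition fscale :: "complex \<Rightarrow> ('a \<Rightarrow> complex) \<Rightarrow> ('a \<Rightarrow> complex)" where
  "fscale c f = (\<lambda>x. c * f x)"

definition fun_vspace :: "('a \<Rightarrow> complex) set \<Rightarrow> ('a \<Rightarrow> complex) vspace" where
  "fun_vspace S = \<lparr>vcarrier = S, vadd = (+), vzero = 0, vscale = fscale\<rparr>"

definition fun_nspace ::
    "('a \<Rightarrow> complex) set \<Rightarrow> (('a \<Rightarrow> complex) \<Rightarrow> real) \<Rightarrow> ('a \<Rightarrow> complex) nspace" where
  "fun_nspace S N = \<lparr>vcarrier = S, vadd = (+), vzero = 0, vscale = fscale, vnorm = N\<rparr>"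

definition dual :: "'a nspace \<Rightarrow> ('a \<Rightarrow> complex) set" where
  "dual X = {\<gamma> \<in> scalar_funs X. bounded_linear_map X complex_space \<gamma>}"

abbreviation dual_norm :: "'a nspace \<Rightarrow> ('a \<Rightarrow> complex) \<Rightarrow> real" where
  "dual_norm X \<equiv> op_norm X complex_space"

definition dual_space :: "'a nspace \<Rightarrow> ('a \<Rightarrow> complex) nspace" where
  "dual_space X = fun_nspace (dual X) (dual_norm X)"


section \<open>Homogeneous polynomials\<close>

text \<open>A \<open>k\<close>-linear form takes its arguments as a list of length \<open>k\<close>.\<close>

definition multilinear_form :: "nat \<Rightarrow> 'a nspace \<Rightarrow> ('a list \<Rightarrow> complex) \<Rightarrow> bool" where
  "multilinear_form k X A \<longleftrightarrow>
     (\<forall>us vs. set us \<subseteq> vcarrier X \<and> set vs \<subseteq> vcarrier X \<and> Suc (length us + length vs) = k \<longrightarrow>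
        linear_map X complex_space (\<lambda>x. A (us @ x # vs)))"

definition symmetric_form :: "nat \<Rightarrow> 'a nspace \<Rightarrow> ('a list \<Rightarrow> complex) \<Rightarrow> bool" where
  "symmetric_form k X A \<longleftrightarrow>
     (\<forall>xs ys. set xs \<subseteq> vcarrier X \<and> length xs = k \<and> mset ys = mset xs \<longrightarrow> A ys = A xs)"

definition homog_polys :: "nat \<Rightarrow> 'a nspace \<Rightarrow> ('a \<Rightarrow> complex) set" where
  "homog_polys k X = {P \<in> scalar_funs X.
     (\<exists>A. multilinear_form k X A \<and> (\<forall>x\<in>vcarrier X. P x = A (replicate k x))) \<and>
     continuous_map (vtopology X) euclidean P}"

text \<open>
  The last condition fixes the values on lists that are not \<open>k\<close>-tuples of vectors; without it
  the description would not be unique.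
\<close>

definition polar_form :: "nat \<Rightarrow> 'a nspace \<Rightarrow> ('a \<Rightarrow> complex) \<Rightarrow> 'a list \<Rightarrow> complex" where
  "polar_form k X P = (THE A. multilinear_form k X A \<and> symmetric_form k X A \<and>
     (\<forall>x\<in>vcarrier X. P x = A (replicate k x)) \<and>
     (\<forall>xs. \<not> (length xs = k \<and> set xs \<subseteq> vcarrier X) \<longrightarrow> A xs = 0))"

text \<open>\<open>poly_at k X P j a\<close> is the polynomial \<open>P\<^bsub>a\<^sup>j\<^esub>\<close> for \<open>P\<close> of degree \<open>k\<close>.\<close>

definition poly_at ::
    "nat \<Rightarrow> 'a nspace \<Rightarrow> ('a \<Rightarrow> complex) \<Rightarrow> nat \<Rightarrow> 'a \<Rightarrow> ('a \<Rightarrow> complex)" where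
  "poly_at k X P j a =
     restr X (\<lambda>x. polar_form k X P (replicate j a @ replicate (k - j) x))"

definition finite_type_polys :: "nat \<Rightarrow> 'a nspace \<Rightarrow> ('a \<Rightarrow> complex) set" where
  "finite_type_polys k X =
     module.span fscale {restr X (\<lambda>x. \<gamma> x ^ k) | \<gamma>. \<gamma> \<in> dual X}"


section \<open>Holomorphic functions\<close>

definition power_series_expansion ::
    "'a nspace \<Rightarrow> ('a \<Rightarrow> complex) \<Rightarrow> 'a \<Rightarrow> (nat \<Rightarrow> 'a \<Rightarrow> complex) \<Rightarrow> bool" where
  "power_series_expansion X f a P \<longleftrightarrow>
     (\<forall>k. P k \<in> homog_polys k X) \<and>
     (\<exists>r>0. uniform_limit (vball X a r) (\<lambda>n x. \<Sum>k<n. P k (vdiff X x a)) f sequentially)"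

definition holomorphic_funs :: "'a nspace \<Rightarrow> ('a \<Rightarrow> complex) set" where
  "holomorphic_funs X =
     {f \<in> scalar_funs X. \<forall>a\<in>vcarrier X. \<exists>P. power_series_expansion X f a P}"

text \<open>\<open>taylor_term X f k\<close> is \<open>d\<^sup>kf(0)/k!\<close> and \<open>deriv_zero X f k\<close> is \<open>d\<^sup>kf(0)\<close>.\<close>

definition taylor_term :: "'a nspace \<Rightarrow> ('a \<Rightarrow> complex) \<Rightarrow> nat \<Rightarrow> ('a \<Rightarrow> complex)" where
  "taylor_term X f = (THE P. power_series_expansion X f (vzero X) P)"

definition deriv_zero :: "'a nspace \<Rightarrow> ('a \<Rightarrow> complex) \<Rightarrow> nat \<Rightarrow> ('a \<Rightarrow> complex)" where
  "deriv_zero X f k = fscale (fact k) (taylor_term X f k)"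

definition exp_fun :: "'a nspace \<Rightarrow> ('a \<Rightarrow> complex) \<Rightarrow> ('a \<Rightarrow> complex)" where
  "exp_fun X \<gamma> = restr X (\<lambda>x. exp (\<gamma> x))"

definition translation :: "'a nspace \<Rightarrow> 'a \<Rightarrow> ('a \<Rightarrow> complex) \<Rightarrow> ('a \<Rightarrow> complex)" where
  "translation X x f = restr X (\<lambda>y. f (vadd X x y))"


section \<open>Banach ideals of polynomials and holomorphy types\<close>

text \<open>
  A family of spaces of polynomials assigns to every Banach space a set of scalar functions,
  and a second map assigns to it the norm of the ideal.
\<close>

type_synonym 'u poly_class = "'u nspace \<Rightarrow> ('u \<Rightarrow> complex) set"
type_synonym 'u poly_norm = "'u nspace \<Rightarrow> ('u \<Rightarrow> complex) \<Rightarrow> real"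

text \<open>
  In the third condition, the polynomial \<open>z \<mapsto> z^k\<close> on the complex numbers is transported to the
  isometric copies \<open>L\<close> of the complex numbers in the universe, because the type of complex numbers
  is not itself carried by \<open>'u\<close>. By the second condition the requirement for one copy amounts to
  the requirement for all of them.
\<close>

definition banach_ideal :: "nat \<Rightarrow> 'u poly_class \<Rightarrow> 'u poly_norm \<Rightarrow> bool" where
  "banach_ideal k A N \<longleftrightarrow>
     (\<forall>E. complex_banach_space E \<longrightarrow>
        A E \<subseteq> homog_polys k E \<and> complex_banach_space (fun_nspace (A E) (N E))) \<and>
     (\<forall>E1 E R P. complex_banach_space E1 \<and> complex_banach_space E \<and>
        bounded_linear_map E1 E R \<and> P \<in> A E \<longrightarrow>
        restr E1 (P \<circ> R) \<in> A E1 \<and> N E1 (restr E1 (P \<circ> R)) \<le> N E P * op_norm E1 E R ^ k) \<and>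
     (\<forall>L \<phi>. complex_banach_space L \<and> isometric_iso L complex_space \<phi> \<longrightarrow>
        restr L (\<lambda>z. \<phi> z ^ k) \<in> A L \<and> N L (restr L (\<lambda>z. \<phi> z ^ k)) = 1)"

definition holomorphy_type ::
    "(nat \<Rightarrow> 'u poly_class) \<Rightarrow> (nat \<Rightarrow> 'u poly_norm) \<Rightarrow> bool" where
  "holomorphy_type A N \<longleftrightarrow>
     (\<forall>k. banach_ideal k (A k) (N k)) \<and>
     (\<exists>(c::real) (C :: nat \<Rightarrow> nat \<Rightarrow> real).
        (\<forall>k l. l \<le> k \<longrightarrow> C k l \<le> c ^ k) \<and>
        (\<forall>E k l P a. complex_banach_space E \<and> l \<le> k \<and> P \<in> A k E \<and> a \<in> vcarrier E \<longrightarrow>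
           poly_at k E P l a \<in> A (k - l) E \<and>
           N (k - l) E (poly_at k E P l a) \<le> C k l * N k E P * vnorm E a ^ l))"

abbreviation ideal_space ::
    "(nat \<Rightarrow> 'u poly_class) \<Rightarrow> (nat \<Rightarrow> 'u poly_norm) \<Rightarrow> nat \<Rightarrow> 'u nspace
      \<Rightarrow> ('u \<Rightarrow> complex) nspace" where
  "ideal_space A N k E \<equiv> fun_nspace (A k E) (N k E)"

definition weakly_differentiable ::
    "(nat \<Rightarrow> 'u poly_class) \<Rightarrow> (nat \<Rightarrow> 'u poly_norm) \<Rightarrow> 'u nspace
      \<Rightarrow> (nat \<Rightarrow> nat \<Rightarrow> real) \<Rightarrow> bool" where
  "weakly_differentiable A N E c \<longleftrightarrow>
     (\<forall>k l. l \<le> k \<longrightarrow> c k l > 0 \<and>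
        (\<forall>P \<phi>. P \<in> A k E \<and> \<phi> \<in> dual (ideal_space A N (k - l) E) \<longrightarrow>
           restr E (\<lambda>x. \<phi> (poly_at k E P l x)) \<in> A l E \<and>
           N l E (restr E (\<lambda>x. \<phi> (poly_at k E P l x)))
             \<le> c k l * dual_norm (ideal_space A N (k - l) E) \<phi> * N k E P))"

definition finite_type_dense ::
    "(nat \<Rightarrow> 'u poly_class) \<Rightarrow> (nat \<Rightarrow> 'u poly_norm) \<Rightarrow> nat \<Rightarrow> 'u nspace \<Rightarrow> bool" where
  "finite_type_dense A N k E \<longleftrightarrow>
     finite_type_polys k E \<subseteq> A k E \<and>
     vtopology (ideal_space A N k E) closure_of finite_type_polys k E = A k E"


section \<open>Entire functions of bounded type and of exponential type\<close>

definition bounded_type_funs ::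
    "(nat \<Rightarrow> 'u poly_class) \<Rightarrow> (nat \<Rightarrow> 'u poly_norm) \<Rightarrow> 'u nspace \<Rightarrow> ('u \<Rightarrow> complex) set" where
  "bounded_type_funs A N E = {f \<in> holomorphic_funs E.
     (\<forall>k. deriv_zero E f k \<in> A k E) \<and>
     (\<lambda>k. root k (N k E (taylor_term E f k))) \<longlonglongrightarrow> 0}"

definition bounded_type_seminorm ::
    "(nat \<Rightarrow> 'u poly_norm) \<Rightarrow> 'u nspace \<Rightarrow> real \<Rightarrow> ('u \<Rightarrow> complex) \<Rightarrow> real" where
  "bounded_type_seminorm N E s f = (\<Sum>k. s ^ k * N k E (taylor_term E f k))"

definition seminorm_topology ::
    "('a \<Rightarrow> complex) set \<Rightarrow> ('i \<Rightarrow> ('a \<Rightarrow> complex) \<Rightarrow> real) \<Rightarrow> 'i set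
      \<Rightarrow> ('a \<Rightarrow> complex) topology" where
  "seminorm_topology H p I =
     topology_generated_by {{g \<in> H. p i (g - f) < e} | i f e. i \<in> I \<and> f \<in> H \<and> e > 0}"

definition bounded_type_topology ::
    "(nat \<Rightarrow> 'u poly_class) \<Rightarrow> (nat \<Rightarrow> 'u poly_norm) \<Rightarrow> 'u nspace
      \<Rightarrow> ('u \<Rightarrow> complex) topology" where
  "bounded_type_topology A N E =
     seminorm_topology (bounded_type_funs A N E) (bounded_type_seminorm N E) {0<..}"

definition exp_type_funs ::
    "(nat \<Rightarrow> 'u poly_class) \<Rightarrow> (nat \<Rightarrow> 'u poly_norm) \<Rightarrow> 'u nspace \<Rightarrow> real
      \<Rightarrow> ('u \<Rightarrow> complex) set" where
  "exp_type_funs A N E p = {f \<in> bounded_type_funs A N E.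
     limsup (\<lambda>k. ereal (root k (N k E (deriv_zero E f k)))) \<le> ereal p}"


section \<open>Convolution operators and frequent hypercyclicity\<close>

definition convolution_operator ::
    "(nat \<Rightarrow> 'u poly_class) \<Rightarrow> (nat \<Rightarrow> 'u poly_norm) \<Rightarrow> 'u nspace
      \<Rightarrow> (('u \<Rightarrow> complex) \<Rightarrow> ('u \<Rightarrow> complex)) \<Rightarrow> bool" where
  "convolution_operator A N E T \<longleftrightarrow>
     linear_map (fun_vspace (bounded_type_funs A N E)) (fun_vspace (bounded_type_funs A N E)) T \<and>
     continuous_map (bounded_type_topology A N E) (bounded_type_topology A N E) T \<and>
     (\<forall>x\<in>vcarrier E. \<forall>f\<in>bounded_type_funs A N E.
        T (translation E x f) = translation E x (T f))"

definition trivial_operator ::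
    "('a \<Rightarrow> complex) set \<Rightarrow> (('a \<Rightarrow> complex) \<Rightarrow> ('a \<Rightarrow> complex)) \<Rightarrow> bool" where
  "trivial_operator H T \<longleftrightarrow> (\<exists>c. \<forall>f\<in>H. T f = fscale c f)"

text \<open>
  For a non-trivial convolution operator, \<open>\<gamma> \<mapsto> T(e\<^sup>\<gamma>)(0)\<close> is a non-constant holomorphic function
  on the dual, so that the infimum is over a non-empty set.
\<close>

definition conv_alpha ::
    "'u nspace \<Rightarrow> (('u \<Rightarrow> complex) \<Rightarrow> ('u \<Rightarrow> complex)) \<Rightarrow> real" where
  "conv_alpha E T = Inf {dual_norm E \<gamma> | \<gamma>. \<gamma> \<in> dual E \<and> cmod (T (exp_fun E \<gamma>) (vzero E)) = 1}"

definition lower_density :: "nat set \<Rightarrow> ereal" where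
  "lower_density S = liminf (\<lambda>n. ereal (real (card (S \<inter> {..n})) / real (n + 1)))"

definition frequently_hypercyclic :: "'a topology \<Rightarrow> ('a \<Rightarrow> 'a) \<Rightarrow> 'a \<Rightarrow> bool" where
  "frequently_hypercyclic \<tau> T f \<longleftrightarrow> f \<in> topspace \<tau> \<and>
     (\<forall>U. openin \<tau> U \<and> U \<noteq> {} \<longrightarrow> lower_density {n. (T ^^ n) f \<in> U} > 0)"

end

theory Submission
  imports Defs "HOL-Complex_Analysis.Complex_Analysis"
begin

text \<open>
  Evaluating a convolution operator at the origin shows that every exponential \<open>e\<^sup>\<gamma>\<close> is an eigenvector,
  with an eigenvalue depending holomorphically on \<open>\<gamma>\<close>. For non-trivial \<open>T\<close> this eigenvalue function is
  not constant, so by Picard's theorem it meets the unit circle; choose \<open>\<gamma>\<^sub>0\<close> of norm below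
  \<open>\<alpha>\<^sub>T + \<epsilon>\<close> with unimodular eigenvalue. Near a point where the derivative along a line does not
  vanish the eigenvalue is a local coordinate, and smooth superpositions of eigenvectors over an arc
  of the unit circle have a two-sided orbit under \<open>T\<close> whose terms decay quadratically, because they
  are Fourier coefficients. Shrinking the arcs, the closed span of these superpositions contains
  \<open>e\<^sup>\<gamma>\<close> for all such \<open>\<gamma>\<close>, and by the identity theorem along lines it contains all exponentials,
  hence is the whole space. Adding up suitable backward iterates of a dense sequence
  of such vectors along sparse sets of positive lower density gives the frequently
  hypercyclic function. All functions involved are absolutely convergent series of the monomials
  \<open>\<eta>\<^sup>k e\<^sup>\<gamma> / k!\<close> with \<open>\<parallel>\<gamma>\<parallel> + \<parallel>\<eta>\<parallel> \<le> \<alpha>\<^sub>T + \<epsilon>\<close>, which bounds the exponential type.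
\<close>

section \<open>Normed spaces with explicit carriers\<close>

text \<open>An ideal norm is known only through two facts: \<open>z ^ k\<close> has norm 1 on a copy
  of the complex numbers, and composing with a linear map costs the \<open>k\<close>-th power of its
  norm. This controls powers of a single functional, whereas the Taylor terms of the exponential
  monomials are mixed products of \<gamma> and \<eta>. General polarization constants of size k^k/k!
  would enlarge the exponential type; averaging powers of \<gamma> + w \<eta> over roots of unity w
  costs nothing and yields the radius |\<gamma>| + |\<eta>|. No vector-valued integral is formed.
  The integrand exp(\<gamma> + \<psi>(t) \<eta>) is expanded in powers of \<psi>(t), so a
  superposition over an arc becomes a series of monomials whose coefficients are scalar oscillatory
  integrals. All these orbits live in one fixed radius, yet exponentials of arbitrarily large
  functionals must be approximated. Points of a line tending to its base point suffice: they put
  every Taylor coefficient along the line into the closed span, and the coefficients recover the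
  exponentials on the whole line.\<close>

lemma complex_space_sel [simp]:
  "vcarrier complex_space = UNIV" "vadd complex_space = (+)" "vzero complex_space = 0"
  "vscale complex_space = (*)" "vnorm complex_space = cmod"
  by (simp_all add: complex_space_def)

lemma fun_nspace_sel [simp]:
  "vcarrier (fun_nspace S M) = S" "vadd (fun_nspace S M) = (+)" "vzero (fun_nspace S M) = 0"
  "vscale (fun_nspace S M) = fscale" "vnorm (fun_nspace S M) = M"
  by (simp_all add: fun_nspace_def)

lemma fun_vspace_sel [simp]:
  "vcarrier (fun_vspace S) = S" "vadd (fun_vspace S) = (+)" "vzero (fun_vspace S) = 0"
  "vscale (fun_vspace S) = fscale"
  by (simp_all add: fun_vspace_def)

lemma fscale_apply [simp]: "fscale c f x = c * f x"
  by (simp add: fscale_def)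

lemma fscale_zero_left [simp]: "fscale 0 f = 0"
  and fscale_one [simp]: "fscale 1 f = f"
  and fscale_fscale [simp]: "fscale a (fscale b f) = fscale (a * b) f"
  and fscale_zero_right [simp]: "fscale a 0 = 0"
  by (auto simp: fun_eq_iff)

lemma fun_diff_eq_fscale: "f - g = f + fscale (-1) g"
  by (auto simp: fun_eq_iff)

lemma vdiff_fun [simp]: "vdiff (fun_nspace S M) f g = f - g"
  by (simp add: vdiff_def fun_diff_eq_fscale)

lemma restr_apply [simp]: "x \<in> vcarrier X \<Longrightarrow> restr X f x = f x"
  and restr_outside [simp]: "x \<notin> vcarrier X \<Longrightarrow> restr X f x = 0"
  by (simp_all add: restr_def)

lemma restr_scalar_funs [simp]: "restr X f \<in> scalar_funs X"
  by (simp add: scalar_funs_def)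

lemma scalar_funs_add: "f \<in> scalar_funs X \<Longrightarrow> g \<in> scalar_funs X \<Longrightarrow> f + g \<in> scalar_funs X"
  and scalar_funs_fscale: "f \<in> scalar_funs X \<Longrightarrow> fscale c f \<in> scalar_funs X"
  by (simp_all add: scalar_funs_def)

lemma scalar_funs_eqI:
  assumes "f \<in> scalar_funs X" "g \<in> scalar_funs X" "\<And>x. x \<in> vcarrier X \<Longrightarrow> f x = g x"
  shows "f = g"
proof
  fix x show "f x = g x"
    using assms by (cases "x \<in> vcarrier X") (auto simp: scalar_funs_def)
qed

lemma sum_fun_apply: "(sum f S) x = (\<Sum>i\<in>S. f i x)"
  for f :: "'i \<Rightarrow> 'a \<Rightarrow> 'b::comm_monoid_add"
  by (induction S rule: infinite_finite_induct) auto

context complex_vector_space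
begin

lemma add_left_cancel:
  assumes "x \<in> vcarrier X" "y \<in> vcarrier X" "z \<in> vcarrier X" "vadd X x y = vadd X x z"
  shows "y = z"
proof -
  obtain w where w: "w \<in> vcarrier X" "vadd X x w = vzero X" using add_inverse assms(1) by blast
  have "vadd X (vadd X w x) y = vadd X (vadd X w x) z"
    using assms w by (simp add: add_assoc)
  then show ?thesis using assms w by (metis add_commute add_zero zero_closed)
qed

lemma zero_add: "x \<in> vcarrier X \<Longrightarrow> vadd X (vzero X) x = x"
  by (metis add_commute add_zero zero_closed)

lemma scale_0: "x \<in> vcarrier X \<Longrightarrow> vscale X 0 x = vzero X"
proof -
  assume x: "x \<in> vcarrier X"
  have "vadd X x (vscale X 0 x) = vadd X x (vzero X)"
    using scale_add_left[OF x, of 1 0] x by (simp add: scale_one add_zero)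
  then show ?thesis using x add_left_cancel scale_closed zero_closed by blast
qed

lemma scale_vzero: "vscale X c (vzero X) = vzero X"
  using scale_0[OF zero_closed] scale_scale[OF zero_closed, of c 0] by simp

lemma vdiff_closed: "x \<in> vcarrier X \<Longrightarrow> y \<in> vcarrier X \<Longrightarrow> vdiff X x y \<in> vcarrier X"
  by (simp add: vdiff_def add_closed scale_closed)

lemma vdiff_self: "x \<in> vcarrier X \<Longrightarrow> vdiff X x x = vzero X"
  using scale_add_left[of x 1 "-1"] by (simp add: vdiff_def scale_one scale_0)

lemma vdiff_vzero: "x \<in> vcarrier X \<Longrightarrow> vdiff X x (vzero X) = x"
  by (simp add: vdiff_def scale_vzero add_zero)

lemma vadd_vdiff: "x \<in> vcarrier X \<Longrightarrow> a \<in> vcarrier X \<Longrightarrow> vadd X a (vdiff X x a) = x"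
  using vdiff_self[of a]
  by (simp add: vdiff_def) (metis add_assoc add_commute add_zero scale_closed)

lemma vdiff_vadd: "y \<in> vcarrier X \<Longrightarrow> a \<in> vcarrier X \<Longrightarrow> vdiff X (vadd X a y) a = y"
  by (metis add_closed add_left_cancel vadd_vdiff vdiff_closed)

lemma vdiff_eq_vzero: "x \<in> vcarrier X \<Longrightarrow> y \<in> vcarrier X \<Longrightarrow> vdiff X x y = vzero X \<Longrightarrow> x = y"
  by (metis add_zero vadd_vdiff)

lemma vdiff_minus:
  "x \<in> vcarrier X \<Longrightarrow> y \<in> vcarrier X \<Longrightarrow> vscale X (-1) (vdiff X x y) = vdiff X y x"
  by (simp add: vdiff_def scale_add_right scale_closed scale_scale scale_one add_commute)

lemma vdiff_trans:
  assumes "x \<in> vcarrier X" "y \<in> vcarrier X" "z \<in> vcarrier X"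
  shows "vadd X (vdiff X x y) (vdiff X y z) = vdiff X x z"
proof (rule add_left_cancel[of z])
  show "vadd X z (vadd X (vdiff X x y) (vdiff X y z)) = vadd X z (vdiff X x z)"
    using assms by (metis add_assoc add_commute vadd_vdiff vdiff_closed)
qed (use assms in \<open>auto simp: vdiff_closed add_closed\<close>)

end

context complex_normed_space
begin

lemma norm_vzero [simp]: "vnorm X (vzero X) = 0"
  using norm_eq_zero zero_closed by blast

lemma metric: "Metric_space (vcarrier X) (vdist X)"
proof
  fix x y z
  show "0 \<le> vdist X x y" by (auto simp: vdist_def intro: norm_nonneg vdiff_closed)
  show "vdist X x y = vdist X y x"
    using norm_scale[of "vdiff X x y" "-1"]
    by (auto simp: vdist_def vdiff_minus vdiff_closed)
  assume x: "x \<in> vcarrier X" and y: "y \<in> vcarrier X"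
  then show "(vdist X x y = 0) = (x = y)"
    by (auto simp: vdist_def norm_eq_zero vdiff_closed vdiff_self dest: vdiff_eq_vzero)
  assume z: "z \<in> vcarrier X"
  then show "vdist X x z \<le> vdist X x y + vdist X y z"
    using norm_triangle[of "vdiff X x y" "vdiff X y z"] x y
    by (simp add: vdist_def vdiff_closed vdiff_trans)
qed

lemma vball_iff:
  "x \<in> vball X a r \<longleftrightarrow> a \<in> vcarrier X \<and> x \<in> vcarrier X \<and> vnorm X (vdiff X x a) < r"
  using Metric_space.commute[OF metric, of a x]
  by (auto simp: Metric_space.mball_def[OF metric] vdist_def)

end

lemma dualD:
  assumes "\<gamma> \<in> dual X"
  shows dual_add: "\<lbrakk>x \<in> vcarrier X; y \<in> vcarrier X\<rbrakk> \<Longrightarrow> \<gamma> (vadd X x y) = \<gamma> x + \<gamma> y"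
    and dual_scale: "x \<in> vcarrier X \<Longrightarrow> \<gamma> (vscale X c x) = c * \<gamma> x"
    and dual_scalar_funs: "\<gamma> \<in> scalar_funs X"
  using assms by (simp_all add: dual_def bounded_linear_map_def linear_map_def)

context complex_normed_space
begin

lemma op_norm_bound:
  assumes "complex_normed_space Y" "bounded_linear_map X Y R"
  shows op_norm_nonneg: "0 \<le> op_norm X Y R"
    and op_norm_ge: "x \<in> vcarrier X \<Longrightarrow> vnorm Y (R x) \<le> op_norm X Y R * vnorm X x"
proof -
  interpret Y: complex_normed_space Y by fact
  let ?S = "{vnorm Y (R x) | x. x \<in> vcarrier X \<and> vnorm X x \<le> 1}"
  have lin: "linear_map X Y R" using assms by (simp add: bounded_linear_map_def)
  obtain B where B: "\<And>x. x \<in> vcarrier X \<Longrightarrow> vnorm Y (R x) \<le> B * vnorm X x"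
    using assms(2) by (auto simp: bounded_linear_map_def)
  \<comment> \<open>The constant \<open>B\<close> of \<open>bounded_linear_map\<close> may be
    negative, for instance on the zero space, so the unit ball is bounded with
    \<bar>B\<bar>.\<close>
  have "vnorm Y (R x) \<le> \<bar>B\<bar>" if "x \<in> vcarrier X" "vnorm X x \<le> 1" for x
    using B[OF that(1)] norm_nonneg[OF that(1)] that(2)
    by (smt (verit, best) mult_left_le mult_right_mono)
  then have bdd: "bdd_above ?S" by (intro bdd_aboveI[of _ "\<bar>B\<bar>"]) auto
  have "0 \<le> vnorm Y (R (vzero X))"
    using lin zero_closed by (auto simp: linear_map_def intro: Y.norm_nonneg)
  also have "\<dots> \<le> op_norm X Y R"
    unfolding op_norm_def by (intro cSup_upper bdd) (auto intro!: exI[of _ "vzero X"] zero_closed)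
  finally show nn: "0 \<le> op_norm X Y R" .
  show "vnorm Y (R x) \<le> op_norm X Y R * vnorm X x" if x: "x \<in> vcarrier X"
  proof (cases "vnorm X x = 0")
    case True
    then show ?thesis using B[OF x] by simp
  next
    case False
    then have pos: "vnorm X x > 0" using norm_nonneg[OF x] by simp
    let ?y = "vscale X (complex_of_real (inverse (vnorm X x))) x"
    have y: "?y \<in> vcarrier X" using x scale_closed by blast
    have "vnorm X ?y = 1" using x pos by (simp add: norm_scale norm_inverse)
    then have "vnorm Y (R ?y) \<le> op_norm X Y R"
      unfolding op_norm_def by (intro cSup_upper bdd) (use y in auto)
    moreover have "vnorm Y (R ?y) = inverse (vnorm X x) * vnorm Y (R x)"
      using lin x pos by (simp add: linear_map_def Y.norm_scale norm_inverse)
    ultimately have "inverse (vnorm X x) * vnorm Y (R x) \<le> op_norm X Y R" by simp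
    then show ?thesis using pos by (simp add: field_simps)
  qed
qed

lemma op_norm_le:
  assumes "0 \<le> B" "\<And>x. x \<in> vcarrier X \<Longrightarrow> vnorm Y (R x) \<le> B * vnorm X x"
  shows "op_norm X Y R \<le> B"
  unfolding op_norm_def
proof (rule cSup_least)
  show "{vnorm Y (R x) | x. x \<in> vcarrier X \<and> vnorm X x \<le> 1} \<noteq> {}"
    using zero_closed norm_vzero by (auto intro!: exI[of _ "vzero X"])
  fix v assume "v \<in> {vnorm Y (R x) | x. x \<in> vcarrier X \<and> vnorm X x \<le> 1}"
  then obtain x where x: "x \<in> vcarrier X" "vnorm X x \<le> 1" "v = vnorm Y (R x)" by auto
  then show "v \<le> B" using assms(2)[OF x(1)] mult_left_mono[OF x(2) assms(1)] by simp
qed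

end

lemma complex_normed_space_complex: "complex_normed_space complex_space"
  by unfold_locales (auto simp: algebra_simps norm_mult norm_triangle_ineq intro: exI[of _ "- x" for x])

context complex_normed_space
begin

lemma dual_norm_nonneg: "\<gamma> \<in> dual X \<Longrightarrow> 0 \<le> dual_norm X \<gamma>"
  and dual_norm_ge: "\<gamma> \<in> dual X \<Longrightarrow> x \<in> vcarrier X \<Longrightarrow> cmod (\<gamma> x) \<le> dual_norm X \<gamma> * vnorm X x"
  using op_norm_bound[OF complex_normed_space_complex, of \<gamma>] by (auto simp: dual_def)

lemma dual_norm_le:
  "0 \<le> B \<Longrightarrow> (\<And>x. x \<in> vcarrier X \<Longrightarrow> cmod (\<gamma> x) \<le> B * vnorm X x) \<Longrightarrow> dual_norm X \<gamma> \<le> B"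
  using op_norm_le[of B complex_space \<gamma>] by simp

lemma dualI:
  assumes "\<gamma> \<in> scalar_funs X"
    "\<And>x y. \<lbrakk>x \<in> vcarrier X; y \<in> vcarrier X\<rbrakk> \<Longrightarrow> \<gamma> (vadd X x y) = \<gamma> x + \<gamma> y"
    "\<And>c x. x \<in> vcarrier X \<Longrightarrow> \<gamma> (vscale X c x) = c * \<gamma> x"
    "\<And>x. x \<in> vcarrier X \<Longrightarrow> cmod (\<gamma> x) \<le> B * vnorm X x"
  shows "\<gamma> \<in> dual X"
  using assms unfolding dual_def bounded_linear_map_def linear_map_def by simp blast

lemma dual_plus: "\<gamma> \<in> dual X \<Longrightarrow> \<eta> \<in> dual X \<Longrightarrow> \<gamma> + \<eta> \<in> dual X"
  and dual_norm_triangle: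
    "\<gamma> \<in> dual X \<Longrightarrow> \<eta> \<in> dual X \<Longrightarrow> dual_norm X (\<gamma> + \<eta>) \<le> dual_norm X \<gamma> + dual_norm X \<eta>"
proof -
  assume g: "\<gamma> \<in> dual X" and h: "\<eta> \<in> dual X"
  have *: "cmod ((\<gamma> + \<eta>) x) \<le> (dual_norm X \<gamma> + dual_norm X \<eta>) * vnorm X x"
    if "x \<in> vcarrier X" for x
    using dual_norm_ge[OF g that] dual_norm_ge[OF h that] norm_triangle_ineq[of "\<gamma> x" "\<eta> x"]
    by (simp add: distrib_right)
  show "\<gamma> + \<eta> \<in> dual X"
    by (rule dualI[where \<gamma> = "\<gamma> + \<eta>", OF _ _ _ *])
      (use g h in \<open>auto simp: dual_add dual_scale distrib_left scalar_funs_add dual_scalar_funs\<close>)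
  show "dual_norm X (\<gamma> + \<eta>) \<le> dual_norm X \<gamma> + dual_norm X \<eta>"
    using * by (intro dual_norm_le) (auto simp: dual_norm_nonneg g h)
qed

lemma dual_fscale: "\<gamma> \<in> dual X \<Longrightarrow> fscale c \<gamma> \<in> dual X"
  and dual_norm_fscale: "\<gamma> \<in> dual X \<Longrightarrow> dual_norm X (fscale c \<gamma>) = cmod c * dual_norm X \<gamma>"
proof -
  have *: "cmod (fscale c \<gamma> x) \<le> cmod c * dual_norm X \<gamma> * vnorm X x"
    if "\<gamma> \<in> dual X" "x \<in> vcarrier X" for x c \<gamma>
    using dual_norm_ge[OF that] by (simp add: norm_mult mult_left_mono mult.assoc)
  have 1: "fscale c \<gamma> \<in> dual X" if "\<gamma> \<in> dual X" for c \<gamma>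
    by (rule dualI[where \<gamma> = "fscale c \<gamma>", OF _ _ _ *])
      (use that in \<open>auto simp: dual_add dual_scale distrib_left scalar_funs_fscale dual_scalar_funs\<close>)
  have le: "dual_norm X (fscale c \<gamma>) \<le> cmod c * dual_norm X \<gamma>" if "\<gamma> \<in> dual X" for c \<gamma>
    using *[OF that] by (intro dual_norm_le) (auto simp: dual_norm_nonneg that)
  assume g: "\<gamma> \<in> dual X"
  show "fscale c \<gamma> \<in> dual X" by (rule 1[OF g])
  show "dual_norm X (fscale c \<gamma>) = cmod c * dual_norm X \<gamma>"
  proof (cases "c = 0")
    case True
    then show ?thesis using le[OF g, of 0] dual_norm_nonneg[OF 1[OF g, of 0]] by simp
  next
    case False
    \<comment> \<open>The reverse inequality is the estimate \<open>le\<close> for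
      \<open>fscale c \<gamma>\<close> and the scalar \<open>inverse c\<close>.\<close>
    then have "dual_norm X \<gamma> \<le> inverse (cmod c) * dual_norm X (fscale c \<gamma>)"
      using le[OF 1[OF g, of c], of "inverse c"] by (simp add: norm_inverse)
    then show ?thesis using le[OF g, of c] False by (simp add: field_simps)
  qed
qed

lemma dual_zero: "0 \<in> dual X"
  by (rule dualI[of _ 0]) (auto simp: scalar_funs_def)

lemma dual_norm_zero [simp]: "dual_norm X 0 = 0"
  using dual_norm_fscale[OF dual_zero, of 0] by simp

lemma dual_vzero: "\<gamma> \<in> dual X \<Longrightarrow> \<gamma> (vzero X) = 0"
  using dual_scale[of \<gamma> X "vzero X" 0] zero_closed scale_vzero by simp

lemma dual_norm_eq_zero:
  assumes "\<gamma> \<in> dual X" "dual_norm X \<gamma> = 0" shows "\<gamma> = 0"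
proof
  fix x show "\<gamma> x = 0 x"
    using dual_norm_ge[OF assms(1), of x] assms dual_scalar_funs[OF assms(1)]
    by (cases "x \<in> vcarrier X") (auto simp: scalar_funs_def)
qed

lemma dual_space_normed: "complex_normed_space (dual_space X)"
proof
  fix \<gamma> assume g: "\<gamma> \<in> vcarrier (dual_space X)"
  then have "\<gamma> + fscale (-1) \<gamma> = 0" by (auto simp: fun_eq_iff)
  then show "\<exists>y\<in>vcarrier (dual_space X). vadd (dual_space X) \<gamma> y = vzero (dual_space X)"
    using g dual_fscale[of \<gamma> "-1"] by (auto simp: dual_space_def)
next
  fix \<gamma> assume "\<gamma> \<in> vcarrier (dual_space X)"
  then show "vnorm (dual_space X) \<gamma> = 0 \<longleftrightarrow> \<gamma> = vzero (dual_space X)"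
    using dual_norm_eq_zero by (auto simp: dual_space_def)
qed (auto simp: dual_space_def dual_plus dual_zero dual_fscale dual_norm_nonneg
      dual_norm_fscale dual_norm_triangle, auto simp: fun_eq_iff algebra_simps)

end

section \<open>Homogeneous polynomials and power series\<close>

text \<open>The multilinear form behind a polynomial need not be symmetric, so the scalar is pulled
  out of one slot after the other, from the left.\<close>

lemma homog_poly_scale:
  assumes "complex_vector_space X" "P \<in> homog_polys k X" "x \<in> vcarrier X"
  shows "P (vscale X t x) = t ^ k * P x"
proof -
  interpret complex_vector_space X by fact
  obtain A where A: "multilinear_form k X A" "\<And>x. x \<in> vcarrier X \<Longrightarrow> P x = A (replicate k x)"
    using assms by (auto simp: homog_polys_def)
  let ?y = "vscale X t x"
  have y: "?y \<in> vcarrier X" using assms scale_closed by blast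
  have "i \<le> k \<Longrightarrow> A (replicate i ?y @ replicate (k - i) x) = t ^ i * A (replicate k x)" for i
  proof (induction i)
    case (Suc i)
    let ?us = "replicate i ?y" and ?vs = "replicate (k - Suc i) x"
    have "A (replicate (Suc i) ?y @ ?vs) = A (?us @ ?y # ?vs)"
      by (metis append.assoc append_Cons append_Nil replicate_Suc replicate_append_same)
    also have "\<dots> = t * A (?us @ x # ?vs)"
    proof -
      have "set ?us \<subseteq> vcarrier X \<and> set ?vs \<subseteq> vcarrier X \<and> Suc (length ?us + length ?vs) = k"
        using assms(3) y Suc.prems by auto
      then have "linear_map X complex_space (\<lambda>z. A (?us @ z # ?vs))"
        using A(1) unfolding multilinear_form_def by blast
      then show ?thesis using assms(3) by (simp add: linear_map_def)
    qed
    also have "?us @ x # ?vs = ?us @ replicate (k - i) x"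
      using Suc.prems by (metis Suc_diff_Suc Suc_le_lessD replicate_Suc)
    finally show ?case using Suc by simp
  qed simp
  from this[of k] show ?thesis using A(2)[OF y] A(2)[OF assms(3)] by simp
qed

lemma homog_polys_add:
  assumes "P \<in> homog_polys k X" "Q \<in> homog_polys k X" shows "P + Q \<in> homog_polys k X"
proof -
  obtain A B where "multilinear_form k X A" "\<And>x. x \<in> vcarrier X \<Longrightarrow> P x = A (replicate k x)"
    "multilinear_form k X B" "\<And>x. x \<in> vcarrier X \<Longrightarrow> Q x = B (replicate k x)"
    using assms by (auto simp: homog_polys_def)
  then have "multilinear_form k X (A + B)" "\<And>x. x \<in> vcarrier X \<Longrightarrow> (P + Q) x = (A + B) (replicate k x)"
    by (auto simp: multilinear_form_def linear_map_def algebra_simps)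
  moreover have "continuous_map (vtopology X) euclidean (\<lambda>x. P x + Q x)"
    using assms by (intro continuous_map_add) (auto simp: homog_polys_def)
  moreover have "P + Q \<in> scalar_funs X"
    using assms by (auto simp: homog_polys_def intro: scalar_funs_add)
  ultimately show ?thesis
    unfolding homog_polys_def by (auto simp: plus_fun_def)
qed

lemma homog_polys_fscale:
  assumes "P \<in> homog_polys k X" shows "fscale c P \<in> homog_polys k X"
proof -
  obtain A where "multilinear_form k X A" "\<And>x. x \<in> vcarrier X \<Longrightarrow> P x = A (replicate k x)"
    using assms by (auto simp: homog_polys_def)
  then have "multilinear_form k X (fscale c A)" "\<And>x. x \<in> vcarrier X \<Longrightarrow> fscale c P x = (fscale c A) (replicate k x)"
    by (auto simp: multilinear_form_def linear_map_def algebra_simps)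
  moreover have "continuous_map (vtopology X) euclidean (\<lambda>x. c * P x)"
    using continuous_map_compose[of "vtopology X" euclidean P euclidean "\<lambda>z. c * z"] assms
    by (auto simp: homog_polys_def o_def intro!: continuous_intros)
  moreover have "fscale c P \<in> scalar_funs X"
    using assms by (auto simp: homog_polys_def intro: scalar_funs_fscale)
  ultimately show ?thesis
    unfolding homog_polys_def by (auto simp: fscale_def)
qed

lemma power_series_add:
  assumes "power_series_expansion X f a P" "power_series_expansion X g a Q" "complex_normed_space X"
  shows "power_series_expansion X (f + g) a (\<lambda>k. P k + Q k)"
proof -
  interpret complex_normed_space X by fact
  obtain r where r: "r > 0" "uniform_limit (vball X a r) (\<lambda>n x. \<Sum>k<n. P k (vdiff X x a)) f sequentially"
    using assms by (auto simp: power_series_expansion_def)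
  obtain s where s: "s > 0" "uniform_limit (vball X a s) (\<lambda>n x. \<Sum>k<n. Q k (vdiff X x a)) g sequentially"
    using assms by (auto simp: power_series_expansion_def)
  have "uniform_limit (vball X a (min r s))
      (\<lambda>n x. (\<Sum>k<n. P k (vdiff X x a)) + (\<Sum>k<n. Q k (vdiff X x a))) (\<lambda>x. f x + g x) sequentially"
    by (intro uniform_limit_add uniform_limit_on_subset[OF r(2)] uniform_limit_on_subset[OF s(2)])
      (auto simp: vball_iff)
  then have "uniform_limit (vball X a (min r s)) (\<lambda>n x. \<Sum>k<n. (P k + Q k) (vdiff X x a)) (f + g) sequentially"
    by (simp add: sum.distrib plus_fun_def)
  moreover have "\<forall>k. P k + Q k \<in> homog_polys k X"
    using assms by (auto simp: power_series_expansion_def intro: homog_polys_add)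
  ultimately show ?thesis using r(1) s(1)
    unfolding power_series_expansion_def by (intro conjI exI[of _ "min r s"]) auto
qed

lemma power_series_fscale:
  assumes "power_series_expansion X f a P"
  shows "power_series_expansion X (fscale c f) a (\<lambda>k. fscale c (P k))"
proof -
  obtain r where r: "r > 0" "uniform_limit (vball X a r) (\<lambda>n x. \<Sum>k<n. P k (vdiff X x a)) f sequentially"
    using assms by (auto simp: power_series_expansion_def)
  have "uniform_limit (vball X a r) (\<lambda>n x. c * (\<Sum>k<n. P k (vdiff X x a))) (\<lambda>x. c * f x) sequentially"
    by (rule bounded_linear.uniform_limit[OF bounded_linear_mult_right r(2)])
  then have "uniform_limit (vball X a r) (\<lambda>n x. \<Sum>k<n. fscale c (P k) (vdiff X x a)) (fscale c f) sequentially"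
    by (simp add: sum_distrib_left fscale_def)
  moreover have "\<forall>k. fscale c (P k) \<in> homog_polys k X"
    using assms by (auto simp: power_series_expansion_def intro: homog_polys_fscale)
  ultimately show ?thesis using r(1)
    unfolding power_series_expansion_def by (intro conjI exI[of _ r]) auto
qed

text \<open>Restriction to a complex line turns an expansion into a power series in one variable.
  The radius \<open>r / (1 + vnorm X x)\<close> keeps t x inside the ball of uniform convergence,
  also for x = 0.\<close>

lemma power_series_sums_line:
  assumes "complex_normed_space X" "power_series_expansion X f a P" "a \<in> vcarrier X" "x \<in> vcarrier X"
  shows "\<exists>s>0. \<forall>t. cmod t < s \<longrightarrow> (\<lambda>k. P k x * t ^ k) sums f (vadd X a (vscale X t x))"
proof -
  interpret complex_normed_space X by fact
  obtain r where r: "r > 0" "uniform_limit (vball X a r) (\<lambda>n x. \<Sum>k<n. P k (vdiff X x a)) f sequentially"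
    and P: "\<And>k. P k \<in> homog_polys k X"
    using assms by (auto simp: power_series_expansion_def)
  let ?s = "r / (1 + vnorm X x)"
  have n: "1 + vnorm X x > 0" using norm_nonneg[OF assms(4)] by simp
  show ?thesis
  proof (intro exI[of _ ?s] conjI allI impI)
    show "?s > 0" using r n by simp
    fix t :: complex assume "cmod t < ?s"
    then have t: "cmod t * (1 + vnorm X x) < r" using n by (simp add: field_simps)
    let ?y = "vscale X t x"
    have y: "?y \<in> vcarrier X" using assms scale_closed by blast
    have "vnorm X ?y < r"
      using t assms(4) by (simp add: norm_scale distrib_left) (smt (verit) norm_ge_zero)
    then have "vadd X a ?y \<in> vball X a r"
      using assms y by (simp add: vball_iff add_closed vdiff_vadd)
    from tendsto_uniform_limitI[OF r(2) this]
    have "(\<lambda>n. \<Sum>k<n. P k ?y) \<longlonglongrightarrow> f (vadd X a ?y)"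
      using assms y by (simp add: vdiff_vadd)
    then show "(\<lambda>k. P k x * t ^ k) sums f (vadd X a ?y)"
      using homog_poly_scale[OF complex_vector_space_axioms P assms(4), of _ t]
      by (simp add: sums_def mult.commute)
  qed
qed

text \<open>A non-zero coefficient of positive index would make the zeros of the sum isolated at 0,
  which the zero function contradicts; index 0 is evaluation at 0 and is settled separately.\<close>

lemma powser_sums_zero_coeffs:
  fixes a :: "nat \<Rightarrow> complex"
  assumes "s > 0" "\<And>t. cmod t < s \<Longrightarrow> (\<lambda>k. a k * t ^ k) sums 0"
  shows "a k = 0"
proof (rule ccontr)
  assume nz: "a k \<noteq> 0"
  have a0: "a 0 = 0" using assms(2)[of 0] assms(1) powser_sums_zero_iff[of a 0] by simp
  then have k: "k > 0" using nz by (cases k) auto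
  show False
  proof (rule powser_0_nonzero[where f = "\<lambda>_. 0" and \<xi> = 0 and a = a, OF assms(1) _ refl nz k])
    show "(\<lambda>n. a n * (x - 0) ^ n) sums 0" if "norm (x - 0) < s" for x
      using assms(2)[of x] that by simp
    fix d :: real assume d: "d > 0" "\<And>z::complex. z \<in> cball 0 d - {0} \<Longrightarrow> (0::complex) \<noteq> 0"
    from d(1) have "complex_of_real d \<in> cball 0 d - {0}" by auto
    from d(2)[OF this] show False by simp
  qed
qed

text \<open>Comparing coefficients on every line through the origin gives uniqueness, and with it a
  meaning to the definite description in \<open>taylor_term\<close>.\<close>

lemma power_series_unique:
  assumes "complex_normed_space X" "power_series_expansion X f (vzero X) P"
    "power_series_expansion X f (vzero X) Q"
  shows "P = Q"
proof
  fix k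
  interpret complex_normed_space X by fact
  have PQ: "P k \<in> homog_polys k X" "Q k \<in> homog_polys k X"
    using assms by (auto simp: power_series_expansion_def)
  show "P k = Q k"
  proof (rule scalar_funs_eqI)
    show "P k \<in> scalar_funs X" "Q k \<in> scalar_funs X" using PQ by (auto simp: homog_polys_def)
    fix x assume x: "x \<in> vcarrier X"
    obtain s1 where s1: "s1 > 0"
      "\<And>t. cmod t < s1 \<Longrightarrow> (\<lambda>k. P k x * t ^ k) sums f (vadd X (vzero X) (vscale X t x))"
      using power_series_sums_line[OF assms(1,2) zero_closed x] by auto
    obtain s2 where s2: "s2 > 0"
      "\<And>t. cmod t < s2 \<Longrightarrow> (\<lambda>k. Q k x * t ^ k) sums f (vadd X (vzero X) (vscale X t x))"
      using power_series_sums_line[OF assms(1,3) zero_closed x] by auto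
    have "(\<lambda>k. (P k x - Q k x) * t ^ k) sums 0" if "cmod t < min s1 s2" for t
      using sums_diff[OF s1(2)[of t] s2(2)[of t]] that by (simp add: left_diff_distrib)
    from powser_sums_zero_coeffs[of "min s1 s2", OF _ this, of k] s1(1) s2(1)
    show "P k x = Q k x" by simp
  qed
qed

lemma taylor_term_eq:
  assumes "complex_normed_space X" "power_series_expansion X f (vzero X) P"
  shows "taylor_term X f = P"
  unfolding taylor_term_def
  by (rule the_equality, rule assms(2), rule power_series_unique[OF assms(1) _ assms(2)])

lemma power_series_taylor:
  assumes "complex_normed_space X" "f \<in> holomorphic_funs X"
  shows "power_series_expansion X f (vzero X) (taylor_term X f)"
proof -
  interpret complex_normed_space X by fact
  obtain P where "power_series_expansion X f (vzero X) P"
    using assms(2) zero_closed by (auto simp: holomorphic_funs_def)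
  then show ?thesis using taylor_term_eq[OF assms(1)] by metis
qed

lemma holomorphic_funs_add:
  assumes "complex_normed_space X" "f \<in> holomorphic_funs X" "g \<in> holomorphic_funs X"
  shows "f + g \<in> holomorphic_funs X"
  using assms power_series_add[OF _ _ assms(1)] unfolding holomorphic_funs_def
  by (blast intro: scalar_funs_add)

lemma holomorphic_funs_fscale:
  assumes "f \<in> holomorphic_funs X"
  shows "fscale c f \<in> holomorphic_funs X"
proof -
  have "\<exists>P. power_series_expansion X (fscale c f) a P" if a: "a \<in> vcarrier X" for a
  proof -
    obtain P where "power_series_expansion X f a P" using assms a by (auto simp: holomorphic_funs_def)
    show ?thesis by (rule exI, rule power_series_fscale, fact)
  qed
  then show ?thesis using assms by (auto simp: holomorphic_funs_def intro: scalar_funs_fscale)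
qed

lemma taylor_term_add:
  assumes "complex_normed_space X" "f \<in> holomorphic_funs X" "g \<in> holomorphic_funs X"
  shows "taylor_term X (f + g) k = taylor_term X f k + taylor_term X g k"
  using taylor_term_eq[OF assms(1) power_series_add[OF power_series_taylor power_series_taylor]] assms
  by simp

lemma taylor_term_fscale:
  assumes "complex_normed_space X" "f \<in> holomorphic_funs X"
  shows "taylor_term X (fscale c f) k = fscale c (taylor_term X f k)"
  using taylor_term_eq[OF assms(1) power_series_fscale[OF power_series_taylor]] assms by simp

lemma taylor_term_0_vzero:
  assumes "complex_normed_space X" "f \<in> holomorphic_funs X"
  shows "taylor_term X f 0 (vzero X) = f (vzero X)"
proof -
  interpret complex_normed_space X by fact
  obtain s where s: "s > 0" "\<And>t. cmod t < s \<Longrightarrow>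
      (\<lambda>k. taylor_term X f k (vzero X) * t ^ k) sums f (vadd X (vzero X) (vscale X t (vzero X)))"
    using power_series_sums_line[OF assms(1) power_series_taylor[OF assms] zero_closed zero_closed] by auto
  from s(2)[of 0] s(1) show ?thesis
    using powser_sums_zero_iff[of "\<lambda>k. taylor_term X f k (vzero X)"]
    by (simp add: scale_vzero add_zero zero_closed)
qed

text \<open>On a complex line through the origin a holomorphic function is entire, which makes the
  identity theorem available although the expansions are only known to converge locally.\<close>

lemma holomorphic_funs_line:
  assumes "complex_normed_space X" "f \<in> holomorphic_funs X" "x \<in> vcarrier X"
  shows "(\<lambda>t. f (vscale X t x)) holomorphic_on UNIV"
proof -
  interpret complex_normed_space X by fact
  have "(\<lambda>t. f (vscale X t x)) field_differentiable at t0" for t0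
  proof -
    let ?a = "vscale X t0 x"
    have a: "?a \<in> vcarrier X" using assms scale_closed by blast
    obtain P where "power_series_expansion X f ?a P"
      using assms(2) a by (auto simp: holomorphic_funs_def)
    from power_series_sums_line[OF assms(1) this a assms(3)] obtain s where
      s: "s > 0" "\<And>t. cmod t < s \<Longrightarrow> (\<lambda>k. P k x * t ^ k) sums f (vadd X ?a (vscale X t x))" by auto
    have "(\<lambda>k. P k x * (t - t0) ^ k) sums f (vscale X t x)" if "t \<in> ball t0 s" for t
    proof -
      have "cmod (t - t0) < s" using that by (simp add: dist_norm norm_minus_commute)
      from s(2)[OF this] show ?thesis using scale_add_left[OF assms(3), of t0 "t - t0"] by simp
    qed
    then have "(\<lambda>t. f (vscale X t x)) holomorphic_on ball t0 s"
      by (rule power_series_holomorphic)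
    then show ?thesis using s(1) by (auto simp: holomorphic_on_open field_differentiable_def)
  qed
  then show ?thesis by (simp add: holomorphic_on_def)
qed

text \<open>Vanishing Taylor terms annihilate \<open>f\<close> only near the origin of each line;
  analytic continuation along the line reaches the point x itself.\<close>

lemma holomorphic_funs_eq_zero:
  assumes "complex_normed_space X" "f \<in> holomorphic_funs X" "\<And>k. taylor_term X f k = 0"
  shows "f = 0"
proof (rule scalar_funs_eqI)
  interpret complex_normed_space X by fact
  show "f \<in> scalar_funs X" using assms(2) by (simp add: holomorphic_funs_def)
  show "0 \<in> scalar_funs X" by (simp add: scalar_funs_def)
  fix x assume x: "x \<in> vcarrier X"
  obtain s where s: "s > 0" "\<And>t. cmod t < s \<Longrightarrow>
      (\<lambda>k. taylor_term X f k x * t ^ k) sums f (vadd X (vzero X) (vscale X t x))"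
    using power_series_sums_line[OF assms(1) power_series_taylor[OF assms(1,2)] zero_closed x] by auto
  have z: "f (vscale X t x) = 0" if "cmod t < s" for t
  proof -
    have "(\<lambda>k. 0) sums f (vscale X t x)"
      using s(2)[OF that] assms(3) x by (simp add: zero_add scale_closed)
    then show ?thesis using sums_unique2[OF sums_zero] by metis
  qed
  have "f (vscale X 1 x) = 0"
    by (rule analytic_continuation_open[of "ball 0 s" UNIV "\<lambda>t. f (vscale X t x)" "\<lambda>_. 0"])
      (use s(1) z holomorphic_funs_line[OF assms(1,2) x] in auto)
  then show "f x = 0 x" using x by (simp add: scale_one)
qed

section \<open>Polynomial ideals on a fixed space\<close>

text \<open>Exchanging the roles of root index and exponent makes the sum geometric with ratio
  \<open>w i / w k\<close>, an \<open>M\<close>-th root of unity that equals 1 only for i =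
  k.\<close>

lemma root_unity_filter:
  assumes "i < M" "k < M"
  shows "(\<Sum>j<M. (exp (2 * of_real pi * \<i> * of_nat j / of_nat M) :: complex) ^ i
            / exp (2 * of_real pi * \<i> * of_nat j / of_nat M) ^ k) = (if i = k then of_nat M else 0)"
proof -
  define w where "w i = exp (2 * of_real pi * \<i> * of_nat i / of_nat M)" for i
  have M: "M \<noteq> 0" using assms by auto
  have pw: "exp (2 * of_real pi * \<i> * of_nat j / of_nat M) ^ i = w i ^ j" for i j
    by (simp add: w_def flip: exp_of_nat_mult) (simp add: mult_ac)
  have "(\<Sum>j<M. (exp (2 * of_real pi * \<i> * of_nat j / of_nat M) :: complex) ^ i
            / exp (2 * of_real pi * \<i> * of_nat j / of_nat M) ^ k) = (\<Sum>j<M. (w i / w k) ^ j)"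
    by (simp add: pw power_divide)
  also have "\<dots> = (if i = k then of_nat M else 0)"
  proof (cases "i = k")
    case True
    then show ?thesis by (simp add: w_def)
  next
    case False
    have "w i \<noteq> w k"
      unfolding w_def using False assms complex_root_unity_eq[of M i k] M by (simp add: mult.assoc)
    moreover have "w k \<noteq> 0" by (simp add: w_def)
    ultimately have "w i / w k \<noteq> 1" by simp
    moreover have "(w i / w k) ^ M = 1"
      using complex_root_unity[OF M, of i] complex_root_unity[OF M, of k]
      by (simp add: w_def power_divide)
    ultimately show ?thesis using False geometric_sum[of "w i / w k" M] by simp
  qed
  finally show ?thesis .
qed

text \<open>Averaging over roots of unity extracts one homogeneous component of \<open>(a + b)\<^sup>m\<close> with
  coefficients of modulus one.\<close>

lemma binomial_component:
  fixes a b :: complex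
  assumes "k \<le> m"
  shows "b ^ k * a ^ (m - k) / (fact k * fact (m - k)) =
    (\<Sum>j<Suc m. inverse (exp (2 * of_real pi * \<i> * of_nat j / of_nat (Suc m))) ^ k
        / (of_nat (Suc m) * fact m) * (a + exp (2 * of_real pi * \<i> * of_nat j / of_nat (Suc m)) * b) ^ m)"
proof -
  define w :: "nat \<Rightarrow> complex" where "w j = exp (2 * of_real pi * \<i> * of_nat j / of_nat (Suc m))" for j
  have fil: "(\<Sum>j<Suc m. w j ^ i / w j ^ k) = (if i = k then of_nat (Suc m) else 0)" if "i \<le> m" for i
    unfolding w_def using root_unity_filter[of i "Suc m" k] that assms by (simp del: of_nat_Suc)
  have "(\<Sum>j<Suc m. inverse (w j) ^ k * (a + w j * b) ^ m)
      = (\<Sum>j<Suc m. \<Sum>i\<le>m. (of_nat (m choose i) * b ^ i * a ^ (m - i)) * (w j ^ i / w j ^ k))"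
  proof (rule sum.cong[OF refl])
    fix j
    have "(a + w j * b) ^ m = (\<Sum>i\<le>m. of_nat (m choose i) * (w j * b) ^ i * a ^ (m - i))"
      by (subst add.commute) (rule binomial_ring)
    then show "inverse (w j) ^ k * (a + w j * b) ^ m
        = (\<Sum>i\<le>m. (of_nat (m choose i) * b ^ i * a ^ (m - i)) * (w j ^ i / w j ^ k))"
      by (simp only: sum_distrib_left power_mult_distrib power_inverse divide_inverse mult_ac)
  qed
  also have "\<dots> = (\<Sum>i\<le>m. (of_nat (m choose i) * b ^ i * a ^ (m - i)) * (\<Sum>j<Suc m. w j ^ i / w j ^ k))"
    by (subst sum.swap) (simp add: sum_distrib_left del: sum.lessThan_Suc)
  also have "\<dots> = (\<Sum>i\<le>m. if i = k then of_nat (m choose i) * b ^ i * a ^ (m - i) * of_nat (Suc m) else 0)"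
    by (intro sum.cong) (auto simp: fil simp del: sum.lessThan_Suc of_nat_Suc)
  also have "\<dots> = of_nat (m choose k) * b ^ k * a ^ (m - k) * of_nat (Suc m)"
    using assms by simp
  finally have *: "(\<Sum>j<Suc m. inverse (w j) ^ k * (a + w j * b) ^ m)
      = of_nat (m choose k) * b ^ k * a ^ (m - k) * of_nat (Suc m)" .
  have "(\<Sum>j<Suc m. inverse (w j) ^ k / (of_nat (Suc m) * fact m) * (a + w j * b) ^ m)
      = (\<Sum>j<Suc m. inverse (w j) ^ k * (a + w j * b) ^ m) / (of_nat (Suc m) * fact m)"
    by (simp add: sum_divide_distrib del: sum.lessThan_Suc of_nat_Suc)
  also have "\<dots> = b ^ k * a ^ (m - k) / (fact k * fact (m - k))"
    unfolding * using assms by (simp add: binomial_fact field_simps del: of_nat_Suc)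
  finally show ?thesis by (simp add: w_def)
qed

text \<open>The axioms of an ideal give access to \<open>z \<mapsto> z\<^sup>k\<close> only on copies of the complex numbers inside the
  universe; in a non-zero space every unit vector spans one.\<close>

definition line :: "'a nspace \<Rightarrow> 'a \<Rightarrow> 'a nspace" where
  "line X e = \<lparr>vcarrier = range (\<lambda>z. vscale X z e), vadd = vadd X, vzero = vzero X,
     vscale = vscale X, vnorm = vnorm X\<rparr>"

definition line_coord :: "'a nspace \<Rightarrow> 'a \<Rightarrow> 'a \<Rightarrow> complex" where
  "line_coord X e = inv (\<lambda>z. vscale X z e)"

context complex_normed_space
begin

context
  fixes e assumes e: "e \<in> vcarrier X" "vnorm X e = 1"
begin

lemma line_coord_scale: "line_coord X e (vscale X z e) = z"
proof -
  have "z = w" if eq: "vscale X z e = vscale X w e" for z w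
  proof -
    have "vscale X (z - w) e = vdiff X (vscale X z e) (vscale X w e)"
      using scale_add_left[OF e(1), of z "- w"] scale_scale[OF e(1), of "-1" w] by (simp add: vdiff_def)
    then have "vnorm X (vscale X (z - w) e) = 0"
      using eq e by (simp add: vdiff_self scale_closed)
    then show ?thesis using e by (simp add: norm_scale)
  qed
  then show ?thesis unfolding line_coord_def by (intro inv_f_f injI)
qed

lemma line_sel [simp]:
  "vcarrier (line X e) = range (\<lambda>z. vscale X z e)" "vadd (line X e) = vadd X"
  "vzero (line X e) = vzero X" "vscale (line X e) = vscale X" "vnorm (line X e) = vnorm X"
  by (simp_all add: line_def)

lemma line_scale_add: "vadd X (vscale X z e) (vscale X w e) = vscale X (z + w) e"
  using e scale_add_left by simp

lemma line_subset: "x \<in> range (\<lambda>z. vscale X z e) \<Longrightarrow> x \<in> vcarrier X"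
  using e scale_closed by auto

lemma line_normed: "complex_normed_space (line X e)"
proof
  fix x y c
  assume x: "x \<in> vcarrier (line X e)"
  then obtain z where z: "x = vscale X z e" by auto
  show "vscale (line X e) c x \<in> vcarrier (line X e)"
    using e(1) by (simp add: z scale_scale)
  show "\<exists>y\<in>vcarrier (line X e). vadd (line X e) x y = vzero (line X e)"
    using e(1) by (auto simp: z line_scale_add scale_0 intro!: exI[of _ "-z"])
  assume "y \<in> vcarrier (line X e)"
  then obtain w where "y = vscale X w e" by auto
  then show "vadd (line X e) x y \<in> vcarrier (line X e)" by (simp add: z line_scale_add)
next
  show "vzero (line X e) \<in> vcarrier (line X e)"
    using e scale_0[OF e(1)] by (metis line_sel(1,3) rangeI)
qed (simp_all add: line_subset add_assoc add_zero scale_add_right scale_add_left scale_scale scale_one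
      norm_nonneg norm_eq_zero norm_triangle norm_scale, metis add_commute line_subset)

lemma line_vdist: "vdist (line X e) (vscale X z e) (vscale X w e) = cmod (z - w)"
proof -
  have "vdiff X (vscale X z e) (vscale X w e) = vscale X (z - w) e"
    using scale_add_left[OF e(1), of z "- w"] scale_scale[OF e(1), of "-1" w] by (simp add: vdiff_def)
  then show ?thesis using e by (simp add: vdist_def vdiff_def norm_scale)
qed

text \<open>Completeness is transported from the complex numbers along the isometry z -> z e, so
  that the ideal axioms apply to the line.\<close>

lemma line_banach: "complex_banach_space (line X e)"
proof -
  interpret L: complex_normed_space "line X e" by (rule line_normed)
  interpret M: Metric_space "vcarrier (line X e)" "vdist (line X e)" by (rule L.metric)
  have "M.mcomplete"
    unfolding M.mcomplete_def
  proof (intro allI impI)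
    fix \<sigma> assume \<sigma>: "M.MCauchy \<sigma>"
    then have "\<forall>n. \<exists>z. \<sigma> n = vscale X z e" unfolding M.MCauchy_def by (auto simp: image_subset_iff image_iff)
    then obtain z where z: "\<And>n. \<sigma> n = vscale X (z n) e" by metis
    have "Cauchy z"
      using \<sigma> unfolding M.MCauchy_def by (auto simp: z line_vdist Cauchy_def dist_norm)
    then obtain l where l: "z \<longlonglongrightarrow> l" using Cauchy_convergent convergent_def by blast
    have "limitin M.mtopology \<sigma> (vscale X l e) sequentially"
      using l unfolding M.limit_metric_sequentially by (simp add: z line_vdist lim_sequentially dist_norm)
    then show "\<exists>x. limitin M.mtopology \<sigma> x sequentially" ..
  qed
  then show ?thesis
    using line_normed by (simp add: complex_banach_space_def complex_banach_space_axioms_def)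
qed

lemma line_iso: "isometric_iso (line X e) complex_space (line_coord X e)"
  unfolding isometric_iso_def linear_map_def
  using e by (auto simp: line_coord_scale line_scale_add scale_scale norm_scale
      intro!: bij_betw_byWitness[where f' = "\<lambda>z. vscale X z e"])

end

end

text \<open>The assumption \<open>nonzero\<close> supplies unit vectors, through which copies of the
  complex numbers enter. The zero space is dealt with in
  \<open>trivial_operator_zero_space\<close>.\<close>

locale poly_ideal_space =
  fixes A :: "nat \<Rightarrow> 'u poly_class" and N :: "nat \<Rightarrow> 'u poly_norm" and E :: "'u nspace"
  assumes ideal: "\<And>k. banach_ideal k (A k) (N k)"
    and banach: "complex_banach_space E"
    and finite_type: "\<And>k. finite_type_dense A N k E"
    and nonzero: "\<exists>x\<in>vcarrier E. x \<noteq> vzero E"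
begin

sublocale E: complex_banach_space E by (rule banach)

lemma A_subset: "P \<in> A k E \<Longrightarrow> P \<in> homog_polys k E"
  and A_banach: "complex_banach_space (ideal_space A N k E)"
  using ideal[of k] banach by (auto simp: banach_ideal_def)

lemma A_normed: "complex_normed_space (ideal_space A N k E)"
  using A_banach[of k] by (simp add: complex_banach_space_def)

lemma A_vector: "complex_vector_space (ideal_space A N k E)"
  using A_normed[of k] by (simp add: complex_normed_space_def)

lemma A_scalar_funs: "P \<in> A k E \<Longrightarrow> P \<in> scalar_funs E"
  using A_subset by (auto simp: homog_polys_def)

lemma A_add: "P \<in> A k E \<Longrightarrow> Q \<in> A k E \<Longrightarrow> P + Q \<in> A k E"
  and A_fscale: "P \<in> A k E \<Longrightarrow> fscale c P \<in> A k E"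
  and A_zero: "0 \<in> A k E"
  using complex_vector_space.add_closed[OF A_vector, of P k Q]
    complex_vector_space.scale_closed[OF A_vector, of P k c]
    complex_vector_space.zero_closed[OF A_vector, of k] by simp_all

lemma A_diff: "P \<in> A k E \<Longrightarrow> Q \<in> A k E \<Longrightarrow> P - Q \<in> A k E"
  by (simp add: fun_diff_eq_fscale A_add A_fscale)

lemma N_nonneg: "P \<in> A k E \<Longrightarrow> 0 \<le> N k E P"
  and N_add: "P \<in> A k E \<Longrightarrow> Q \<in> A k E \<Longrightarrow> N k E (P + Q) \<le> N k E P + N k E Q"
  and N_fscale: "P \<in> A k E \<Longrightarrow> N k E (fscale c P) = cmod c * N k E P"
  and N_zero [simp]: "N k E 0 = 0"
  and N_eq_zero: "P \<in> A k E \<Longrightarrow> N k E P = 0 \<Longrightarrow> P = 0"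
  using complex_normed_space.norm_nonneg[OF A_normed, of P k]
    complex_normed_space.norm_triangle[OF A_normed, of P k Q]
    complex_normed_space.norm_scale[OF A_normed, of P k c]
    complex_normed_space.norm_vzero[OF A_normed, of k]
    complex_normed_space.norm_eq_zero[OF A_normed, of P k] by simp_all

lemma A_sum: "(\<And>i. i \<in> I \<Longrightarrow> P i \<in> A k E) \<Longrightarrow> sum P I \<in> A k E"
  by (induction I rule: infinite_finite_induct) (auto simp: A_zero A_add)

lemma N_sum: "(\<And>i. i \<in> I \<Longrightarrow> P i \<in> A k E) \<Longrightarrow> N k E (sum P I) \<le> (\<Sum>i\<in>I. N k E (P i))"
proof (induction I rule: infinite_finite_induct)
  case (insert x I)
  then have "N k E (P x + sum P I) \<le> N k E (P x) + N k E (sum P I)"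
    by (intro N_add) (auto intro: A_sum)
  also have "\<dots> \<le> N k E (P x) + (\<Sum>i\<in>I. N k E (P i))" using insert by simp
  finally show ?case by (simp only: sum.insert[OF insert(1,2)])
qed auto

lemma ideal_comp:
  "\<lbrakk>complex_banach_space F; complex_banach_space G; bounded_linear_map F G R; P \<in> A k G\<rbrakk>
    \<Longrightarrow> restr F (P \<circ> R) \<in> A k F"
  "\<lbrakk>complex_banach_space F; complex_banach_space G; bounded_linear_map F G R; P \<in> A k G\<rbrakk>
    \<Longrightarrow> N k F (restr F (P \<circ> R)) \<le> N k G P * op_norm F G R ^ k"
  using ideal[of k] unfolding banach_ideal_def by blast+

lemma ideal_unit:
  "\<lbrakk>complex_banach_space L; isometric_iso L complex_space \<phi>\<rbrakk> \<Longrightarrow> restr L (\<lambda>z. \<phi> z ^ k) \<in> A k L"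
  "\<lbrakk>complex_banach_space L; isometric_iso L complex_space \<phi>\<rbrakk> \<Longrightarrow> N k L (restr L (\<lambda>z. \<phi> z ^ k)) = 1"
  using ideal[of k] unfolding banach_ideal_def by blast+

lemma unit_vector: "x \<in> vcarrier E \<Longrightarrow> \<exists>e z. e \<in> vcarrier E \<and> vnorm E e = 1 \<and> x = vscale E z e \<and> cmod z = vnorm E x"
proof -
  assume x: "x \<in> vcarrier E"
  have *: "\<exists>e z. e \<in> vcarrier E \<and> vnorm E e = 1 \<and> y = vscale E z e \<and> cmod z = vnorm E y"
    if y: "y \<in> vcarrier E" "y \<noteq> vzero E" for y
  proof -
    have p: "vnorm E y > 0" using y E.norm_nonneg[OF y(1)] E.norm_eq_zero[OF y(1)] by simp
    show ?thesis
      using y p E.norm_nonneg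
      by (intro exI[of _ "vscale E (inverse (of_real (vnorm E y))) y"] exI[of _ "of_real (vnorm E y)"])
        (auto simp: E.scale_closed E.norm_scale E.scale_scale E.scale_one norm_inverse)
  qed
  show ?thesis
  proof (cases "x = vzero E")
    case True
    from nonzero * obtain e where e: "e \<in> vcarrier E" "vnorm E e = 1" by metis
    then show ?thesis using True E.scale_0[OF e(1)] by (intro exI[of _ e] exI[of _ 0]) simp
  qed (use * x in auto)
qed

text \<open>Restricted to the line through the unit vector e in the direction of x, \<open>P\<close>
  is P(e) z^k, of ideal norm exactly |P(e)|. The inclusion of the line has norm at most 1, so the
  ideal inequality bounds this by \<open>N k E P\<close>.\<close>

lemma A_eval_le:
  assumes "P \<in> A k E" "x \<in> vcarrier E"
  shows "cmod (P x) \<le> N k E P * vnorm E x ^ k"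
proof -
  obtain e z where e: "e \<in> vcarrier E" "vnorm E e = 1" "x = vscale E z e" "cmod z = vnorm E x"
    using unit_vector[OF assms(2)] by blast
  let ?L = "line E e" and ?q = "restr (line E e) (\<lambda>z. line_coord E e z ^ k)"
  note line = E.line_sel[OF e(1,2)]
  have L: "complex_banach_space ?L" by (rule E.line_banach[OF e(1,2)])
  interpret L: complex_banach_space ?L by (rule L)
  have R: "bounded_linear_map ?L E (\<lambda>x. x)"
    using e(1) unfolding bounded_linear_map_def linear_map_def line
    by (auto simp: E.scale_closed intro!: exI[of _ 1])
  have op: "op_norm ?L E (\<lambda>x. x) \<le> 1" by (intro L.op_norm_le) (auto simp: line)
  have eq: "restr ?L (P \<circ> (\<lambda>x. x)) = fscale (P e) ?q"
  proof
    fix y show "restr ?L (P \<circ> (\<lambda>x. x)) y = fscale (P e) ?q y"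
      using homog_poly_scale[OF E.complex_vector_space_axioms A_subset[OF assms(1)] e(1)]
        E.line_coord_scale[OF e(1,2)]
      by (cases "y \<in> vcarrier ?L") (auto simp: line)
  qed
  interpret AL: complex_banach_space "fun_nspace (A k ?L) (N k ?L)"
    using ideal[of k] L by (simp add: banach_ideal_def)
  have "cmod (P e) = N k ?L (fscale (P e) ?q)"
    using AL.norm_scale[of ?q "P e"] ideal_unit[OF L E.line_iso[OF e(1,2)]] by simp
  also have "\<dots> \<le> N k E P * op_norm ?L E (\<lambda>x. x) ^ k"
    using ideal_comp(2)[OF L banach R assms(1)] eq by simp
  also have "\<dots> \<le> N k E P * 1"
    using op L.op_norm_nonneg[OF E.complex_normed_space_axioms R] N_nonneg[OF assms(1)]
    by (intro mult_left_mono power_le_one)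
  finally have "cmod (P e) \<le> N k E P" by simp
  then have "cmod z ^ k * cmod (P e) \<le> vnorm E x ^ k * N k E P"
    using e(4) by (intro mult_mono) (auto simp: E.norm_nonneg assms)
  then show ?thesis
    using homog_poly_scale[OF E.complex_vector_space_axioms A_subset[OF assms(1)] e(1), of z] e(3)
    by (simp add: norm_mult norm_power mult.commute)
qed

text \<open>The power of \<gamma> is z^k composed with x -> \<gamma>(x) e, a map into a copy of the
  complex numbers of norm at most that of \<gamma>.\<close>

lemma dual_power_A:
  assumes "\<gamma> \<in> dual E"
  shows "restr E (\<lambda>x. \<gamma> x ^ k) \<in> A k E"
    and "N k E (restr E (\<lambda>x. \<gamma> x ^ k)) \<le> dual_norm E \<gamma> ^ k"
proof -
  obtain e where e: "e \<in> vcarrier E" "vnorm E e = 1" using unit_vector[OF E.zero_closed] by blast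
  let ?L = "line E e" and ?q = "restr (line E e) (\<lambda>z. line_coord E e z ^ k)"
  let ?R = "\<lambda>x. vscale E (\<gamma> x) e"
  note line = E.line_sel[OF e]
  have L: "complex_banach_space ?L" by (rule E.line_banach[OF e])
  interpret L: complex_banach_space ?L by (rule L)
  have le: "vnorm ?L (?R x) \<le> dual_norm E \<gamma> * vnorm E x" if "x \<in> vcarrier E" for x
    using e E.dual_norm_ge[OF assms that] by (simp add: line E.norm_scale)
  then have R: "bounded_linear_map E ?L ?R"
    using e(1) dualD[OF assms] unfolding bounded_linear_map_def linear_map_def
    by (auto simp: line E.scale_add_left E.scale_scale)
  have op: "op_norm E ?L ?R \<le> dual_norm E \<gamma>"
    by (intro E.op_norm_le le E.dual_norm_nonneg assms)
  have eq: "restr E (?q \<circ> ?R) = restr E (\<lambda>x. \<gamma> x ^ k)"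
    by (auto simp: restr_def line E.line_coord_scale[OF e])
  note u = ideal_unit[OF L E.line_iso[OF e], of k]
  show "restr E (\<lambda>x. \<gamma> x ^ k) \<in> A k E" using ideal_comp(1)[OF banach L R u(1)] eq by simp
  have "N k E (restr E (\<lambda>x. \<gamma> x ^ k)) \<le> op_norm E ?L ?R ^ k"
    using ideal_comp(2)[OF banach L R u(1)] eq u(2) by simp
  also have "\<dots> \<le> dual_norm E \<gamma> ^ k"
    using op E.op_norm_nonneg[OF L.complex_normed_space_axioms R] by (intro power_mono)
  finally show "N k E (restr E (\<lambda>x. \<gamma> x ^ k)) \<le> dual_norm E \<gamma> ^ k" .
qed

text \<open>For \<open>k \<le> m\<close> this is the degree \<open>m\<close> part of \<eta>^k / k!
  times the exponential of \<gamma>.\<close>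

definition mixed :: "('u \<Rightarrow> complex) \<Rightarrow> ('u \<Rightarrow> complex) \<Rightarrow> nat \<Rightarrow> nat \<Rightarrow> 'u \<Rightarrow> complex" where
  "mixed \<gamma> \<eta> k m = restr E (\<lambda>x. \<eta> x ^ k * \<gamma> x ^ (m - k) / (fact k * fact (m - k)))"

text \<open>By \<open>binomial_component\<close> the product is a sum of \<open>Suc m\<close> powers
  of functionals \<gamma> + w \<eta> with |w| = 1, whose coefficients have total modulus 1/m!. Hence
  the bound carries no polarization constant.\<close>

lemma mixed_A:
  assumes "\<gamma> \<in> dual E" "\<eta> \<in> dual E" "k \<le> m"
  shows "mixed \<gamma> \<eta> k m \<in> A m E"
    and "N m E (mixed \<gamma> \<eta> k m) \<le> (dual_norm E \<gamma> + dual_norm E \<eta>) ^ m / fact m"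
proof -
  define w :: "nat \<Rightarrow> complex" where "w j = exp (2 * of_real pi * \<i> * of_nat j / of_nat (Suc m))" for j
  define c where "c j = inverse (w j) ^ k / (of_nat (Suc m) * fact m)" for j
  define \<delta> where "\<delta> j = \<gamma> + fscale (w j) \<eta>" for j
  let ?P = "\<lambda>j. fscale (c j) (restr E (\<lambda>x. \<delta> j x ^ m))"
  have w: "cmod (w j) = 1" for j by (simp add: w_def norm_exp_eq_Re)
  have d: "\<delta> j \<in> dual E" for j
    unfolding \<delta>_def by (intro E.dual_plus E.dual_fscale assms)
  have dn: "dual_norm E (\<delta> j) \<le> dual_norm E \<gamma> + dual_norm E \<eta>" for j
    unfolding \<delta>_def using E.dual_norm_triangle[OF assms(1) E.dual_fscale[OF assms(2)], of "w j"]
    by (simp add: E.dual_norm_fscale assms(2) w)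
  have eq: "mixed \<gamma> \<eta> k m = (\<Sum>j<Suc m. ?P j)"
  proof
    fix x show "mixed \<gamma> \<eta> k m x = (\<Sum>j<Suc m. ?P j) x"
      using binomial_component[OF assms(3), of "\<eta> x" "\<gamma> x"]
      by (cases "x \<in> vcarrier E")
        (simp_all add: mixed_def sum_fun_apply c_def \<delta>_def w_def del: sum.lessThan_Suc of_nat_Suc)
  qed
  have PA: "?P j \<in> A m E" for j by (intro A_fscale dual_power_A d)
  show "mixed \<gamma> \<eta> k m \<in> A m E" unfolding eq by (intro A_sum PA)
  have "N m E (?P j) \<le> 1 / (real (Suc m) * fact m) * (dual_norm E \<gamma> + dual_norm E \<eta>) ^ m" for j
  proof -
    have "N m E (?P j) = cmod (c j) * N m E (restr E (\<lambda>x. \<delta> j x ^ m))"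
      by (intro N_fscale dual_power_A d)
    also have "\<dots> \<le> cmod (c j) * (dual_norm E \<gamma> + dual_norm E \<eta>) ^ m"
      by (intro mult_left_mono order.trans[OF dual_power_A(2)[OF d]] power_mono dn E.dual_norm_nonneg d) auto
    also have "cmod (c j) = 1 / (real (Suc m) * fact m)"
      unfolding c_def by (simp add: norm_divide norm_mult norm_power norm_inverse w del: of_nat_Suc)
    finally show ?thesis .
  qed
  then have "N m E (mixed \<gamma> \<eta> k m) \<le> (\<Sum>j<Suc m. 1 / (real (Suc m) * fact m) * (dual_norm E \<gamma> + dual_norm E \<eta>) ^ m)"
    unfolding eq by (intro order.trans[OF N_sum[OF PA]] sum_mono)
  also have "\<dots> = (dual_norm E \<gamma> + dual_norm E \<eta>) ^ m / fact m"
    by (simp del: of_nat_Suc)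
  finally show "N m E (mixed \<gamma> \<eta> k m) \<le> (dual_norm E \<gamma> + dual_norm E \<eta>) ^ m / fact m" .
qed

text \<open>Completeness of the ideal produces a limit in the ideal norm. Since that norm dominates
  point values, the limit must be the pointwise sum, which is the form in which series appear
  later.\<close>

lemma A_suminf:
  assumes P: "\<And>n. P n \<in> A m E" and sm: "summable (\<lambda>n. N m E (P n))"
  shows "(\<lambda>x. \<Sum>n. P n x) \<in> A m E"
    and "N m E (\<lambda>x. \<Sum>n. P n x) \<le> (\<Sum>n. N m E (P n))"
    and "x \<in> vcarrier E \<Longrightarrow> summable (\<lambda>n. cmod (P n x))"
proof -
  interpret B: complex_banach_space "ideal_space A N m E" by (rule A_banach)
  interpret M: Metric_space "A m E" "vdist (ideal_space A N m E)" using B.metric by simp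
  define S where "S n = sum P {..<n}" for n
  have S: "S n \<in> A m E" for n unfolding S_def by (intro A_sum P)
  have dist: "vdist (ideal_space A N m E) f g = N m E (f - g)" if "f \<in> A m E" "g \<in> A m E" for f g
    using that by (simp add: vdist_def)
  have le: "N m E (S b - S a) \<le> (\<Sum>n. N m E (P n)) - (\<Sum>n<a. N m E (P n))" if "a \<le> b" for a b
  proof -
    have "S b - S a = sum P {a..<b}"
      using that sum_diff_nat_ivl[of 0 a b P] by (simp add: S_def lessThan_atLeast0)
    then have "N m E (S b - S a) \<le> (\<Sum>n\<in>{a..<b}. N m E (P n))" using N_sum P by metis
    also have "\<dots> = (\<Sum>n<b. N m E (P n)) - (\<Sum>n<a. N m E (P n))"
      using that sum_diff_nat_ivl[of 0 a b "\<lambda>n. N m E (P n)"] by (simp add: lessThan_atLeast0)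
    also have "(\<Sum>n<b. N m E (P n)) \<le> (\<Sum>n. N m E (P n))"
      by (intro sum_le_suminf sm) (auto intro: N_nonneg P)
    finally show ?thesis by simp
  qed
  have lim0: "(\<lambda>a. (\<Sum>n. N m E (P n)) - (\<Sum>n<a. N m E (P n))) \<longlonglongrightarrow> 0"
    using tendsto_diff[OF tendsto_const[of "\<Sum>n. N m E (P n)"] summable_LIMSEQ[OF sm]] by simp
  have "M.MCauchy S"
    unfolding M.MCauchy_def
  proof (intro conjI allI impI)
    fix \<epsilon> :: real assume "\<epsilon> > 0"
    then obtain K where K: "\<And>a. a \<ge> K \<Longrightarrow> (\<Sum>n. N m E (P n)) - (\<Sum>n<a. N m E (P n)) < \<epsilon>"
      using lim0 order_tendstoD(2)[OF lim0] by (auto simp: eventually_sequentially)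
    have "N m E (S b - S a) < \<epsilon>" if "K \<le> a" "K \<le> b" for a b
    proof (cases "a \<le> b")
      case True
      then show ?thesis using le[OF True] K[OF that(1)] by simp
    next
      case False
      have "N m E (S b - S a) = N m E (S a - S b)"
        using M.commute[of "S b" "S a"] S by (simp add: dist)
      then show ?thesis using le[of b a] K[OF that(2)] False by simp
    qed
    then show "\<exists>K. \<forall>n n'. K \<le> n \<longrightarrow> K \<le> n' \<longrightarrow> vdist (ideal_space A N m E) (S n) (S n') < \<epsilon>"
      using S by (auto simp: dist)
  qed (use S in auto)
  then obtain Q where "limitin M.mtopology S Q sequentially"
    using B.complete by (auto simp: M.mcomplete_def)
  then have Q: "Q \<in> A m E" and lim: "(\<lambda>n. N m E (S n - Q)) \<longlonglongrightarrow> 0"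
    using S by (auto simp: M.limitin_metric_dist_null dist tendsto_cong)
  \<comment> \<open>\<open>Q\<close> is so far only a limit in the ideal norm;
    \<open>A_eval_le\<close> identifies its values.\<close>
  have pt: "(\<lambda>n. P n x) sums Q x" for x
  proof (cases "x \<in> vcarrier E")
    case True
    have "(\<lambda>n. S n x - Q x) \<longlonglongrightarrow> 0"
    proof (rule Lim_null_comparison)
      show "\<forall>\<^sub>F n in sequentially. norm (S n x - Q x) \<le> N m E (S n - Q) * vnorm E x ^ m"
        using A_eval_le[OF A_diff[OF S Q] True] by simp
      show "(\<lambda>n. N m E (S n - Q) * vnorm E x ^ m) \<longlonglongrightarrow> 0"
        using tendsto_mult_left_zero[OF lim] by simp
    qed
    then show ?thesis by (simp add: sums_def S_def sum_fun_apply LIM_zero_iff)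
  next
    case False
    then show ?thesis using A_scalar_funs[OF Q] A_scalar_funs[OF P] by (simp add: scalar_funs_def)
  qed
  then have eq: "(\<lambda>x. \<Sum>n. P n x) = Q" by (auto simp: sums_iff)
  show "(\<lambda>x. \<Sum>n. P n x) \<in> A m E" using Q eq by simp
  have "N m E Q \<le> (\<Sum>n. N m E (P n)) + N m E (S k - Q)" for k
  proof -
    have "N m E Q = N m E (S k + fscale (-1) (S k - Q))" by (simp add: fun_eq_iff fscale_def fun_diff_def plus_fun_def)
    also have "\<dots> \<le> N m E (S k) + N m E (fscale (-1) (S k - Q))" by (intro N_add S A_fscale A_diff Q)
    also have "N m E (fscale (-1) (S k - Q)) = N m E (S k - Q)" by (simp add: N_fscale A_diff S Q)
    also have "N m E (S k) \<le> (\<Sum>n. N m E (P n))" using le[of 0 k] by (simp add: S_def)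
    finally show ?thesis by (simp del: minus_apply)
  qed
  then have "N m E Q \<le> (\<Sum>n. N m E (P n)) + 0"
    by (intro LIMSEQ_le_const[OF tendsto_add[OF tendsto_const lim]]) auto
  then show "N m E (\<lambda>x. \<Sum>n. P n x) \<le> (\<Sum>n. N m E (P n))" using eq by simp
  assume x: "x \<in> vcarrier E"
  show "summable (\<lambda>n. cmod (P n x))"
    by (rule summable_comparison_test'[OF summable_mult2[OF sm, of "vnorm E x ^ m"], of 0])
      (use A_eval_le[OF P x] in auto)
qed

end

section \<open>Entire functions of bounded type\<close>

text \<open>The Cauchy-Hadamard criterion for infinite radius. Roots below 1/(2s) give comparison
  with the powers of 1/2; conversely, terms at weight 2/\<epsilon> eventually below 1 force roots of
  at most \<epsilon>/2.\<close>

lemma root_tendsto_zero_iff: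
  assumes "\<And>k. 0 \<le> a k"
  shows "(\<lambda>k. root k (a k)) \<longlonglongrightarrow> 0 \<longleftrightarrow> (\<forall>s>0. summable (\<lambda>k. s ^ k * a k))"
proof (intro iffI allI impI)
  fix s :: real assume s: "s > 0" and lim: "(\<lambda>k. root k (a k)) \<longlonglongrightarrow> 0"
  have half: "0 < 1 / (2 * s)" using s by simp
  have "\<forall>\<^sub>F k in sequentially. norm (s ^ k * a k) \<le> (1 / 2) ^ k"
    using order_tendstoD(2)[OF lim half] eventually_gt_at_top[of 0]
  proof eventually_elim
    case (elim k)
    have "a k = root k (a k) ^ k" using elim assms by simp
    also have "\<dots> \<le> (1 / (2 * s)) ^ k" using elim assms s by (intro power_mono) auto
    finally have "s ^ k * a k \<le> s ^ k * (1 / (2 * s)) ^ k" using s by (intro mult_left_mono) auto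
    also have "\<dots> = (1 / 2) ^ k" using s by (simp flip: power_mult_distrib)
    finally show ?case using assms[of k] s by simp
  qed
  then show "summable (\<lambda>k. s ^ k * a k)"
    by (rule summable_comparison_test_ev) (simp add: summable_geometric)
next
  assume sm: "\<forall>s>0. summable (\<lambda>k. s ^ k * a k)"
  show "(\<lambda>k. root k (a k)) \<longlonglongrightarrow> 0"
  proof (rule LIMSEQ_I)
    fix \<epsilon> :: real assume e: "\<epsilon> > 0"
    then have "(\<lambda>k. (2 / \<epsilon>) ^ k * a k) \<longlonglongrightarrow> 0" using sm by (intro summable_LIMSEQ_zero) simp
    from order_tendstoD(2)[OF this zero_less_one] have "\<forall>\<^sub>F k in sequentially. norm (root k (a k) - 0) < \<epsilon>"
      using eventually_gt_at_top[of 0]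
    proof eventually_elim
      case (elim k)
      have "a k \<le> (\<epsilon> / 2) ^ k" using elim e by (simp add: field_simps)
      then have "root k (a k) \<le> root k ((\<epsilon> / 2) ^ k)" using elim by simp
      also have "\<dots> = \<epsilon> / 2" using e elim by (simp add: real_root_power_cancel)
      finally show ?case using e assms[of k] by (simp add: real_root_ge_zero)
    qed
    then show "\<exists>no. \<forall>n\<ge>no. norm (root n (a n) - 0) < \<epsilon>" by (simp add: eventually_sequentially)
  qed
qed

text \<open>Domination by a product of summable sequences gives absolute summability over all pairs,
  so the unordered sum can be taken in either order. The remaining work identifies unordered with
  ordered sums.\<close>

lemma suminf_swap_bounded:
  fixes a :: "nat \<Rightarrow> nat \<Rightarrow> complex"
  assumes b: "\<And>n m. cmod (a n m) \<le> \<alpha> n * \<beta> m" and \<alpha>: "summable \<alpha>" and \<beta>: "summable \<beta>"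
    and nn: "\<And>n. 0 \<le> \<alpha> n" "\<And>m. 0 \<le> \<beta> m"
  shows "(\<Sum>m. \<Sum>n. a n m) = (\<Sum>n. \<Sum>m. a n m)" and "summable (\<lambda>n. \<Sum>m. a n m)"
proof -
  have "(\<lambda>(n, m). \<alpha> n * \<beta> m) summable_on UNIV \<times> UNIV"
    by (intro summable_on_SigmaI[where g = "\<lambda>n. \<alpha> n * suminf \<beta>"])
      (use \<alpha> \<beta> nn in \<open>auto intro!: sums_nonneg_imp_has_sum sums_mult summable_sums
        simp: summable_on_UNIV_nonneg_real_iff suminf_nonneg summable_mult2\<close>)
  then have "(\<lambda>x. norm (case x of (n, m) \<Rightarrow> a n m)) summable_on UNIV \<times> UNIV"
    by (rule summable_on_comparison_test) (use b in auto)
  then have s: "(\<lambda>(n, m). a n m) summable_on UNIV \<times> UNIV" by (rule abs_summable_summable)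
  have row: "summable (\<lambda>m. cmod (a n m))" for n
    by (rule summable_comparison_test'[OF summable_mult[OF \<beta>, of "\<alpha> n"], of 0]) (use b in auto)
  have col: "summable (\<lambda>n. cmod (a n m))" for m
    by (rule summable_comparison_test'[OF summable_mult2[OF \<alpha>, of "\<beta> m"], of 0]) (use b in auto)
  have row': "infsum (a n) UNIV = (\<Sum>m. a n m)" for n
    by (intro infsumI norm_summable_imp_has_sum row summable_sums summable_norm_cancel[OF row])
  have col': "infsum (\<lambda>n. a n m) UNIV = (\<Sum>n. a n m)" for m
    by (intro infsumI norm_summable_imp_has_sum col summable_sums summable_norm_cancel[OF col])
  have nrow: "cmod (\<Sum>m. a n m) \<le> \<alpha> n * suminf \<beta>" for n
    using summable_norm[OF row[of n]] suminf_le[OF b[of n] row summable_mult[OF \<beta>]]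
      suminf_mult[OF \<beta>, of "\<alpha> n"] by simp
  have ncol: "cmod (\<Sum>n. a n m) \<le> suminf \<alpha> * \<beta> m" for m
    using summable_norm[OF col[of m]] suminf_le[OF b[where m = m] col summable_mult2[OF \<alpha>]]
      suminf_mult2[OF \<alpha>, of "\<beta> m"] by simp
  have sr: "summable (\<lambda>n. cmod (\<Sum>m. a n m))"
    by (rule summable_comparison_test'[OF summable_mult2[OF \<alpha>, of "suminf \<beta>"], of 0]) (use nrow in auto)
  have sc: "summable (\<lambda>m. cmod (\<Sum>n. a n m))"
    by (rule summable_comparison_test'[OF summable_mult[OF \<beta>, of "suminf \<alpha>"], of 0]) (use ncol in auto)
  show "summable (\<lambda>n. \<Sum>m. a n m)" by (rule summable_norm_cancel[OF sr])
  have "infsum (\<lambda>n. infsum (a n) UNIV) UNIV = (\<Sum>n. \<Sum>m. a n m)" unfolding row'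
    by (intro infsumI norm_summable_imp_has_sum sr summable_sums summable_norm_cancel[OF sr])
  moreover have "infsum (\<lambda>m. infsum (\<lambda>n. a n m) UNIV) UNIV = (\<Sum>m. \<Sum>n. a n m)" unfolding col'
    by (intro infsumI norm_summable_imp_has_sum sc summable_sums summable_norm_cancel[OF sc])
  moreover have "infsum (\<lambda>n. infsum (a n) UNIV) UNIV = infsum (\<lambda>m. infsum (\<lambda>n. a n m) UNIV) UNIV"
    using infsum_swap_banach[OF s] by simp
  ultimately show "(\<Sum>m. \<Sum>n. a n m) = (\<Sum>n. \<Sum>m. a n m)" by simp
qed

lemma continuous_map_vtopologyI:
  fixes P :: "'a \<Rightarrow> complex"
  assumes "complex_normed_space X"
    and "\<And>a \<epsilon>. a \<in> vcarrier X \<Longrightarrow> \<epsilon> > 0 \<Longrightarrow>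
      \<exists>\<delta>>0. \<forall>x\<in>vcarrier X. vnorm X (vdiff X x a) < \<delta> \<longrightarrow> cmod (P x - P a) < \<epsilon>"
  shows "continuous_map (vtopology X) euclidean P"
proof -
  interpret complex_normed_space X by fact
  interpret M: Metric_space "vcarrier X" "vdist X" by (rule metric)
  show ?thesis
    unfolding M.continuous_map_from_metric
  proof (intro conjI ballI allI impI)
    fix a U assume a: "a \<in> vcarrier X" and U: "openin euclidean U \<and> P a \<in> U"
    then obtain \<epsilon> where e: "\<epsilon> > 0" "ball (P a) \<epsilon> \<subseteq> U"
      using open_contains_ball[of U] by auto
    obtain \<delta> where "\<delta> > 0" "\<And>x. x \<in> vcarrier X \<Longrightarrow> vnorm X (vdiff X x a) < \<delta> \<Longrightarrow> cmod (P x - P a) < \<epsilon>"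
      using assms(2)[OF a e(1)] by blast
    then show "\<exists>r>0. \<forall>x. x \<in> vcarrier X \<and> vdist X a x < r \<longrightarrow> P x \<in> U"
      using e a M.commute[of a]
      by (intro exI[of _ \<delta>]) (auto simp: vdist_def subset_iff dist_norm norm_minus_commute)
  qed auto
qed

text \<open>The copies of x are replaced by a one slot at a time. Each replacement changes the value
  by the form with x - a in that slot, and the m changes are added up.\<close>

lemma multilinear_diag_diff:
  assumes "complex_normed_space X" "multilinear_form m X B"
    and bnd: "\<And>xs. length xs = m \<Longrightarrow> set xs \<subseteq> vcarrier X \<Longrightarrow> cmod (B xs) \<le> C * prod_list (map (vnorm X) xs)"
    and x: "x \<in> vcarrier X" "vnorm X x \<le> R" and a: "a \<in> vcarrier X" "vnorm X a \<le> R" and "0 \<le> C" "1 \<le> R"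
  shows "cmod (B (replicate m x) - B (replicate m a)) \<le> real m * (C * R ^ m * vnorm X (vdiff X x a))"
proof -
  interpret complex_normed_space X by fact
  define L where "L i = replicate i a @ replicate (m - i) x" for i
  have nn: "0 \<le> vnorm X (vdiff X x a)" "0 \<le> vnorm X x" "0 \<le> vnorm X a"
    using x a by (auto intro!: norm_nonneg vdiff_closed)
  have step: "cmod (B (L i) - B (L (Suc i))) \<le> C * R ^ m * vnorm X (vdiff X x a)" if i: "i < m" for i
  proof -
    let ?us = "replicate i a" and ?vs = "replicate (m - Suc i) x"
    have sets: "set ?us \<subseteq> vcarrier X \<and> set ?vs \<subseteq> vcarrier X \<and> Suc (length ?us + length ?vs) = m"
      using x a i by auto
    then have lin: "linear_map X complex_space (\<lambda>z. B (?us @ z # ?vs))"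
      using assms(2) unfolding multilinear_form_def by blast
    have 1: "L i = ?us @ x # ?vs"
      using i by (simp add: L_def) (metis Suc_diff_Suc replicate_Suc)
    have 2: "L (Suc i) = ?us @ a # ?vs"
      by (simp add: L_def replicate_app_Cons_same)
    have "B (?us @ x # ?vs) = B (?us @ a # ?vs) + B (?us @ vdiff X x a # ?vs)"
      using lin x a vadd_vdiff[of x a] vdiff_closed[of x a] unfolding linear_map_def
      by simp metis
    then have "B (L i) - B (L (Suc i)) = B (?us @ vdiff X x a # ?vs)" by (simp add: 1 2)
    then have "cmod (B (L i) - B (L (Suc i))) \<le> C * prod_list (map (vnorm X) (?us @ vdiff X x a # ?vs))"
      using bnd[of "?us @ vdiff X x a # ?vs"] sets vdiff_closed[OF x(1) a(1)] by simp
    also have "prod_list (map (vnorm X) (?us @ vdiff X x a # ?vs))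
        = vnorm X a ^ i * vnorm X x ^ (m - Suc i) * vnorm X (vdiff X x a)"
      by (simp add: prod_list_replicate)
    also have "\<dots> \<le> (R ^ i * R ^ (m - Suc i)) * vnorm X (vdiff X x a)"
      using nn x a assms by (intro mult_right_mono mult_mono power_mono) auto
    \<comment> \<open>One slot holds x - a, which leaves m - 1 factors; \<open>1 \<le> R\<close>
      rounds the exponent up to m.\<close>
    also have "R ^ i * R ^ (m - Suc i) \<le> R ^ m"
      using i assms(9) by (simp flip: power_add add: power_increasing)
    finally show ?thesis using nn assms by (simp add: mult.assoc mult_left_mono mult_right_mono)
  qed
  have "i \<le> m \<Longrightarrow> cmod (B (L 0) - B (L i)) \<le> real i * (C * R ^ m * vnorm X (vdiff X x a))" for i
  proof (induction i)
    case (Suc i)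
    then show ?case
      using step[of i] norm_triangle_ineq[of "B (L 0) - B (L i)" "B (L i) - B (L (Suc i))"]
      by (simp add: distrib_right)
  qed simp
  from this[of m] show ?thesis by (simp add: L_def)
qed

text \<open>A bounded form is Lipschitz on the diagonal of every ball, here the one of radius |a| +
  1. This is how infinite sums of forms are recognised as continuous polynomials.\<close>

lemma multilinear_bounded_homog_poly:
  assumes "complex_normed_space X" "multilinear_form m X B"
    and bnd: "\<And>xs. length xs = m \<Longrightarrow> set xs \<subseteq> vcarrier X \<Longrightarrow> cmod (B xs) \<le> C * prod_list (map (vnorm X) xs)"
    and "0 \<le> C"
  shows "restr X (\<lambda>x. B (replicate m x)) \<in> homog_polys m X"
proof -
  interpret complex_normed_space X by fact
  let ?P = "restr X (\<lambda>x. B (replicate m x))"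
  have "continuous_map (vtopology X) euclidean ?P"
  proof (rule continuous_map_vtopologyI[OF assms(1)])
    fix a \<epsilon> assume a: "a \<in> vcarrier X" and e: "(\<epsilon>::real) > 0"
    define R where "R = vnorm X a + 1"
    define K where "K = real m * (C * R ^ m)"
    have R: "1 \<le> R" using norm_nonneg[OF a] by (simp add: R_def)
    have K: "0 \<le> K" using assms R by (simp add: K_def)
    let ?\<delta> = "min 1 (\<epsilon> / (K + 1))"
    have "cmod (?P x - ?P a) < \<epsilon>" if x: "x \<in> vcarrier X" and d: "vnorm X (vdiff X x a) < ?\<delta>" for x
    proof -
      have "vnorm X x \<le> vnorm X a + vnorm X (vdiff X x a)"
        using norm_triangle[OF a vdiff_closed[OF x a]] vadd_vdiff[OF x a] by simp
      then have "vnorm X x \<le> R" using d by (simp add: R_def)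
      then have "cmod (?P x - ?P a) \<le> K * vnorm X (vdiff X x a)"
        using multilinear_diag_diff[OF assms(1,2) bnd x _ a _ assms(4) R] x a
        by (simp add: R_def K_def mult.assoc)
      also have "\<dots> \<le> K * (\<epsilon> / (K + 1))" using d K by (intro mult_left_mono) auto
      also have "\<dots> < \<epsilon>" using K e by (simp add: field_simps)
      finally show ?thesis .
    qed
    then show "\<exists>\<delta>>0. \<forall>x\<in>vcarrier X. vnorm X (vdiff X x a) < \<delta> \<longrightarrow> cmod (?P x - ?P a) < \<epsilon>"
      using e K by (intro exI[of _ ?\<delta>]) auto
  qed
  then show ?thesis using assms(2) by (auto simp: homog_polys_def)
qed

context poly_ideal_space
begin

abbreviation H :: "('u \<Rightarrow> complex) set" where
  "H \<equiv> bounded_type_funs A N E"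

abbreviation sn :: "real \<Rightarrow> ('u \<Rightarrow> complex) \<Rightarrow> real" where
  "sn \<equiv> bounded_type_seminorm N E"

text \<open>The root condition becomes summability against all geometric weights, which is stable
  under linear operations and makes the seminorm series converge.\<close>

lemma H_iff:
  "f \<in> H \<longleftrightarrow> f \<in> holomorphic_funs E \<and> (\<forall>k. taylor_term E f k \<in> A k E) \<and>
    (\<forall>s>0. summable (\<lambda>k. s ^ k * N k E (taylor_term E f k)))"
proof -
  have "deriv_zero E f k \<in> A k E \<longleftrightarrow> taylor_term E f k \<in> A k E" for k
    using A_fscale[of "taylor_term E f k" k "fact k"]
      A_fscale[of "fscale (fact k) (taylor_term E f k)" k "inverse (fact k)"]
    by (auto simp: deriv_zero_def)
  then show ?thesis
    using root_tendsto_zero_iff[of "\<lambda>k. N k E (taylor_term E f k)"] N_nonneg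
    by (auto simp: bounded_type_funs_def)
qed

lemma H_D:
  assumes "f \<in> H"
  shows H_holomorphic: "f \<in> holomorphic_funs E"
    and H_taylor: "taylor_term E f k \<in> A k E"
    and H_summable: "s > 0 \<Longrightarrow> summable (\<lambda>k. s ^ k * N k E (taylor_term E f k))"
  using assms by (auto simp: H_iff)

lemma H_scalar_funs: "f \<in> H \<Longrightarrow> f \<in> scalar_funs E"
  using H_holomorphic by (auto simp: holomorphic_funs_def)

lemma H_add: "f \<in> H \<Longrightarrow> g \<in> H \<Longrightarrow> f + g \<in> H"
  and sn_add: "f \<in> H \<Longrightarrow> g \<in> H \<Longrightarrow> s > 0 \<Longrightarrow> sn s (f + g) \<le> sn s f + sn s g"
proof -
  assume f: "f \<in> H" and g: "g \<in> H"
  have T: "taylor_term E (f + g) k = taylor_term E f k + taylor_term E g k" for k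
    by (intro taylor_term_add E.complex_normed_space_axioms H_holomorphic f g)
  have sm: "summable (\<lambda>k. s ^ k * N k E (taylor_term E f k) + s ^ k * N k E (taylor_term E g k))"
    if "s > 0" for s
    by (intro summable_add H_summable f g that)
  have le: "s ^ k * N k E (taylor_term E (f + g) k)
      \<le> s ^ k * N k E (taylor_term E f k) + s ^ k * N k E (taylor_term E g k)" if "s > 0" for s k
    using N_add[OF H_taylor[OF f, of k] H_taylor[OF g, of k]] that
    unfolding T by (simp flip: distrib_left)
  have TA: "taylor_term E (f + g) k \<in> A k E" for k unfolding T by (intro A_add H_taylor f g)
  have sm': "summable (\<lambda>k. s ^ k * N k E (taylor_term E (f + g) k))" if "s > 0" for s
    by (rule summable_comparison_test'[OF sm[OF that], of 0])
      (use le[OF that] that N_nonneg[OF TA] in auto)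
  show "f + g \<in> H"
    unfolding H_iff using TA sm' holomorphic_funs_add[OF E.complex_normed_space_axioms] f g
    by (auto simp: H_holomorphic)
  assume s: "s > 0"
  have "sn s (f + g) \<le> (\<Sum>k. s ^ k * N k E (taylor_term E f k) + s ^ k * N k E (taylor_term E g k))"
    unfolding bounded_type_seminorm_def by (intro suminf_le le sm sm' s)
  also have "\<dots> = sn s f + sn s g"
    unfolding bounded_type_seminorm_def by (intro suminf_add[symmetric] H_summable f g s)
  finally show "sn s (f + g) \<le> sn s f + sn s g" .
qed

lemma H_fscale: "f \<in> H \<Longrightarrow> fscale c f \<in> H"
  and sn_fscale: "f \<in> H \<Longrightarrow> s > 0 \<Longrightarrow> sn s (fscale c f) = cmod c * sn s f"
proof -
  assume f: "f \<in> H"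
  have T: "taylor_term E (fscale c f) k = fscale c (taylor_term E f k)" for k
    by (intro taylor_term_fscale E.complex_normed_space_axioms H_holomorphic f)
  have eq: "s ^ k * N k E (taylor_term E (fscale c f) k) = cmod c * (s ^ k * N k E (taylor_term E f k))" for s k
    unfolding T by (simp add: N_fscale H_taylor f)
  show "fscale c f \<in> H"
    unfolding H_iff eq using H_D[OF f]
    by (auto simp: T A_fscale intro: summable_mult holomorphic_funs_fscale)
  show "sn s (fscale c f) = cmod c * sn s f" if "s > 0"
    unfolding bounded_type_seminorm_def eq by (rule suminf_mult[OF H_summable[OF f that]])
qed

lemma H_diff: "f \<in> H \<Longrightarrow> g \<in> H \<Longrightarrow> f - g \<in> H"
  by (simp add: fun_diff_eq_fscale H_add H_fscale)

lemma sn_nonneg: "f \<in> H \<Longrightarrow> s > 0 \<Longrightarrow> 0 \<le> sn s f"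
  unfolding bounded_type_seminorm_def
  by (intro suminf_nonneg H_summable) (auto intro!: mult_nonneg_nonneg N_nonneg H_taylor)

lemma sn_diff_commute: "f \<in> H \<Longrightarrow> g \<in> H \<Longrightarrow> s > 0 \<Longrightarrow> sn s (f - g) = sn s (g - f)"
  using sn_fscale[OF H_diff, of f g s "-1"] by (simp add: fscale_def fun_diff_def)

lemma sn_triangle:
  assumes "f \<in> H" "g \<in> H" "h \<in> H" "s > 0"
  shows "sn s (f - h) \<le> sn s (f - g) + sn s (g - h)"
proof -
  have "f - h = (f - g) + (g - h)" by (simp add: fun_eq_iff)
  then show ?thesis using sn_add[OF H_diff[OF assms(1,2)] H_diff[OF assms(2,3)] assms(4)] by metis
qed

lemma sn_mono: "f \<in> H \<Longrightarrow> 0 < s \<Longrightarrow> s \<le> t \<Longrightarrow> sn s f \<le> sn t f"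
  unfolding bounded_type_seminorm_def
  by (intro suminf_le H_summable mult_right_mono power_mono N_nonneg H_taylor) auto

lemma eval_zero_le_sn: "f \<in> H \<Longrightarrow> s > 0 \<Longrightarrow> cmod (f (vzero E)) \<le> sn s f"
proof -
  assume f: "f \<in> H" and s: "s > 0"
  have "cmod (f (vzero E)) \<le> N 0 E (taylor_term E f 0)"
    using A_eval_le[OF H_taylor[OF f] E.zero_closed, of 0]
      taylor_term_0_vzero[OF E.complex_normed_space_axioms H_holomorphic[OF f]] by simp
  also have "\<dots> \<le> sn s f"
    unfolding bounded_type_seminorm_def
    using sum_le_suminf[OF H_summable[OF f s], of "{0}"] s N_nonneg[OF H_taylor[OF f]] by simp
  finally show ?thesis .
qed

text \<open>Each single seminorm is already a norm, so one of them suffices to show that two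
  functions coincide.\<close>

lemma sn_eq_zero:
  assumes "f \<in> H" "s > 0" "sn s f = 0"
  shows "f = 0"
proof (rule holomorphic_funs_eq_zero[OF E.complex_normed_space_axioms H_holomorphic[OF assms(1)]])
  fix k
  have "s ^ k * N k E (taylor_term E f k) = 0"
    using assms suminf_eq_zero_iff[OF H_summable[OF assms(1,2)]] N_nonneg[OF H_taylor[OF assms(1)]]
    unfolding bounded_type_seminorm_def by simp
  then show "taylor_term E f k = 0" using assms(2) N_eq_zero[OF H_taylor[OF assms(1)]] by simp
qed

section \<open>Absolutely convergent series of exponential monomials\<close>

text \<open>The coefficient of z^k in the expansion of exp(\<gamma> + z \<eta>), which is why sums
  over \<open>k\<close> recover exponentials along a line.\<close>

definition atom :: "('u \<Rightarrow> complex) \<Rightarrow> ('u \<Rightarrow> complex) \<Rightarrow> nat \<Rightarrow> 'u \<Rightarrow> complex" where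
  "atom \<gamma> \<eta> k = restr E (\<lambda>x. \<eta> x ^ k / fact k * exp (\<gamma> x))"

text \<open>No symmetrisation is made: \<open>homog_polys\<close> asks only for some multilinear
  form with the prescribed diagonal.\<close>

definition mono_form :: "('u \<Rightarrow> complex) \<Rightarrow> ('u \<Rightarrow> complex) \<Rightarrow> nat \<Rightarrow> nat \<Rightarrow> 'u list \<Rightarrow> complex" where
  "mono_form \<gamma> \<eta> m i xs = (\<Prod>j<m. (if j < i then \<eta> else \<gamma>) (xs ! j))"

text \<open>The factor of \<eta>(y)^i / i! in (\<eta>(a) + \<eta>(y))^k / k!; the case distinction
  guards against truncated subtraction for i > k.\<close>

definition atom_coeff :: "('u \<Rightarrow> complex) \<Rightarrow> nat \<Rightarrow> 'u \<Rightarrow> nat \<Rightarrow> complex" where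
  "atom_coeff \<eta> k a i = (if i \<le> k then \<eta> a ^ (k - i) / fact (k - i) else 0)"

text \<open>The \<open>m\<close>-linear form whose diagonal is the degree \<open>m\<close> part of \<open>y \<mapsto> atom \<gamma> \<eta> k (a + y)\<close>.\<close>

definition atom_form ::
    "('u \<Rightarrow> complex) \<Rightarrow> ('u \<Rightarrow> complex) \<Rightarrow> nat \<Rightarrow> 'u \<Rightarrow> nat \<Rightarrow> 'u list \<Rightarrow> complex" where
  "atom_form \<gamma> \<eta> k a m xs = exp (\<gamma> a) *
     (\<Sum>i\<le>m. atom_coeff \<eta> k a i / (fact i * fact (m - i)) * mono_form \<gamma> \<eta> m i xs)"

lemma mono_form_replicate: "i \<le> m \<Longrightarrow> mono_form \<gamma> \<eta> m i (replicate m x) = \<eta> x ^ i * \<gamma> x ^ (m - i)"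
proof -
  assume i: "i \<le> m"
  have "mono_form \<gamma> \<eta> m i (replicate m x) = (\<Prod>j<m. if j < i then \<eta> x else \<gamma> x)"
    unfolding mono_form_def by (intro prod.cong) auto
  also have "\<dots> = \<eta> x ^ card ({..<m} \<inter> {j. j < i}) * \<gamma> x ^ card ({..<m} \<inter> - {j. j < i})"
    by (simp add: prod.If_cases)
  also have "{..<m} \<inter> {j. j < i} = {..<i}" using i by auto
  also have "{..<m} \<inter> - {j. j < i} = {i..<m}" by auto
  finally show ?thesis by simp
qed

lemma mono_form_linear:
  assumes "\<gamma> \<in> dual E" "\<eta> \<in> dual E" "Suc (length us + length vs) = m"
  shows "linear_map E complex_space (\<lambda>x. mono_form \<gamma> \<eta> m i (us @ x # vs))"
proof -
  define g where "g j = (if j < i then \<eta> else \<gamma>)" for j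
  let ?l = "length us"
  have g: "g j \<in> dual E" for j using assms by (simp add: g_def)
  define C where "C = (\<Prod>j\<in>{..<m} - {?l}. g j ((us @ vzero E # vs) ! j))"
  have "mono_form \<gamma> \<eta> m i (us @ x # vs) = g ?l x * C" for x
  proof -
    have "mono_form \<gamma> \<eta> m i (us @ x # vs)
        = g ?l ((us @ x # vs) ! ?l) * (\<Prod>j\<in>{..<m} - {?l}. g j ((us @ x # vs) ! j))"
      unfolding mono_form_def g_def[symmetric] using assms(3) by (intro prod.remove) auto
    also have "(\<Prod>j\<in>{..<m} - {?l}. g j ((us @ x # vs) ! j)) = C"
      unfolding C_def by (intro prod.cong) (auto simp: nth_append nth_Cons')
    finally show ?thesis by simp
  qed
  then show ?thesis using dualD[OF g[of ?l]] by (auto simp: linear_map_def algebra_simps)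
qed

lemma mono_form_bound:
  assumes "\<gamma> \<in> dual E" "\<eta> \<in> dual E" "length xs = m" "set xs \<subseteq> vcarrier E" "i \<le> m"
  shows "cmod (mono_form \<gamma> \<eta> m i xs)
    \<le> dual_norm E \<eta> ^ i * dual_norm E \<gamma> ^ (m - i) * prod_list (map (vnorm E) xs)"
proof -
  have "cmod (mono_form \<gamma> \<eta> m i xs)
      \<le> (\<Prod>j<m. (if j < i then dual_norm E \<eta> else dual_norm E \<gamma>) * vnorm E (xs ! j))"
    unfolding mono_form_def prod_norm[symmetric]
  proof (intro prod_mono conjI)
    fix j assume "j \<in> {..<m}"
    then have "xs ! j \<in> vcarrier E" using assms by (auto dest: nth_mem)
    then show "cmod ((if j < i then \<eta> else \<gamma>) (xs ! j))
        \<le> (if j < i then dual_norm E \<eta> else dual_norm E \<gamma>) * vnorm E (xs ! j)"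
      using assms E.dual_norm_ge by simp
  qed simp
  also have "\<dots> = (\<Prod>j<m. if j < i then dual_norm E \<eta> else dual_norm E \<gamma>) * (\<Prod>j<m. vnorm E (xs ! j))"
    by (rule prod.distrib)
  also have "(\<Prod>j<m. vnorm E (xs ! j)) = prod_list (map (vnorm E) xs)"
    using assms(3) by (simp add: prod.list_conv_set_nth lessThan_atLeast0)
  also have "(\<Prod>j<m. if j < i then dual_norm E \<eta> else dual_norm E \<gamma>)
      = dual_norm E \<eta> ^ card ({..<m} \<inter> {j. j < i}) * dual_norm E \<gamma> ^ card ({..<m} \<inter> - {j. j < i})"
    by (simp add: prod.If_cases)
  also have "{..<m} \<inter> {j. j < i} = {..<i}" using assms by auto
  also have "{..<m} \<inter> - {j. j < i} = {i..<m}" by auto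
  finally show ?thesis by simp
qed

lemma atom_form_linear:
  assumes "\<gamma> \<in> dual E" "\<eta> \<in> dual E" "Suc (length us + length vs) = m"
  shows "linear_map E complex_space (\<lambda>x. atom_form \<gamma> \<eta> k a m (us @ x # vs))"
  using mono_form_linear[OF assms] unfolding atom_form_def linear_map_def
  by (simp add: distrib_left sum.distrib sum_distrib_left mult_ac)

lemma power_fact_le_exp: "0 \<le> (x::real) \<Longrightarrow> x ^ n / fact n \<le> exp x"
  using sum_le_suminf[OF summable_exp_generic[of x], of "{n}"]
  by (simp add: exp_def field_simps scaleR_conv_of_real)

lemma binomial_fact_sum:
  "(\<Sum>i\<le>m. b ^ i * a ^ (m - i) / (fact i * fact (m - i))) = (a + b) ^ m / fact m"
  for a b :: "'b::field_char_0"
proof -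
  have "(b + a) ^ m / fact m = (\<Sum>i\<le>m. of_nat (m choose i) * b ^ i * a ^ (m - i) / fact m)"
    by (simp add: binomial_ring sum_divide_distrib)
  also have "\<dots> = (\<Sum>i\<le>m. b ^ i * a ^ (m - i) / (fact i * fact (m - i)))"
    by (intro sum.cong) (auto simp: binomial_fact field_simps)
  finally show ?thesis by (simp add: add.commute)
qed

text \<open>One factor \<open>exp (r * vnorm E a)\<close> bounds the exponential at a, the other the
  coefficients \<open>atom_coeff\<close>; the binomial sum produces r^m / m!. The bound is
  independent of \<open>k\<close>, so atoms of unbounded degree may be mixed in one series.\<close>

lemma atom_form_bound:
  assumes "\<gamma> \<in> dual E" "\<eta> \<in> dual E" "length xs = m" "set xs \<subseteq> vcarrier E" "a \<in> vcarrier E"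
    and r: "dual_norm E \<gamma> + dual_norm E \<eta> \<le> r"
  shows "cmod (atom_form \<gamma> \<eta> k a m xs)
    \<le> exp (2 * r * vnorm E a) * (r ^ m / fact m) * prod_list (map (vnorm E) xs)"
proof -
  let ?\<Pi> = "prod_list (map (vnorm E) xs)"
  have g0: "0 \<le> dual_norm E \<gamma>" and h0: "0 \<le> dual_norm E \<eta>" using assms E.dual_norm_nonneg by auto
  have na: "0 \<le> vnorm E a" using assms E.norm_nonneg by auto
  have pi0: "0 \<le> ?\<Pi>" using assms(4) E.norm_nonneg by (intro prod_list_nonneg) auto
  have ga: "cmod (\<gamma> a) \<le> r * vnorm E a"
    using E.dual_norm_ge[OF assms(1,5)] mult_right_mono[of "dual_norm E \<gamma>" r, OF _ na] r h0 by linarith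
  have ha: "cmod (\<eta> a) \<le> r * vnorm E a"
    using E.dual_norm_ge[OF assms(2,5)] mult_right_mono[of "dual_norm E \<eta>" r, OF _ na] r g0 by linarith
  have e1: "cmod (exp (\<gamma> a)) \<le> exp (r * vnorm E a)"
    using ga complex_Re_le_cmod[of "\<gamma> a"] by (simp add: norm_exp_eq_Re)
  have w: "cmod (atom_coeff \<eta> k a i) \<le> exp (r * vnorm E a)" for i
    using power_fact_le_exp[of "cmod (\<eta> a)" "k - i"] ha exp_ge_zero[of "r * vnorm E a"]
    by (auto simp: atom_coeff_def norm_divide norm_power intro: order.trans)
  have "cmod (\<Sum>i\<le>m. atom_coeff \<eta> k a i / (fact i * fact (m - i)) * mono_form \<gamma> \<eta> m i xs)
      \<le> (\<Sum>i\<le>m. exp (r * vnorm E a) * (dual_norm E \<eta> ^ i * dual_norm E \<gamma> ^ (m - i) / (fact i * fact (m - i))) * ?\<Pi>)"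
  proof (intro order.trans[OF norm_sum] sum_mono)
    fix i assume "i \<in> {..m}"
    then have "cmod (mono_form \<gamma> \<eta> m i xs) \<le> dual_norm E \<eta> ^ i * dual_norm E \<gamma> ^ (m - i) * ?\<Pi>"
      using mono_form_bound assms by auto
    then have "cmod (atom_coeff \<eta> k a i) * cmod (mono_form \<gamma> \<eta> m i xs) / (fact i * fact (m - i))
        \<le> exp (r * vnorm E a) * (dual_norm E \<eta> ^ i * dual_norm E \<gamma> ^ (m - i) * ?\<Pi>) / (fact i * fact (m - i))"
      using w by (intro divide_right_mono mult_mono) auto
    then show "cmod (atom_coeff \<eta> k a i / (fact i * fact (m - i)) * mono_form \<gamma> \<eta> m i xs)
        \<le> exp (r * vnorm E a) * (dual_norm E \<eta> ^ i * dual_norm E \<gamma> ^ (m - i) / (fact i * fact (m - i))) * ?\<Pi>"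
      by (simp add: norm_mult norm_divide)
  qed
  also have "\<dots> = exp (r * vnorm E a) * ((dual_norm E \<gamma> + dual_norm E \<eta>) ^ m / fact m) * ?\<Pi>"
    unfolding sum_distrib_left[symmetric] sum_distrib_right[symmetric] binomial_fact_sum ..
  also have "\<dots> \<le> exp (r * vnorm E a) * (r ^ m / fact m) * ?\<Pi>"
    using r g0 h0 pi0 by (intro mult_right_mono mult_left_mono divide_right_mono power_mono) auto
  finally have "cmod (atom_form \<gamma> \<eta> k a m xs)
      \<le> exp (r * vnorm E a) * (exp (r * vnorm E a) * (r ^ m / fact m) * ?\<Pi>)"
    unfolding atom_form_def norm_mult using e1 by (intro mult_mono) auto
  then show ?thesis by (simp add: mult.assoc flip: exp_add) (simp add: mult_ac flip: exp_add)
qed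

text \<open>The Cauchy product of the finite expansion of \<eta>(a + y)^k / k! in powers of
  \<eta>(y) with the exponential series of \<gamma>(y).\<close>

lemma atom_form_sums:
  assumes "\<gamma> \<in> dual E" "\<eta> \<in> dual E" "a \<in> vcarrier E" "y \<in> vcarrier E"
  shows "(\<lambda>m. atom_form \<gamma> \<eta> k a m (replicate m y)) sums atom \<gamma> \<eta> k (vadd E a y)"
proof -
  define p where "p i = atom_coeff \<eta> k a i * \<eta> y ^ i / fact i" for i
  define q where "q i = \<gamma> y ^ i / fact i" for i
  have pfin: "p i = 0" if "i \<notin> {..k}" for i using that by (simp add: p_def atom_coeff_def)
  have sp: "(\<Sum>i. p i) = (\<eta> a + \<eta> y) ^ k / fact k"
  proof -
    have "(\<Sum>i. p i) = (\<Sum>i\<le>k. p i)" by (rule suminf_finite) (use pfin in auto)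
    also have "\<dots> = (\<Sum>i\<le>k. \<eta> y ^ i * \<eta> a ^ (k - i) / (fact i * fact (k - i)))"
      by (intro sum.cong) (auto simp: p_def atom_coeff_def mult.commute)
    finally show ?thesis by (simp add: binomial_fact_sum)
  qed
  have sq: "q sums exp (\<gamma> y)"
    using exp_converges[of "\<gamma> y"] unfolding q_def by (simp add: scaleR_conv_of_real field_simps)
  have "(\<lambda>m. \<Sum>i\<le>m. p i * q (m - i)) sums ((\<Sum>i. p i) * (\<Sum>i. q i))"
  proof (rule Cauchy_product_sums)
    show "summable (\<lambda>i. norm (p i))" by (rule summable_finite[of "{..k}"]) (use pfin in auto)
    show "summable (\<lambda>i. norm (q i))"
      using summable_norm_exp[of "\<gamma> y"]
      unfolding q_def by (simp add: norm_divide norm_mult norm_power divide_inverse norm_inverse mult.commute)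
  qed
  then have "(\<lambda>m. exp (\<gamma> a) * (\<Sum>i\<le>m. p i * q (m - i))) sums (exp (\<gamma> a) * ((\<eta> a + \<eta> y) ^ k / fact k * exp (\<gamma> y)))"
    using sq sp by (intro sums_mult) (simp add: sums_iff)
  moreover have "exp (\<gamma> a) * (\<Sum>i\<le>m. p i * q (m - i)) = atom_form \<gamma> \<eta> k a m (replicate m y)" for m
  proof -
    have "(\<Sum>i\<le>m. p i * q (m - i)) = (\<Sum>i\<le>m. atom_coeff \<eta> k a i / (fact i * fact (m - i))
        * mono_form \<gamma> \<eta> m i (replicate m y))"
      by (rule sum.cong) (simp_all add: p_def q_def mono_form_replicate)
    then show ?thesis by (simp add: atom_form_def)
  qed
  moreover have "exp (\<gamma> a) * ((\<eta> a + \<eta> y) ^ k / fact k * exp (\<gamma> y)) = atom \<gamma> \<eta> k (vadd E a y)"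
    using assms dualD[OF assms(1)] dualD[OF assms(2)]
    by (simp add: atom_def E.add_closed exp_add)
  ultimately show ?thesis by simp
qed

lemma atom_form_vzero:
  assumes "\<gamma> \<in> dual E" "\<eta> \<in> dual E" "y \<in> vcarrier E"
  shows "atom_form \<gamma> \<eta> k (vzero E) m (replicate m y) = (if k \<le> m then mixed \<gamma> \<eta> k m y else 0)"
proof -
  have 0: "\<gamma> (vzero E) = 0" "\<eta> (vzero E) = 0" using assms E.dual_vzero by auto
  have "atom_form \<gamma> \<eta> k (vzero E) m (replicate m y)
      = (\<Sum>i\<le>m. if i = k then \<eta> y ^ k * \<gamma> y ^ (m - k) / (fact k * fact (m - k)) else 0)"
    unfolding atom_form_def 0 exp_zero mult_1
    by (intro sum.cong) (auto simp: atom_coeff_def 0 mono_form_replicate)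
  then show ?thesis using assms by (simp add: mixed_def)
qed

section \<open>Summable series of exponential monomials as entire functions of bounded type\<close>

context
  fixes c :: "nat \<Rightarrow> complex" and \<gamma> \<eta> :: "nat \<Rightarrow> 'u \<Rightarrow> complex" and k :: "nat \<Rightarrow> nat" and r :: real
  assumes dual: "\<And>n. \<gamma> n \<in> dual E" "\<And>n. \<eta> n \<in> dual E"
    and r: "\<And>n. dual_norm E (\<gamma> n) + dual_norm E (\<eta> n) \<le> r"
    and sm: "summable (\<lambda>n. cmod (c n))"
begin

lemma r_nonneg: "0 \<le> r"
  using r[of 0] E.dual_norm_nonneg[OF dual(1)[of 0]] E.dual_norm_nonneg[OF dual(2)[of 0]] by linarith

lemma atom_series_form_bound:
  assumes "a \<in> vcarrier E" "length xs = m" "set xs \<subseteq> vcarrier E"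
  shows "cmod (c n * atom_form (\<gamma> n) (\<eta> n) (k n) a m xs)
      \<le> cmod (c n) * (exp (2 * r * vnorm E a) * (r ^ m / fact m) * prod_list (map (vnorm E) xs))"
  unfolding norm_mult by (intro mult_left_mono atom_form_bound dual r assms) auto

lemma atom_series_form_summable:
  assumes "a \<in> vcarrier E" "length xs = m" "set xs \<subseteq> vcarrier E"
  shows "summable (\<lambda>n. cmod (c n * atom_form (\<gamma> n) (\<eta> n) (k n) a m xs))"
  by (rule summable_comparison_test'[OF summable_mult2[OF sm,
          of "exp (2 * r * vnorm E a) * (r ^ m / fact m) * prod_list (map (vnorm E) xs)"], of 0])
    (use atom_series_form_bound[OF assms] in auto)

lemma atom_series_homog_poly:
  assumes a: "a \<in> vcarrier E"
  shows "restr E (\<lambda>y. \<Sum>n. c n * atom_form (\<gamma> n) (\<eta> n) (k n) a m (replicate m y)) \<in> homog_polys m E"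
proof (rule multilinear_bounded_homog_poly[OF E.complex_normed_space_axioms])
  let ?B = "\<lambda>xs. \<Sum>n. c n * atom_form (\<gamma> n) (\<eta> n) (k n) a m xs"
  have sm': "summable (\<lambda>n. c n * atom_form (\<gamma> n) (\<eta> n) (k n) a m xs)"
    if "length xs = m" "set xs \<subseteq> vcarrier E" for xs
    by (rule summable_norm_cancel[OF atom_series_form_summable[OF a that]])
  show "multilinear_form m E ?B"
    unfolding multilinear_form_def
  proof (intro allI impI)
    fix us vs assume uv: "set us \<subseteq> vcarrier E \<and> set vs \<subseteq> vcarrier E \<and> Suc (length us + length vs) = m"
    have l: "linear_map E complex_space (\<lambda>x. atom_form (\<gamma> n) (\<eta> n) (k n) a m (us @ x # vs))" for n
      using uv by (intro atom_form_linear dual) auto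
    have s: "summable (\<lambda>n. c n * atom_form (\<gamma> n) (\<eta> n) (k n) a m (us @ x # vs))" if "x \<in> vcarrier E" for x
      using uv that by (intro sm') auto
    have "?B (us @ vadd E x y # vs) = ?B (us @ x # vs) + ?B (us @ y # vs)"
      if "x \<in> vcarrier E" "y \<in> vcarrier E" for x y
      unfolding suminf_add[OF s[OF that(1)] s[OF that(2)]]
      using l that by (simp add: linear_map_def distrib_left)
    moreover have "?B (us @ vscale E d x # vs) = d * ?B (us @ x # vs)" if "x \<in> vcarrier E" for d x
      unfolding suminf_mult[OF s[OF that], symmetric]
      using l that by (simp add: linear_map_def mult.left_commute)
    ultimately show "linear_map E complex_space (\<lambda>x. ?B (us @ x # vs))"
      by (simp add: linear_map_def)
  qed
  let ?C = "suminf (\<lambda>n. cmod (c n)) * (exp (2 * r * vnorm E a) * (r ^ m / fact m))"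
  show "0 \<le> ?C" using r_nonneg by (intro mult_nonneg_nonneg suminf_nonneg sm) auto
  fix xs assume xs: "length xs = m" "set xs \<subseteq> vcarrier E"
  have "cmod (?B xs) \<le> (\<Sum>n. cmod (c n) * (exp (2 * r * vnorm E a) * (r ^ m / fact m) * prod_list (map (vnorm E) xs)))"
    using summable_norm[OF atom_series_form_summable[OF a xs]]
      suminf_le[OF atom_series_form_bound[OF a xs] atom_series_form_summable[OF a xs] summable_mult2[OF sm]]
    by linarith
  also have "\<dots> = ?C * prod_list (map (vnorm E) xs)"
    unfolding suminf_mult2[OF sm, symmetric] by (simp add: mult.assoc)
  finally show "cmod (?B xs) \<le> ?C * prod_list (map (vnorm E) xs)" .
qed

text \<open>The factorial in \<open>atom_form_bound\<close> gives a majorant uniform on the unit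
  ball around a, and the same majorant justifies exchanging the sums over atoms and over degrees.
  Expansions at all points are needed, since holomorphy is local by definition.\<close>

lemma atom_series_expansion:
  assumes a: "a \<in> vcarrier E"
  shows "power_series_expansion E (\<lambda>x. \<Sum>n. c n * atom (\<gamma> n) (\<eta> n) (k n) x) a
    (\<lambda>m. restr E (\<lambda>y. \<Sum>n. c n * atom_form (\<gamma> n) (\<eta> n) (k n) a m (replicate m y)))"
    (is "power_series_expansion E ?f a ?P")
  unfolding power_series_expansion_def
proof (intro conjI allI exI[of _ 1])
  show "?P m \<in> homog_polys m E" for m by (rule atom_series_homog_poly[OF a])
  show "(0::real) < 1" by simp
  let ?S = "suminf (\<lambda>n. cmod (c n))"
  define \<beta> where "\<beta> m = exp (2 * r * vnorm E a) * (r ^ m / fact m)" for m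
  have \<beta>: "summable \<beta>" unfolding \<beta>_def using summable_exp_generic[of r]
    by (intro summable_mult) (simp add: scaleR_conv_of_real field_simps)
  have \<beta>0: "0 \<le> \<beta> m" for m using r_nonneg by (simp add: \<beta>_def)
  have bnd: "cmod (c n * atom_form (\<gamma> n) (\<eta> n) (k n) a m (replicate m y)) \<le> cmod (c n) * \<beta> m"
    if "y \<in> vcarrier E" "vnorm E y \<le> 1" for y n m
  proof -
    have "vnorm E y ^ m \<le> 1" using that E.norm_nonneg by (intro power_le_one) auto
    then have "\<beta> m * vnorm E y ^ m \<le> \<beta> m * 1" by (intro mult_left_mono \<beta>0)
    then have "cmod (c n) * (\<beta> m * vnorm E y ^ m) \<le> cmod (c n) * \<beta> m" by (intro mult_left_mono) auto
    moreover have "set (replicate m y) \<subseteq> vcarrier E" using that(1) by auto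
    ultimately show ?thesis
      using atom_series_form_bound[OF a, of "replicate m y" m n]
      by (simp add: \<beta>_def prod_list_replicate)
  qed
  have *: "uniform_limit (vball E a 1) (\<lambda>n x. \<Sum>i<n. ?P i (vdiff E x a)) (\<lambda>x. \<Sum>i. ?P i (vdiff E x a)) sequentially"
  proof (rule Weierstrass_m_test)
    show "summable (\<lambda>m. ?S * \<beta> m)" by (intro summable_mult \<beta>)
    fix m x assume "x \<in> vball E a 1"
    then have y: "vdiff E x a \<in> vcarrier E" "vnorm E (vdiff E x a) \<le> 1"
      by (auto simp: E.vball_iff E.vdiff_closed)
    have s: "summable (\<lambda>n. cmod (c n * atom_form (\<gamma> n) (\<eta> n) (k n) a m (replicate m (vdiff E x a))))"
      using y by (intro atom_series_form_summable a) auto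
    have "cmod (?P m (vdiff E x a)) \<le> (\<Sum>n. cmod (c n) * \<beta> m)"
      using y summable_norm[OF s] suminf_le[OF bnd[OF y] s summable_mult2[OF sm]] by simp
    then show "norm (?P m (vdiff E x a)) \<le> ?S * \<beta> m" using suminf_mult2[OF sm, of "\<beta> m"] by simp
  qed
  have "(\<Sum>i. ?P i (vdiff E x a)) = ?f x" if "x \<in> vball E a 1" for x
  proof -
    have x: "x \<in> vcarrier E" using that by (simp add: E.vball_iff)
    have y: "vdiff E x a \<in> vcarrier E" "vnorm E (vdiff E x a) \<le> 1"
      using that by (auto simp: E.vball_iff E.vdiff_closed)
    have "(\<Sum>i. ?P i (vdiff E x a))
        = (\<Sum>m. \<Sum>n. c n * atom_form (\<gamma> n) (\<eta> n) (k n) a m (replicate m (vdiff E x a)))"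
      using y by simp
    also have "\<dots> = (\<Sum>n. \<Sum>m. c n * atom_form (\<gamma> n) (\<eta> n) (k n) a m (replicate m (vdiff E x a)))"
      by (rule suminf_swap_bounded(1)[OF bnd[OF y] sm \<beta>]) (auto simp: \<beta>0)
    also have "\<dots> = ?f x"
    proof -
      have "(\<lambda>m. c n * atom_form (\<gamma> n) (\<eta> n) (k n) a m (replicate m (vdiff E x a))) sums (c n * atom (\<gamma> n) (\<eta> n) (k n) x)" for n
        using atom_form_sums[OF dual a y(1), of n n "k n"] E.vadd_vdiff[OF x a] by (intro sums_mult) simp
      then show ?thesis by (simp add: sums_iff)
    qed
    finally show ?thesis .
  qed
  then show "uniform_limit (vball E a 1) (\<lambda>n x. \<Sum>k<n. ?P k (vdiff E x a)) ?f sequentially"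
    by (intro uniform_limit_cong'[THEN iffD1, OF _ _ *]) auto
qed

text \<open>The Taylor term at 0 is a series of the polynomials \<open>mixed\<close>, and it
  converges in the ideal norm because each of them has norm at most r^m / m!.\<close>

lemma atom_series_H:
  shows "(\<lambda>x. \<Sum>n. c n * atom (\<gamma> n) (\<eta> n) (k n) x) \<in> H"
    and "N m E (taylor_term E (\<lambda>x. \<Sum>n. c n * atom (\<gamma> n) (\<eta> n) (k n) x) m)
      \<le> suminf (\<lambda>n. cmod (c n)) * (r ^ m / fact m)"
proof -
  let ?f = "\<lambda>x. \<Sum>n. c n * atom (\<gamma> n) (\<eta> n) (k n) x"
  let ?S = "suminf (\<lambda>n. cmod (c n))"
  let ?P = "\<lambda>m. restr E (\<lambda>y. \<Sum>n. c n * atom_form (\<gamma> n) (\<eta> n) (k n) (vzero E) m (replicate m y))"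
  define Q where "Q m n = fscale (c n) (if k n \<le> m then mixed (\<gamma> n) (\<eta> n) (k n) m else 0)" for m n
  have T: "taylor_term E ?f = ?P"
    by (rule taylor_term_eq[OF E.complex_normed_space_axioms atom_series_expansion[OF E.zero_closed]])
  have QA: "Q m n \<in> A m E" for m n
    unfolding Q_def using mixed_A(1)[OF dual] by (auto intro!: A_fscale A_zero)
  have QN: "N m E (Q m n) \<le> cmod (c n) * (r ^ m / fact m)" for m n
  proof -
    have "N m E (if k n \<le> m then mixed (\<gamma> n) (\<eta> n) (k n) m else 0) \<le> r ^ m / fact m"
    proof (cases "k n \<le> m")
      case True
      have "(dual_norm E (\<gamma> n) + dual_norm E (\<eta> n)) ^ m / fact m \<le> r ^ m / fact m"
        using r E.dual_norm_nonneg dual by (intro divide_right_mono power_mono) auto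
      then show ?thesis using mixed_A(2)[OF dual(1)[of n] dual(2)[of n] True] True by simp
    qed (use r_nonneg in simp)
    then have "cmod (c n) * N m E (if k n \<le> m then mixed (\<gamma> n) (\<eta> n) (k n) m else 0)
        \<le> cmod (c n) * (r ^ m / fact m)" by (intro mult_left_mono) auto
    moreover have "N m E (Q m n) = cmod (c n) * N m E (if k n \<le> m then mixed (\<gamma> n) (\<eta> n) (k n) m else 0)"
      unfolding Q_def by (rule N_fscale) (auto intro: A_zero mixed_A dual)
    ultimately show ?thesis by simp
  qed
  have smQ: "summable (\<lambda>n. N m E (Q m n))" for m
    by (rule summable_comparison_test'[OF summable_mult2[OF sm, of "r ^ m / fact m"], of 0])
      (use QN[of m] N_nonneg[OF QA[of m]] in auto)
  have PQ: "?P m = (\<lambda>x. \<Sum>n. Q m n x)" for m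
  proof
    fix x show "?P m x = (\<Sum>n. Q m n x)"
    proof (cases "x \<in> vcarrier E")
      case True
      have "c n * atom_form (\<gamma> n) (\<eta> n) (k n) (vzero E) m (replicate m x) = Q m n x" for n
        using atom_form_vzero[OF dual True, of n n "k n" m] by (simp add: Q_def)
      then show ?thesis using True by simp
    next
      case False
      then have "Q m n x = 0" for n by (cases "k n \<le> m") (auto simp: Q_def mixed_def)
      then show ?thesis using False by simp
    qed
  qed
  have TA: "taylor_term E ?f m \<in> A m E" for m
    unfolding T PQ by (rule A_suminf(1)[OF QA smQ])
  have TN: "N m E (taylor_term E ?f m) \<le> ?S * (r ^ m / fact m)" for m
  proof -
    have "N m E (taylor_term E ?f m) \<le> (\<Sum>n. N m E (Q m n))"
      unfolding T PQ by (rule A_suminf(2)[OF QA smQ])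
    also have "\<dots> \<le> (\<Sum>n. cmod (c n) * (r ^ m / fact m))"
      by (intro suminf_le QN smQ summable_mult2 sm)
    finally show ?thesis using suminf_mult2[OF sm, of "r ^ m / fact m"] by simp
  qed
  then show "N m E (taylor_term E ?f m) \<le> ?S * (r ^ m / fact m)" .
  have "?f \<in> scalar_funs E" by (simp add: scalar_funs_def atom_def)
  then have "?f \<in> holomorphic_funs E"
    using atom_series_expansion unfolding holomorphic_funs_def by blast
  moreover have "summable (\<lambda>m. s ^ m * N m E (taylor_term E ?f m))" if s: "s > 0" for s
  proof (rule summable_comparison_test'[of "\<lambda>m. ?S * ((s * r) ^ m / fact m)" 0])
    show "summable (\<lambda>m. ?S * ((s * r) ^ m / fact m))"
      using summable_exp_generic[of "s * r"] by (intro summable_mult) (simp add: scaleR_conv_of_real field_simps)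
    fix m
    have "s ^ m * N m E (taylor_term E ?f m) \<le> s ^ m * (?S * (r ^ m / fact m))"
      using s TN by (intro mult_left_mono) auto
    then show "norm (s ^ m * N m E (taylor_term E ?f m)) \<le> ?S * ((s * r) ^ m / fact m)"
      using s N_nonneg[OF TA] by (simp add: power_mult_distrib mult_ac)
  qed
  ultimately show "?f \<in> H" using TA by (simp add: H_iff)
qed

end

text \<open>\<open>Rep r\<close> describes a Banach space continuously included in the functions of exponential type
  at most \<open>r\<close>, with \<open>\<nu>\<close> a bound for the norm.\<close>

definition Rep :: "real \<Rightarrow> ('u \<Rightarrow> complex) \<Rightarrow> real \<Rightarrow> bool" where
  "Rep r f \<nu> \<longleftrightarrow> (\<exists>c \<gamma> \<eta> k. (\<forall>n. \<gamma> n \<in> dual E \<and> \<eta> n \<in> dual E \<and> dual_norm E (\<gamma> n) + dual_norm E (\<eta> n) \<le> r) \<and>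
     summable (\<lambda>n. cmod (c n)) \<and> (\<Sum>n. cmod (c n)) \<le> \<nu> \<and>
     f = (\<lambda>x. \<Sum>n. c n * atom (\<gamma> n) (\<eta> n) (k n) x))"

lemma Rep_nonneg: "Rep r f \<nu> \<Longrightarrow> 0 \<le> \<nu>"
  unfolding Rep_def using suminf_nonneg[of "\<lambda>n. cmod (_ n)"] by fastforce

lemma Rep_H: "Rep r f \<nu> \<Longrightarrow> f \<in> H"
  unfolding Rep_def using atom_series_H(1) by blast

lemma Rep_radius_nonneg: "Rep r f \<nu> \<Longrightarrow> 0 \<le> r"
  unfolding Rep_def using r_nonneg by blast

lemma Rep_taylor: "Rep r f \<nu> \<Longrightarrow> N m E (taylor_term E f m) \<le> \<nu> * (r ^ m / fact m)"
proof -
  assume R: "Rep r f \<nu>"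
  then obtain c \<gamma> \<eta> k where
    g: "\<And>n. \<gamma> n \<in> dual E" "\<And>n. \<eta> n \<in> dual E" "\<And>n. dual_norm E (\<gamma> n) + dual_norm E (\<eta> n) \<le> r"
    and c: "summable (\<lambda>n. cmod (c n))" "(\<Sum>n. cmod (c n)) \<le> \<nu>"
    and f: "f = (\<lambda>x. \<Sum>n. c n * atom (\<gamma> n) (\<eta> n) (k n) x)"
    unfolding Rep_def by blast
  have "(\<Sum>n. cmod (c n)) * (r ^ m / fact m) \<le> \<nu> * (r ^ m / fact m)"
    using c(2) Rep_radius_nonneg[OF R] by (intro mult_right_mono) auto
  then show ?thesis unfolding f by (rule order.trans[OF atom_series_H(2)[OF g c(1)]])
qed

text \<open>The weights s^m r^m / m! add up to exp(s r). Approximation measured by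
  \<open>Rep\<close> therefore implies approximation in every seminorm.\<close>

lemma Rep_sn:
  assumes "Rep r f \<nu>" "s > 0"
  shows "sn s f \<le> exp (s * r) * \<nu>"
proof -
  have ex: "(\<lambda>m. \<nu> * ((s * r) ^ m / fact m)) sums (\<nu> * exp (s * r))"
    using exp_converges[of "s * r"] by (intro sums_mult) (simp add: scaleR_conv_of_real field_simps)
  have "sn s f \<le> (\<Sum>m. \<nu> * ((s * r) ^ m / fact m))"
    unfolding bounded_type_seminorm_def
  proof (rule suminf_le)
    fix m
    have "s ^ m * N m E (taylor_term E f m) \<le> s ^ m * (\<nu> * (r ^ m / fact m))"
      using assms(2) Rep_taylor[OF assms(1)] by (intro mult_left_mono) auto
    then show "s ^ m * N m E (taylor_term E f m) \<le> \<nu> * ((s * r) ^ m / fact m)"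
      by (simp add: power_mult_distrib mult_ac)
  qed (use H_summable[OF Rep_H[OF assms(1)] assms(2)] ex in \<open>auto simp: sums_iff\<close>)
  then show ?thesis using ex by (simp add: sums_iff mult.commute)
qed

lemma Rep_exp_type:
  assumes "Rep r f \<nu>"
  shows "f \<in> exp_type_funs A N E r"
proof -
  note r = Rep_radius_nonneg[OF assms] and nu = Rep_nonneg[OF assms]
  have D: "N k E (deriv_zero E f k) \<le> \<nu> * r ^ k" for k
    using Rep_taylor[OF assms, of k]
    by (simp add: deriv_zero_def N_fscale H_taylor[OF Rep_H[OF assms]] field_simps)
  have D0: "0 \<le> N k E (deriv_zero E f k)" for k
    unfolding deriv_zero_def by (intro N_nonneg A_fscale H_taylor Rep_H[OF assms])
  \<comment> \<open>The constant \<nu> + 1 is strictly positive even for \<nu> = 0, so its roots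
    tend to 1.\<close>
  have "limsup (\<lambda>k. ereal (root k (N k E (deriv_zero E f k)))) \<le> limsup (\<lambda>k. ereal (root k (\<nu> + 1) * r))"
  proof (rule Limsup_mono)
    show "\<forall>\<^sub>F k in sequentially. ereal (root k (N k E (deriv_zero E f k))) \<le> ereal (root k (\<nu> + 1) * r)"
      using eventually_gt_at_top[of 0]
    proof eventually_elim
      case (elim k)
      have "N k E (deriv_zero E f k) \<le> (\<nu> + 1) * r ^ k"
        using D[of k] zero_le_power[OF r, of k] by (simp add: distrib_right)
      then have "root k (N k E (deriv_zero E f k)) \<le> root k ((\<nu> + 1) * r ^ k)" using elim by simp
      then show ?case using elim r by (simp add: real_root_mult real_root_power_cancel)
    qed
  qed
  also have "\<dots> = ereal (1 * r)"
    using nu by (intro lim_imp_Limsup tendsto_intros LIMSEQ_root_const) auto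
  finally show ?thesis using Rep_H[OF assms] by (simp add: exp_type_funs_def)
qed

end

text \<open>A series of series, absolutely convergent in total, is rewritten as one series along the
  pairing function.\<close>

lemma suminf_prod_decode:
  fixes h :: "nat \<Rightarrow> nat \<Rightarrow> 'a::banach"
  assumes row: "\<And>i. summable (\<lambda>n. norm (h i n))" and tot: "summable (\<lambda>i. \<Sum>n. norm (h i n))"
  shows "summable (\<lambda>m. norm (h (fst (prod_decode m)) (snd (prod_decode m))))"
    and "(\<Sum>m. h (fst (prod_decode m)) (snd (prod_decode m))) = (\<Sum>i. \<Sum>n. h i n)"
    and "summable (\<lambda>i. norm (\<Sum>n. h i n))"
proof -
  have "(\<lambda>x. norm (h (fst x) (snd x))) summable_on Sigma UNIV (\<lambda>_. UNIV)"
  proof (rule summable_on_SigmaI)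
    show "((\<lambda>n. norm (h (fst (i, n)) (snd (i, n)))) has_sum (\<Sum>n. norm (h i n))) UNIV" for i
      using row[of i] by (auto intro!: sums_nonneg_imp_has_sum summable_sums)
    show "(\<lambda>i. \<Sum>n. norm (h i n)) summable_on UNIV"
      using tot by (subst summable_on_UNIV_nonneg_real_iff) (auto intro!: suminf_nonneg row)
  qed auto
  then have ns: "(\<lambda>x. norm (h (fst x) (snd x))) summable_on UNIV" by simp
  then have s: "(\<lambda>x. h (fst x) (snd x)) summable_on UNIV" by (rule abs_summable_summable)
  have bij: "bij_betw prod_decode UNIV UNIV" by (rule bij_prod_decode)
  have "(\<lambda>m. norm (h (fst (prod_decode m)) (snd (prod_decode m)))) summable_on UNIV"
    using ns summable_on_reindex_bij_betw[OF bij, of "\<lambda>x. norm (h (fst x) (snd x))"] by simp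
  then show 1: "summable (\<lambda>m. norm (h (fst (prod_decode m)) (snd (prod_decode m))))"
    by (rule summable_on_imp_summable)
  have le: "norm (\<Sum>n. h i n) \<le> (\<Sum>n. norm (h i n))" for i by (rule summable_norm[OF row])
  show 2: "summable (\<lambda>i. norm (\<Sum>n. h i n))"
    by (rule summable_comparison_test'[OF tot, of 0]) (use le in auto)
  have "(\<Sum>m. h (fst (prod_decode m)) (snd (prod_decode m)))
      = infsum (\<lambda>m. h (fst (prod_decode m)) (snd (prod_decode m))) UNIV"
    by (intro infsumI[symmetric] norm_summable_imp_has_sum 1 summable_sums summable_norm_cancel[OF 1])
  also have "\<dots> = infsum (\<lambda>x. h (fst x) (snd x)) UNIV"
    by (rule infsum_reindex_bij_betw[OF bij])
  also have "\<dots> = infsum (\<lambda>i. infsum (\<lambda>n. h i n) UNIV) UNIV"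
    using infsum_Sigma_banach[of "\<lambda>x. h (fst x) (snd x)" UNIV "\<lambda>_. UNIV"] s by simp
  also have "(\<lambda>i. infsum (\<lambda>n. h i n) UNIV) = (\<lambda>i. \<Sum>n. h i n)"
    by (intro ext infsumI norm_summable_imp_has_sum row summable_sums summable_norm_cancel[OF row])
  also have "infsum (\<lambda>i. \<Sum>n. h i n) UNIV = (\<Sum>i. \<Sum>n. h i n)"
    by (intro infsumI norm_summable_imp_has_sum 2 summable_sums summable_norm_cancel[OF 2])
  finally show "(\<Sum>m. h (fst (prod_decode m)) (snd (prod_decode m))) = (\<Sum>i. \<Sum>n. h i n)" .
qed

lemma tail_suminf_tendsto_0:
  fixes \<nu> :: "nat \<Rightarrow> real"
  assumes "summable \<nu>" shows "(\<lambda>n. \<Sum>i. \<nu> (i + n)) \<longlonglongrightarrow> 0"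
proof -
  have "(\<Sum>i. \<nu> (i + n)) = suminf \<nu> - sum \<nu> {..<n}" for n
    by (rule suminf_minus_initial_segment[OF assms])
  then show ?thesis
    using tendsto_diff[OF tendsto_const[of "suminf \<nu>"] summable_LIMSEQ[OF assms]] by simp
qed

section \<open>Closure of the represented functions under series and linear operations\<close>

context poly_ideal_space
begin

lemma atom_eval_bound:
  assumes "\<gamma> \<in> dual E" "\<eta> \<in> dual E" "dual_norm E \<gamma> + dual_norm E \<eta> \<le> r"
  shows "cmod (atom \<gamma> \<eta> k x) \<le> exp (r * vnorm E x)"
proof (cases "x \<in> vcarrier E")
  case True
  have "cmod (atom \<gamma> \<eta> k x) = cmod (\<eta> x) ^ k / fact k * exp (Re (\<gamma> x))"
    using True by (simp add: atom_def norm_mult norm_divide norm_power norm_exp_eq_Re)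
  also have "\<dots> \<le> exp (cmod (\<eta> x)) * exp (cmod (\<gamma> x))"
    using power_fact_le_exp[of "cmod (\<eta> x)" k] complex_Re_le_cmod[of "\<gamma> x"] by (intro mult_mono) auto
  also have "\<dots> = exp (cmod (\<eta> x) + cmod (\<gamma> x))" by (simp add: exp_add)
  also have "cmod (\<eta> x) + cmod (\<gamma> x) \<le> (dual_norm E \<gamma> + dual_norm E \<eta>) * vnorm E x"
    using E.dual_norm_ge[OF assms(1) True] E.dual_norm_ge[OF assms(2) True] by (simp add: distrib_right)
  also have "\<dots> \<le> r * vnorm E x" using assms(3) E.norm_nonneg[OF True] by (intro mult_right_mono)
  finally show ?thesis by simp
qed (simp add: atom_def)

text \<open>This is completeness of the normed space behind \<open>Rep\<close>, for absolutely
  convergent series: the families of atoms are merged along \<open>prod_decode\<close>, with the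
  same radius and with the coefficient sums added.\<close>

lemma Rep_suminf:
  assumes R: "\<And>i. Rep r (f i) (\<nu> i)" and \<nu>: "summable \<nu>"
  shows "Rep r (\<lambda>x. \<Sum>i. f i x) (\<Sum>i. \<nu> i)" and "summable (\<lambda>i. cmod (f i x))"
proof -
  define D where "D i c \<gamma> \<eta> k \<longleftrightarrow> (\<forall>n. \<gamma> n \<in> dual E \<and> \<eta> n \<in> dual E \<and> dual_norm E (\<gamma> n) + dual_norm E (\<eta> n) \<le> r) \<and>
     summable (\<lambda>n. cmod (c n)) \<and> (\<Sum>n. cmod (c n)) \<le> \<nu> i \<and>
     f i = (\<lambda>x. \<Sum>n. c n * atom (\<gamma> n) (\<eta> n) (k n) x)" for i c \<gamma> \<eta> k
  have "\<exists>c \<gamma> \<eta> k. D i c \<gamma> \<eta> k" for i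
    using R[of i] by (simp add: Rep_def D_def)
  then obtain c \<gamma> \<eta> k where D: "\<And>i. D i (c i) (\<gamma> i) (\<eta> i) (k i)" by metis
  have g: "\<gamma> i n \<in> dual E \<and> \<eta> i n \<in> dual E \<and> dual_norm E (\<gamma> i n) + dual_norm E (\<eta> i n) \<le> r"
    and c: "summable (\<lambda>n. cmod (c i n))" "(\<Sum>n. cmod (c i n)) \<le> \<nu> i"
    and f: "f i = (\<lambda>x. \<Sum>n. c i n * atom (\<gamma> i n) (\<eta> i n) (k i n) x)" for i n
    using D[of i] unfolding D_def by auto
  let ?d = "\<lambda>m. fst (prod_decode m)" and ?e = "\<lambda>m. snd (prod_decode m)"
  have tot: "summable (\<lambda>i. \<Sum>n. cmod (c i n))"
    by (rule summable_comparison_test'[OF \<nu>, of 0]) (use c in \<open>auto simp: suminf_nonneg\<close>)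
  have s1: "summable (\<lambda>m. cmod (c (?d m) (?e m)))"
    by (rule suminf_prod_decode(1)) (use c tot in auto)
  have "(\<Sum>m. cmod (c (?d m) (?e m))) = (\<Sum>i. \<Sum>n. cmod (c i n))"
    by (rule suminf_prod_decode(2)) (use c tot in auto)
  also have "\<dots> \<le> suminf \<nu>" by (intro suminf_le c tot \<nu>)
  finally have s2: "(\<Sum>m. cmod (c (?d m) (?e m))) \<le> suminf \<nu>" .
  define h where "h x i n = c i n * atom (\<gamma> i n) (\<eta> i n) (k i n) x" for x i n
  have hb: "norm (h x i n) \<le> cmod (c i n) * exp (r * vnorm E x)" for x i n
    unfolding h_def norm_mult using g by (intro mult_left_mono atom_eval_bound) auto
  have row: "summable (\<lambda>n. norm (h x i n))" for x i
    by (rule summable_comparison_test'[OF summable_mult2[OF c(1)[of i], of "exp (r * vnorm E x)"], of 0])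
      (use hb in auto)
  have rowle: "(\<Sum>n. norm (h x i n)) \<le> (\<Sum>n. cmod (c i n)) * exp (r * vnorm E x)" for x i
    unfolding suminf_mult2[OF c(1)] by (intro suminf_le hb row summable_mult2 c)
  have tot': "summable (\<lambda>i. \<Sum>n. norm (h x i n))" for x
    by (rule summable_comparison_test'[OF summable_mult2[OF tot, of "exp (r * vnorm E x)"], of 0])
      (use rowle row in \<open>auto simp: suminf_nonneg\<close>)
  show "Rep r (\<lambda>x. \<Sum>i. f i x) (\<Sum>i. \<nu> i)"
    unfolding Rep_def
  proof (intro exI conjI)
    show "\<forall>m. \<gamma> (?d m) (?e m) \<in> dual E \<and> \<eta> (?d m) (?e m) \<in> dual E \<and>
        dual_norm E (\<gamma> (?d m) (?e m)) + dual_norm E (\<eta> (?d m) (?e m)) \<le> r" using g by blast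
    show "(\<lambda>x. \<Sum>i. f i x)
        = (\<lambda>x. \<Sum>m. c (?d m) (?e m) * atom (\<gamma> (?d m) (?e m)) (\<eta> (?d m) (?e m)) (k (?d m) (?e m)) x)"
      using suminf_prod_decode(2)[OF row tot'] by (simp add: f h_def)
  qed (use s1 s2 in auto)
  show "summable (\<lambda>i. cmod (f i x))"
    using suminf_prod_decode(3)[OF row tot', of x] by (simp add: f h_def)
qed

lemma Rep_mono: "Rep r f \<nu> \<Longrightarrow> r \<le> r' \<Longrightarrow> \<nu> \<le> \<nu>' \<Longrightarrow> Rep r' f \<nu>'"
  unfolding Rep_def by (elim exE conjE, intro exI conjI) (auto intro: order.trans)

lemma Rep_fscale:
  assumes "Rep r f \<nu>" shows "Rep r (fscale a f) (cmod a * \<nu>)"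
proof -
  obtain c \<gamma> \<eta> k where
    g: "\<And>n. \<gamma> n \<in> dual E \<and> \<eta> n \<in> dual E \<and> dual_norm E (\<gamma> n) + dual_norm E (\<eta> n) \<le> r"
    and c: "summable (\<lambda>n. cmod (c n))" "(\<Sum>n. cmod (c n)) \<le> \<nu>"
    and f: "f = (\<lambda>x. \<Sum>n. c n * atom (\<gamma> n) (\<eta> n) (k n) x)"
    using assms unfolding Rep_def by blast
  have s: "summable (\<lambda>n. c n * atom (\<gamma> n) (\<eta> n) (k n) x)" for x
  proof (rule summable_norm_cancel, rule summable_comparison_test'[OF summable_mult2[OF c(1), of "exp (r * vnorm E x)"], of 0])
    show "norm (norm (c n * atom (\<gamma> n) (\<eta> n) (k n) x)) \<le> cmod (c n) * exp (r * vnorm E x)" for n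
      using g atom_eval_bound[of "\<gamma> n" "\<eta> n" r "k n" x] by (simp add: norm_mult mult_left_mono)
  qed
  show ?thesis
    unfolding Rep_def
  proof (intro exI conjI)
    show "\<forall>n. \<gamma> n \<in> dual E \<and> \<eta> n \<in> dual E \<and> dual_norm E (\<gamma> n) + dual_norm E (\<eta> n) \<le> r" using g by blast
    show "summable (\<lambda>n. cmod (a * c n))" using c by (simp add: norm_mult summable_mult)
    show "(\<Sum>n. cmod (a * c n)) \<le> cmod a * \<nu>"
      using c by (simp add: norm_mult suminf_mult mult_left_mono)
    show "fscale a f = (\<lambda>x. \<Sum>n. a * c n * atom (\<gamma> n) (\<eta> n) (k n) x)"
      using suminf_mult[OF s, of a] by (auto simp: f fun_eq_iff mult.assoc)
  qed
qed

lemma Rep_atom: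
  assumes "\<gamma> \<in> dual E" "\<eta> \<in> dual E" "dual_norm E \<gamma> + dual_norm E \<eta> \<le> r"
  shows "Rep r (atom \<gamma> \<eta> k) 1"
  unfolding Rep_def
proof (intro exI conjI)
  let ?c = "\<lambda>n. if n = 0 then 1 else (0::complex)"
  have *: "(\<lambda>n. if n = 0 then 1 else (0::real)) sums 1" using sums_single[of 0 "\<lambda>_. 1::real"] by simp
  have **: "cmod (?c n) = (if n = 0 then 1 else 0)" for n by simp
  show "\<forall>n::nat. \<gamma> \<in> dual E \<and> \<eta> \<in> dual E \<and> dual_norm E \<gamma> + dual_norm E \<eta> \<le> r" using assms by simp
  show "summable (\<lambda>n. cmod (?c n))" "(\<Sum>n. cmod (?c n)) \<le> 1"
    unfolding ** using * by (simp_all add: sums_iff)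
  have "(\<lambda>n. ?c n * atom \<gamma> \<eta> k x) sums atom \<gamma> \<eta> k x" for x
    using sums_single[of 0 "\<lambda>_. atom \<gamma> \<eta> k x"] by (simp add: if_distrib[of "\<lambda>z. z * _"] cong: if_cong)
  then show "atom \<gamma> \<eta> k = (\<lambda>x. \<Sum>n. ?c n * atom \<gamma> \<eta> k x)" by (auto simp: sums_iff)
qed

lemma Rep_zero: "0 \<le> r \<Longrightarrow> Rep r 0 0"
  using Rep_fscale[OF Rep_atom[OF E.dual_zero E.dual_zero], of r 0] by simp

text \<open>Two representations are merged by \<open>Rep_suminf\<close>, applied to a sequence that
  is zero after two terms.\<close>

lemma Rep_add:
  assumes "Rep r f \<nu>" "Rep r g \<mu>" shows "Rep r (f + g) (\<nu> + \<mu>)"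
proof -
  let ?f = "\<lambda>i::nat. if i = 0 then f else if i = 1 then g else 0"
  let ?\<nu> = "\<lambda>i::nat. if i = 0 then \<nu> else if i = 1 then \<mu> else 0"
  have R: "Rep r (?f i) (?\<nu> i)" for i
    using assms Rep_zero Rep_radius_nonneg[OF assms(1)] by simp
  have s: "?\<nu> sums (\<nu> + \<mu>)" using sums_finite[of "{0, 1::nat}" ?\<nu>] by simp
  have "(\<lambda>i. ?f i x) sums (f x + g x)" for x
    using sums_finite[of "{0, 1::nat}" "\<lambda>i. ?f i x"] by simp
  then have "(\<lambda>x. \<Sum>i. ?f i x) = f + g" by (auto simp: sums_iff)
  then show ?thesis using Rep_suminf(1)[of r ?f ?\<nu>, OF R] s by (simp add: sums_iff)
qed

lemma Rep_sum:
  assumes "finite I" "0 \<le> r" "\<And>i. i \<in> I \<Longrightarrow> Rep r (f i) (\<nu> i)"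
  shows "Rep r (sum f I) (sum \<nu> I)"
  using assms(1,3)
proof (induction I rule: finite_induct)
  case (insert i I)
  have "Rep r (f i + sum f I) (\<nu> i + sum \<nu> I)" using insert by (intro Rep_add) auto
  then show ?case by (simp only: sum.insert[OF insert(1,2)])
qed (simp add: Rep_zero assms)

lemma Rep_series:
  assumes "\<And>k. Rep r (f k) \<nu>" "summable (\<lambda>k. cmod (c k))"
  shows "Rep r (\<lambda>x. \<Sum>k. c k * f k x) ((\<Sum>k. cmod (c k)) * \<nu>)"
  using Rep_suminf(1)[of r "\<lambda>k. fscale (c k) (f k)" "\<lambda>k. cmod (c k) * \<nu>",
      OF Rep_fscale[OF assms(1)] summable_mult2[OF assms(2)]]
    suminf_mult2[OF assms(2)] by simp

lemma suminf_tail_fun: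
  assumes "\<And>i. Rep r (f i) (\<nu> i)" "summable \<nu>"
  shows "(\<lambda>x. \<Sum>i. f i x) - sum f {..<n} = (\<lambda>x. \<Sum>i. f (i + n) x)"
proof
  fix x
  have "summable (\<lambda>i. f i x)" using Rep_suminf(2)[OF assms] by (rule summable_norm_cancel)
  from suminf_minus_initial_segment[OF this, of n]
  show "((\<lambda>x. \<Sum>i. f i x) - sum f {..<n}) x = (\<Sum>i. f (i + n) x)" by (simp add: sum_fun_apply)
qed

lemma Rep_tail:
  assumes "\<And>i. Rep r (f i) (\<nu> i)" "summable \<nu>"
  shows "Rep r ((\<lambda>x. \<Sum>i. f i x) - sum f {..<n}) (\<Sum>i. \<nu> (i + n))"
  unfolding suminf_tail_fun[OF assms]
  by (rule Rep_suminf(1)) (use assms in \<open>auto simp: summable_iff_shift\<close>)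

section \<open>The topology of the space of functions of bounded type\<close>

lemma H_zero: "0 \<in> H"
  using Rep_H[OF Rep_zero[of 0]] by simp

lemma sn_zero [simp]: "s > 0 \<Longrightarrow> sn s 0 = 0"
  using sn_fscale[OF H_zero, of s 0] by simp

lemma H_sum: "(\<And>i. i \<in> I \<Longrightarrow> f i \<in> H) \<Longrightarrow> sum f I \<in> H"
  by (induction I rule: infinite_finite_induct) (auto simp: H_zero H_add)

lemma open_ball_H:
  "f \<in> H \<Longrightarrow> s > 0 \<Longrightarrow> e > 0 \<Longrightarrow> openin (bounded_type_topology A N E) {g \<in> H. sn s (g - f) < e}"
  unfolding bounded_type_topology_def seminorm_topology_def
  by (rule topology_generated_by_Basis) auto

lemma topspace_H: "topspace (bounded_type_topology A N E) = H"
proof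
  show "topspace (bounded_type_topology A N E) \<subseteq> H"
    unfolding bounded_type_topology_def seminorm_topology_def topology_generated_by_topspace by auto
  show "H \<subseteq> topspace (bounded_type_topology A N E)"
  proof
    fix f assume f: "f \<in> H"
    then have "f \<in> {g \<in> H. sn 1 (g - f) < 1}" by simp
    then show "f \<in> topspace (bounded_type_topology A N E)"
      using openin_subset[OF open_ball_H[OF f, of 1 1]] by auto
  qed
qed

text \<open>The balls are given only as a subbase. As the seminorms increase with \<open>s\<close>,
  the intersection of two balls about f contains one for the larger index, so the balls form
  neighbourhood bases.\<close>

lemma openin_H_ball:
  assumes "openin (bounded_type_topology A N E) U" "f \<in> U"
  shows "\<exists>s>0. \<exists>e>0. \<forall>g\<in>H. sn s (g - f) < e \<longrightarrow> g \<in> U"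
proof -
  have "generate_topology_on {{g \<in> H. sn i (g - f) < e} | i f e. i \<in> {0<..} \<and> f \<in> H \<and> e > 0} U"
    using assms(1) unfolding bounded_type_topology_def seminorm_topology_def
    by (simp add: openin_topology_generated_by_iff)
  then have "f \<in> H \<and> (\<exists>s>0. \<exists>e>0. \<forall>g\<in>H. sn s (g - f) < e \<longrightarrow> g \<in> U)" using assms(2)
  proof (induction arbitrary: f rule: generate_topology_on.induct)
    case Empty
    then show ?case by simp
  next
    case (Int a b)
    obtain s1 e1 where 1: "s1 > 0" "e1 > 0" "\<And>g. g \<in> H \<Longrightarrow> sn s1 (g - f) < e1 \<Longrightarrow> g \<in> a"
      and fH: "f \<in> H"
      using Int.IH(1)[of f] Int.prems by blast
    obtain s2 e2 where 2: "s2 > 0" "e2 > 0" "\<And>g. g \<in> H \<Longrightarrow> sn s2 (g - f) < e2 \<Longrightarrow> g \<in> b"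
      using Int.IH(2)[of f] Int.prems by blast
    have "g \<in> a \<inter> b" if g: "g \<in> H" "sn (max s1 s2) (g - f) < min e1 e2" for g
    proof -
      have "sn s1 (g - f) \<le> sn (max s1 s2) (g - f)" "sn s2 (g - f) \<le> sn (max s1 s2) (g - f)"
        using 1(1) 2(1) by (simp_all add: sn_mono[OF H_diff[OF g(1) fH]])
      then show ?thesis using 1(3)[OF g(1)] 2(3)[OF g(1)] g(2) by simp
    qed
    moreover have "max s1 s2 > 0" "min e1 e2 > 0" using 1 2 by auto
    ultimately show ?case using fH by blast
  next
    case (UN K)
    then obtain k where k: "k \<in> K" "f \<in> k" by auto
    from UN.IH[OF this] show ?case using k(1) by blast
  next
    case (Basis V)
    then obtain s h e where V: "V = {g \<in> H. sn s (g - h) < e}" "s > 0" "h \<in> H" by auto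
    have f: "f \<in> H" "sn s (f - h) < e" using Basis V by auto
    have "g \<in> V" if g: "g \<in> H" "sn s (g - f) < e - sn s (f - h)" for g
      using sn_triangle[OF g(1) f(1) V(3,2)] g V by simp
    moreover have "e - sn s (f - h) > 0" using f by simp
    ultimately show ?case using V(2) f(1) by blast
  qed
  then show ?thesis ..
qed

text \<open>For subsets of \<open>H\<close> this is the topological closure; testing one seminorm at
  a time is enough since they increase with \<open>s\<close>.\<close>

definition cl :: "('u \<Rightarrow> complex) set \<Rightarrow> ('u \<Rightarrow> complex) set" where
  "cl S = {f \<in> H. \<forall>s>0. \<forall>e>0. \<exists>g\<in>S. sn s (f - g) < e}"

lemma cl_H: "f \<in> cl S \<Longrightarrow> f \<in> H"
  by (simp add: cl_def)

lemma cl_D: "f \<in> cl S \<Longrightarrow> s > 0 \<Longrightarrow> e > 0 \<Longrightarrow> \<exists>g\<in>S. sn s (f - g) < e"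
  by (simp add: cl_def)

lemma cl_limit:
  assumes "S \<subseteq> H" "f \<in> H" "\<And>s e. s > 0 \<Longrightarrow> e > 0 \<Longrightarrow> \<exists>g\<in>cl S. sn s (f - g) < e"
  shows "f \<in> cl S"
  unfolding cl_def
proof (intro CollectI conjI allI impI assms(2))
  fix s e :: real assume s: "s > 0" and e: "e > 0"
  obtain g where g: "g \<in> cl S" "sn s (f - g) < e / 2" using assms(3)[of s "e / 2"] s e by auto
  obtain h where h: "h \<in> S" "sn s (g - h) < e / 2" using cl_D[OF g(1) s, of "e / 2"] e by auto
  have "sn s (f - h) \<le> sn s (f - g) + sn s (g - h)"
    using assms(1) h(1) by (intro sn_triangle assms(2) cl_H[OF g(1)] s) auto
  then show "\<exists>g\<in>S. sn s (f - g) < e" using g h by (intro bexI[of _ h]) auto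
qed

lemma cl_superset: "S \<subseteq> H \<Longrightarrow> S \<subseteq> cl S"
  unfolding cl_def by (auto intro!: bexI)

lemma cl_mono_cl:
  assumes "S \<subseteq> H" "S' \<subseteq> cl S" shows "cl S' \<subseteq> cl S"
proof
  fix f assume f: "f \<in> cl S'"
  show "f \<in> cl S" by (rule cl_limit[OF assms(1) cl_H[OF f]]) (use cl_D[OF f] assms(2) in blast)
qed

lemma cl_add:
  assumes "S \<subseteq> H" "\<And>f g. f \<in> S \<Longrightarrow> g \<in> S \<Longrightarrow> f + g \<in> S" "f \<in> cl S" "g \<in> cl S"
  shows "f + g \<in> cl S"
  unfolding cl_def
proof (intro CollectI conjI allI impI)
  show "f + g \<in> H" using assms by (intro H_add cl_H)
  fix s e :: real assume s: "s > 0" and e: "e > 0"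
  obtain f' where f': "f' \<in> S" "sn s (f - f') < e / 2" using cl_D[OF assms(3) s, of "e / 2"] e by auto
  obtain g' where g': "g' \<in> S" "sn s (g - g') < e / 2" using cl_D[OF assms(4) s, of "e / 2"] e by auto
  have eq: "(f + g) - (f' + g') = (f - f') + (g - g')" by (simp add: fun_eq_iff)
  have "sn s ((f - f') + (g - g')) \<le> sn s (f - f') + sn s (g - g')"
    using assms(1) f'(1) g'(1) by (intro sn_add H_diff cl_H[OF assms(3)] cl_H[OF assms(4)] s) auto
  then show "\<exists>h\<in>S. sn s ((f + g) - h) < e"
    using f' g' assms(2)[OF f'(1) g'(1)] by (intro bexI[of _ "f' + g'"]) (simp_all only: eq)
qed

lemma cl_fscale:
  assumes "S \<subseteq> H" "\<And>c f. f \<in> S \<Longrightarrow> fscale c f \<in> S" "f \<in> cl S"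
  shows "fscale c f \<in> cl S"
  unfolding cl_def
proof (intro CollectI conjI allI impI)
  show "fscale c f \<in> H" using assms by (intro H_fscale cl_H)
  fix s e :: real assume s: "s > 0" and e: "e > 0"
  obtain g where g: "g \<in> S" "sn s (f - g) < e / (cmod c + 1)"
    using cl_D[OF assms(3) s, of "e / (cmod c + 1)"] e by (auto simp: add_nonneg_pos)
  have fg: "f - g \<in> H" using assms g by (intro H_diff cl_H[OF assms(3)]) auto
  have eq: "fscale c f - fscale c g = fscale c (f - g)" by (simp add: fun_eq_iff right_diff_distrib)
  have "sn s (fscale c f - fscale c g) = cmod c * sn s (f - g)" unfolding eq by (rule sn_fscale[OF fg s])
  also have "\<dots> \<le> cmod c * (e / (cmod c + 1))" using g by (intro mult_left_mono) auto
  also have "\<dots> < e"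
  proof -
    have "cmod c * e < e * (cmod c + 1)" using e by (simp add: algebra_simps)
    then show ?thesis by (simp add: pos_divide_less_eq add_nonneg_pos)
  qed
  finally have "sn s (fscale c f - fscale c g) < e" .
  then show "\<exists>h\<in>S. sn s (fscale c f - h) < e" using assms(2)[OF g(1)] by blast
qed

definition subspace_H :: "('u \<Rightarrow> complex) set \<Rightarrow> bool" where
  "subspace_H S \<longleftrightarrow> S \<subseteq> H \<and> 0 \<in> S \<and> (\<forall>f\<in>S. \<forall>g\<in>S. f + g \<in> S) \<and> (\<forall>c. \<forall>f\<in>S. fscale c f \<in> S)"

lemma subspace_cl:
  assumes "subspace_H S"
  shows "f \<in> cl S \<Longrightarrow> g \<in> cl S \<Longrightarrow> f + g \<in> cl S" "f \<in> cl S \<Longrightarrow> fscale c f \<in> cl S" "0 \<in> cl S"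
    "f \<in> cl S \<Longrightarrow> g \<in> cl S \<Longrightarrow> f - g \<in> cl S"
proof -
  show 1: "f + g \<in> cl S" if "f \<in> cl S" "g \<in> cl S" for f g
    using assms that by (intro cl_add) (auto simp: subspace_H_def)
  show 2: "fscale c f \<in> cl S" if "f \<in> cl S" for c f
    using assms that by (intro cl_fscale) (auto simp: subspace_H_def)
  show "0 \<in> cl S" using assms cl_superset by (auto simp: subspace_H_def)
  show "f - g \<in> cl S" if "f \<in> cl S" "g \<in> cl S"
    using that by (simp add: fun_diff_eq_fscale 1 2)
qed

lemma subspace_cl_sum:
  assumes "subspace_H S" "\<And>i. i \<in> I \<Longrightarrow> f i \<in> cl S" shows "sum f I \<in> cl S"
  using assms(2)
  by (induction I rule: infinite_finite_induct) (auto simp: subspace_cl[OF assms(1)])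

text \<open>\<open>Rep_sn\<close> loses the factor exp(s r), which the tolerance compensates in
  advance. The radius \<open>r\<close> is the same for all e, but the seminorm index is
  arbitrary.\<close>

lemma Rep_limit_cl:
  assumes "S \<subseteq> H" "f \<in> H" "\<And>e. e > 0 \<Longrightarrow> \<exists>g\<in>cl S. Rep r (f - g) e"
  shows "f \<in> cl S"
proof (rule cl_limit[OF assms(1,2)])
  fix s e :: real assume s: "s > 0" and e: "e > 0"
  obtain g where g: "g \<in> cl S" "Rep r (f - g) (e / (2 * exp (s * r)))"
    using assms(3)[of "e / (2 * exp (s * r))"] e by auto
  have "sn s (f - g) \<le> exp (s * r) * (e / (2 * exp (s * r)))" by (rule Rep_sn[OF g(2) s])
  then show "\<exists>g\<in>cl S. sn s (f - g) < e" using g(1) e by (intro bexI[of _ g]) auto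
qed

lemma cl_suminf:
  assumes "subspace_H S" "\<And>i. Rep r (f i) (\<nu> i)" "summable \<nu>" "\<And>i. f i \<in> cl S"
  shows "(\<lambda>x. \<Sum>i. f i x) \<in> cl S"
proof (rule Rep_limit_cl[where r = r])
  show "S \<subseteq> H" using assms(1) by (simp add: subspace_H_def)
  show "(\<lambda>x. \<Sum>i. f i x) \<in> H" by (rule Rep_H[OF Rep_suminf(1)[OF assms(2,3)]])
  fix e :: real assume "e > 0"
  then obtain n where "(\<Sum>i. \<nu> (i + n)) < e"
    using order_tendstoD(2)[OF tail_suminf_tendsto_0[OF assms(3)]] by (auto simp: eventually_sequentially)
  then have "Rep r ((\<lambda>x. \<Sum>i. f i x) - sum f {..<n}) e"
    using Rep_mono[OF Rep_tail[OF assms(2,3)]] by auto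
  then show "\<exists>g\<in>cl S. Rep r ((\<lambda>x. \<Sum>i. f i x) - g) e"
    using subspace_cl_sum[OF assms(1), of "{..<n}" f] assms(4) by blast
qed

text \<open>A closed subspace containing the values of a power series along a sequence tending to
  \<open>0\<close> contains the coefficients: subtract the known terms and divide.\<close>

lemma power_series_coeffs_cl:
  assumes S: "subspace_H S" and u: "\<And>k. Rep r (u k) 1"
    and z: "z \<longlonglongrightarrow> 0" "\<And>n. z n \<noteq> 0" "\<And>n. cmod (z n) < 1"
    and G: "\<And>n. (\<lambda>x. \<Sum>k. z n ^ k * u k x) \<in> cl S"
  shows "u k \<in> cl S"
proof (induction k rule: less_induct)
  case (less k)
  show ?case
  proof (rule Rep_limit_cl[where r = r])
    show "S \<subseteq> H" using S by (simp add: subspace_H_def)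
    show "u k \<in> H" by (rule Rep_H[OF u])
    fix e :: real assume e: "e > 0"
    have "\<forall>\<^sub>F n in sequentially. cmod (z n) < min (1 / 2) (e / 2)"
      using tendsto_norm_zero[OF z(1)] e by (intro order_tendstoD(2)) auto
    \<comment> \<open>The first bound makes the geometric tail at most twice its leading term; the
      second makes the final error 2|w| smaller than e.\<close>
    then obtain n where n: "cmod (z n) < 1 / 2" "cmod (z n) < e / 2"
      by (auto simp: eventually_sequentially)
    let ?w = "z n"
    have R: "Rep r (fscale (?w ^ i) (u i)) (cmod ?w ^ i)" for i
      using Rep_fscale[OF u[of i], of "?w ^ i"] by (simp add: norm_power)
    have sw: "summable (\<lambda>i. cmod ?w ^ i)" using z(3)[of n] by (simp add: summable_geometric)
    define F where "F = (\<lambda>x. \<Sum>i. fscale (?w ^ i) (u i) x)"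
    define g where "g = fscale (inverse (?w ^ k)) (F - (\<Sum>i<k. fscale (?w ^ i) (u i)))"
    have F: "F \<in> cl S" using G[of n] by (simp add: F_def)
    have "(\<Sum>i<k. fscale (?w ^ i) (u i)) \<in> cl S"
      by (rule subspace_cl_sum[OF S]) (use less subspace_cl(2)[OF S] in auto)
    then have g: "g \<in> cl S" unfolding g_def using F by (intro subspace_cl[OF S])
    have T: "Rep r (F - (\<Sum>i<Suc k. fscale (?w ^ i) (u i))) (\<Sum>i. cmod ?w ^ (i + Suc k))"
      unfolding F_def by (rule Rep_tail[OF R sw])
    have tail: "(\<Sum>i. cmod ?w ^ (i + Suc k)) \<le> cmod ?w ^ Suc k * 2"
    proof -
      have "(\<Sum>i. cmod ?w ^ (i + Suc k)) = cmod ?w ^ Suc k * (\<Sum>i. cmod ?w ^ i)"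
        using suminf_mult[OF sw, of "cmod ?w ^ Suc k"] by (simp only: power_add mult.commute)
      also have "(\<Sum>i. cmod ?w ^ i) = 1 / (1 - cmod ?w)" using z(3)[of n] by (simp add: suminf_geometric)
      also have "\<dots> \<le> 2" using n(1) by (simp add: field_simps)
      finally show ?thesis by (simp add: mult_left_mono)
    qed
    have eq: "u k - g = fscale (- inverse (?w ^ k)) (F - (\<Sum>i<Suc k. fscale (?w ^ i) (u i)))"
      using z(2)[of n] by (simp add: g_def fun_eq_iff sum_fun_apply field_simps)
    have "Rep r (u k - g) (cmod (- inverse (?w ^ k)) * (cmod ?w ^ Suc k * 2))"
      unfolding eq by (intro Rep_fscale Rep_mono[OF T] tail order.refl)
    moreover have "cmod (- inverse (?w ^ k)) * (cmod ?w ^ Suc k * 2) = 2 * cmod ?w"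
      using z(2)[of n] by (simp add: norm_inverse norm_power)
    ultimately have "Rep r (u k - g) (2 * cmod ?w)" by (simp only:)
    then have "Rep r (u k - g) e" by (rule Rep_mono) (use n(2) in auto)
    then show "\<exists>g\<in>cl S. Rep r (u k - g) e" using g by blast
  qed
qed

section \<open>Density of the linear span of the exponentials\<close>

lemma exp_fun_atom: "exp_fun E \<gamma> = atom \<gamma> \<eta> 0"
  by (simp add: exp_fun_def atom_def)

lemma atom_fscale: "atom \<gamma> (fscale z \<eta>) k = fscale (z ^ k) (atom \<gamma> \<eta> k)"
  by (auto simp: atom_def fun_eq_iff restr_def power_mult_distrib)

lemma exp_fun_line: "exp_fun E (\<gamma> + fscale z \<eta>) = (\<lambda>x. \<Sum>k. z ^ k * atom \<gamma> \<eta> k x)"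
proof
  fix x
  show "exp_fun E (\<gamma> + fscale z \<eta>) x = (\<Sum>k. z ^ k * atom \<gamma> \<eta> k x)"
  proof (cases "x \<in> vcarrier E")
    case True
    have "(\<lambda>k. (z * \<eta> x) ^ k / fact k * exp (\<gamma> x)) sums (exp (z * \<eta> x) * exp (\<gamma> x))"
      using exp_converges[of "z * \<eta> x"] by (intro sums_mult2) (simp add: scaleR_conv_of_real field_simps)
    then show ?thesis using True
      by (simp add: sums_iff exp_fun_def atom_def exp_add power_mult_distrib mult_ac)
  qed (simp add: exp_fun_def atom_def)
qed

lemma exp_fun_H: "\<gamma> \<in> dual E \<Longrightarrow> exp_fun E \<gamma> \<in> H"
  using Rep_H[OF Rep_atom[OF _ E.dual_zero order.refl, of \<gamma> 0]] by (simp add: exp_fun_atom[of \<gamma> 0])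

lemma taylor_term_sum:
  assumes "\<And>i. i \<in> I \<Longrightarrow> f i \<in> H"
  shows "taylor_term E (sum f I) m = (\<Sum>i\<in>I. taylor_term E (f i) m)"
  using assms
proof (induction I rule: infinite_finite_induct)
  case (insert i I)
  have "taylor_term E (f i + sum f I) m = taylor_term E (f i) m + taylor_term E (sum f I) m"
    using insert by (intro taylor_term_add E.complex_normed_space_axioms H_holomorphic H_sum) auto
  also have "taylor_term E (sum f I) m = (\<Sum>i\<in>I. taylor_term E (f i) m)"
    using insert by (intro insert.IH) auto
  finally show ?case by (simp only: sum.insert[OF insert(1,2)])
qed (use taylor_term_fscale[OF E.complex_normed_space_axioms H_holomorphic[OF H_zero], of 0] in auto)

lemma taylor_term_diff:
  assumes "f \<in> H" "g \<in> H"
  shows "taylor_term E (f - g) m = taylor_term E f m - taylor_term E g m"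
proof -
  have "taylor_term E (f + fscale (-1) g) m = taylor_term E f m + fscale (-1) (taylor_term E g m)"
    using assms by (simp add: taylor_term_add taylor_term_fscale holomorphic_funs_fscale H_holomorphic
        E.complex_normed_space_axioms)
  then show ?thesis by (simp only: fun_diff_eq_fscale)
qed

lemma taylor_term_homog:
  assumes "P \<in> A k E"
  shows "taylor_term E P = (\<lambda>m. if m = k then P else 0)"
proof (rule taylor_term_eq[OF E.complex_normed_space_axioms])
  let ?T = "\<lambda>m. if m = k then P else 0"
  have "uniform_limit (vball E (vzero E) 1) (\<lambda>n x. \<Sum>i<n. ?T i (vdiff E x (vzero E))) P sequentially"
  proof (rule uniform_limitI)
    fix e :: real assume e: "e > 0"
    show "\<forall>\<^sub>F n in sequentially. \<forall>x\<in>vball E (vzero E) 1. dist (\<Sum>i<n. ?T i (vdiff E x (vzero E))) (P x) < e"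
      using eventually_gt_at_top[of k]
    proof eventually_elim
      case (elim n)
      have "(\<Sum>i<n. ?T i y) = (\<Sum>i<n. if i = k then P y else 0)" for y
        by (intro sum.cong) auto
      then have "(\<Sum>i<n. ?T i y) = P y" for y using elim by simp
      then show ?case using e by (simp add: E.vball_iff E.vdiff_vzero)
    qed
  qed
  then show "power_series_expansion E P (vzero E) ?T"
    using A_subset[OF assms] A_subset[OF A_zero]
    unfolding power_series_expansion_def by (intro conjI exI[of _ 1]) auto
qed

text \<open>The exponentials span a dense subspace: differentiating \<open>e\<^bsup>z\<gamma>\<^esup>\<close> at \<open>z = 0\<close> yields the powers
  of \<open>\<gamma>\<close>, hence all finite type polynomials, hence by density all Taylor polynomials.\<close>

lemma exp_funs_cl:
  assumes S: "subspace_H S" and e: "\<And>\<gamma>. \<gamma> \<in> dual E \<Longrightarrow> exp_fun E \<gamma> \<in> cl S"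
  shows "cl S = H"
proof
  show "cl S \<subseteq> H" using cl_H by blast
  have SH: "S \<subseteq> H" using S by (simp add: subspace_H_def)
  have pw: "restr E (\<lambda>x. \<gamma> x ^ k) \<in> cl S" if g: "\<gamma> \<in> dual E" for \<gamma> k
  proof -
    \<comment> \<open>The exponential of z \<gamma> is a power series in z with these coefficients;
      it is sampled at z = 1/(n + 2), the shift by 2 keeping |z| below 1.\<close>
    have "atom 0 \<gamma> k \<in> cl S"
    proof (rule power_series_coeffs_cl[OF S])
      show "Rep (dual_norm E \<gamma>) (atom 0 \<gamma> k) 1" for k
        by (rule Rep_atom) (use g E.dual_zero in auto)
      show "(\<lambda>n. 1 / of_nat (n + 2) :: complex) \<longlonglongrightarrow> 0"
        using LIMSEQ_ignore_initial_segment[OF lim_1_over_n, of 2] by simp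
      show "1 / of_nat (n + 2) \<noteq> (0 :: complex)" for n by (simp flip: of_nat_Suc del: of_nat_add)
      show "cmod (1 / of_nat (n + 2)) < 1" for n
        unfolding norm_divide norm_of_nat norm_one by simp
      show "(\<lambda>x. \<Sum>k. (1 / of_nat (n + 2)) ^ k * atom 0 \<gamma> k x) \<in> cl S" for n
        using e[OF E.dual_plus[OF E.dual_zero E.dual_fscale[OF g]]] unfolding exp_fun_line by blast
    qed
    then have "fscale (fact k) (atom 0 \<gamma> k) \<in> cl S" by (rule subspace_cl(2)[OF S])
    moreover have "fscale (fact k) (atom 0 \<gamma> k) = restr E (\<lambda>x. \<gamma> x ^ k)"
      by (auto simp: atom_def fun_eq_iff restr_def)
    ultimately show ?thesis by simp
  qed
  interpret FM: module fscale
    by unfold_locales (auto simp: fun_eq_iff algebra_simps)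
  have ft: "finite_type_polys k E \<subseteq> cl S" for k
    unfolding finite_type_polys_def
  proof
    fix f assume "f \<in> FM.span {restr E (\<lambda>x. \<gamma> x ^ k) |\<gamma>. \<gamma> \<in> dual E}"
    then show "f \<in> cl S"
    proof (induction rule: FM.span_induct_alt)
      case base
      show ?case by (rule subspace_cl(3)[OF S])
    next
      case (step c x y)
      then have "x \<in> cl S" using pw by blast
      then show ?case using step by (intro subspace_cl(1,2)[OF S])
    qed
  qed
  show "H \<subseteq> cl S"
  proof
    fix f assume f: "f \<in> H"
    let ?P = "taylor_term E f"
    show "f \<in> cl S"
    proof (rule cl_limit[OF SH f])
      fix s e :: real assume s: "s > 0" and e: "e > 0"
      have sm: "summable (\<lambda>k. s ^ k * N k E (?P k))" by (rule H_summable[OF f s])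
      obtain n where n: "(\<Sum>i. s ^ (i + n) * N (i + n) E (?P (i + n))) < e / 2"
        using order_tendstoD(2)[OF tail_suminf_tendsto_0[OF sm], of "e / 2"] e
        by (auto simp: eventually_sequentially)
      \<comment> \<open>The weight s^k is divided out so that each of the n approximated degrees
        contributes at most e / (2 (n + 1)), altogether at most e/2.\<close>
      define \<delta> where "\<delta> k = e / (2 * (real n + 1) * s ^ k)" for k
      have \<delta>: "\<delta> k > 0" for k using s e by (simp add: \<delta>_def)
      have "\<exists>Q\<in>finite_type_polys k E. N k E (?P k - Q) < \<delta> k" for k
      proof -
        interpret M: Metric_space "A k E" "vdist (ideal_space A N k E)"
          using complex_normed_space.metric[OF A_normed, of k] by simp
        have "?P k \<in> M.mtopology closure_of finite_type_polys k E"
          using finite_type[of k] H_taylor[OF f, of k] by (simp add: finite_type_dense_def)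
        then obtain Q where "Q \<in> finite_type_polys k E" "Q \<in> M.mball (?P k) (\<delta> k)"
          using \<delta> unfolding M.metric_closure_of by blast
        then show ?thesis by (auto simp: M.mball_def vdist_def)
      qed
      then obtain Q where Q: "\<And>k. Q k \<in> finite_type_polys k E" "\<And>k. N k E (?P k - Q k) < \<delta> k"
        by metis
      have QA: "Q k \<in> A k E" for k using Q(1)[of k] finite_type[of k] by (auto simp: finite_type_dense_def)
      have QH: "Q k \<in> H" for k using Q(1) ft cl_H by blast
      define g where "g = (\<Sum>k<n. Q k)"
      have g: "g \<in> cl S" unfolding g_def by (rule subspace_cl_sum[OF S]) (use Q(1) ft in blast)
      define h where "h = f - g"
      have T: "taylor_term E h m = (if m < n then ?P m - Q m else ?P m)" for m
      proof -
        have "taylor_term E g m = (\<Sum>k<n. taylor_term E (Q k) m)"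
          unfolding g_def by (rule taylor_term_sum[OF QH])
        also have "\<dots> = (\<Sum>k<n. if k = m then Q m else 0)"
          using taylor_term_homog[OF QA] by (intro sum.cong) auto
        finally show ?thesis
          using taylor_term_diff[OF f cl_H[OF g], of m] by (auto simp: h_def)
      qed
      have fg: "h \<in> H" unfolding h_def by (intro H_diff f cl_H[OF g])
      have "sn s h = (\<Sum>i. s ^ (i + n) * N (i + n) E (taylor_term E h (i + n)))
          + (\<Sum>i<n. s ^ i * N i E (taylor_term E h i))"
        unfolding bounded_type_seminorm_def
        by (rule suminf_split_initial_segment[OF H_summable[OF fg s]])
      also have "(\<Sum>i<n. s ^ i * N i E (taylor_term E h i)) \<le> (\<Sum>i<n. e / (2 * (real n + 1)))"
      proof (rule sum_mono)
        fix i assume i: "i \<in> {..<n}"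
        then have "s ^ i * N i E (taylor_term E h i) \<le> s ^ i * \<delta> i"
          using Q(2)[of i] s by (intro mult_left_mono) (auto simp: T)
        also have "\<dots> = e / (2 * (real n + 1))" using s by (simp add: \<delta>_def)
        finally show "s ^ i * N i E (taylor_term E h i) \<le> e / (2 * (real n + 1))" .
      qed
      also have "(\<Sum>i<n. e / (2 * (real n + 1))) \<le> e / 2" using e by (simp add: field_simps)
      finally have "sn s h < e" using n by (simp add: T)
      then show "\<exists>g\<in>cl S. sn s (f - g) < e" using g unfolding h_def by blast
    qed
  qed
qed

end

section \<open>Separated sets of positive lower density\<close>

lemma lower_density_pos:
  assumes "\<delta> > 0" "\<And>x. x \<ge> x0 \<Longrightarrow> \<delta> * real (x + 1) \<le> real (card (S \<inter> {..x}))"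
  shows "lower_density S > 0"
proof -
  have "ereal \<delta> \<le> lower_density S"
    unfolding lower_density_def
  proof (rule Liminf_bounded)
    show "\<forall>\<^sub>F n in sequentially. ereal \<delta> \<le> ereal (real (card (S \<inter> {..n})) / real (n + 1))"
      using eventually_ge_at_top[of x0]
    proof eventually_elim
      case (elim n)
      have "0 < real (n + 1)" by simp
      from pos_le_divide_eq[OF this] assms(2)[OF elim] show ?case by simp
    qed
  qed
  then show ?thesis using assms(1) by (metis ereal_less(2) less_le_trans)
qed

lemma lower_density_mono:
  assumes "S \<subseteq> S'" shows "lower_density S \<le> lower_density S'"
  unfolding lower_density_def
  by (intro Liminf_mono always_eventually allI) (use assms in \<open>auto intro!: divide_right_mono card_mono\<close>)

text \<open>Windows of radius L_k about the multiples of the k-th period fill a proportion of about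
  2 L_k divided by that period. The factor 16 * 2^k L_k makes this small against the inverses of all
  earlier periods, summably in k; the second factor L_k absorbs the windows that reach across the
  end of an initial segment.\<close>

fun period :: "(nat \<Rightarrow> nat) \<Rightarrow> nat \<Rightarrow> nat" where
  "period L 0 = L 0"
| "period L (Suc k) = 16 * 2 ^ Suc k * L (Suc k) ^ 2 * period L k"

lemma period_pos: "(\<And>k. L k > 0) \<Longrightarrow> period L k > 0"
  by (induction k) auto

lemma period_mono: "(\<And>k. L k > 0) \<Longrightarrow> j \<le> k \<Longrightarrow> period L j \<le> period L k"
proof (induction k)
  case (Suc k)
  have "period L k * 1 \<le> period L k * (16 * 2 ^ Suc k * L (Suc k) ^ 2)"
    using Suc.prems(1)[of "Suc k"] by (intro mult_left_mono) (auto simp: Suc_le_eq)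
  also have "\<dots> = period L (Suc k)" by (simp add: mult_ac)
  finally have "period L k \<le> period L (Suc k)" by simp
  then show ?case using Suc by (cases "j = Suc k") (auto simp del: period.simps intro: order.trans)
qed simp

lemma card_multiples_le:
  assumes "b > 0" shows "finite {m. 0 < m \<and> b dvd m \<and> m < (y::nat)}"
    and "card {m. 0 < m \<and> b dvd m \<and> m < y} \<le> y div b"
proof -
  have sub: "{m. 0 < m \<and> b dvd m \<and> m < y} \<subseteq> (\<lambda>i. b * i) ` {1..y div b}"
  proof
    fix m assume m: "m \<in> {m. 0 < m \<and> b dvd m \<and> m < y}"
    then obtain i where i: "m = b * i" by (auto elim: dvdE)
    have "i \<le> y div b" using m i assms by (simp add: less_eq_div_iff_mult_less_eq mult.commute)
    then show "m \<in> (\<lambda>i. b * i) ` {1..y div b}" using m i by auto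
  qed
  then show "finite {m. 0 < m \<and> b dvd m \<and> m < y}" by (rule finite_subset) simp
  have "card {m. 0 < m \<and> b dvd m \<and> m < y} \<le> card ((\<lambda>i. b * i) ` {1..y div b})"
    using sub by (intro card_mono) auto
  also have "\<dots> \<le> y div b" using card_image_le[of "{1..y div b}" "\<lambda>i. b * i"] by simp
  finally show "card {m. 0 < m \<and> b dvd m \<and> m < y} \<le> y div b" .
qed

lemma card_multiples_ge:
  assumes "b > 0" shows "x div b \<le> card {n. 0 < n \<and> b dvd n \<and> n \<le> (x::nat)}"
proof -
  have "(\<lambda>i. b * i) ` {1..x div b} \<subseteq> {n. 0 < n \<and> b dvd n \<and> n \<le> x}"
    using assms by (auto simp: less_eq_div_iff_mult_less_eq mult.commute)
  moreover have "finite {n. 0 < n \<and> b dvd n \<and> n \<le> x}" by (rule finite_subset[of _ "{..x}"]) auto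
  ultimately have "card ((\<lambda>i. b * i) ` {1..x div b}) \<le> card {n. 0 < n \<and> b dvd n \<and> n \<le> x}"
    by (rule card_mono[rotated])
  moreover have "card ((\<lambda>i. b * i) ` {1..x div b}) = x div b"
    using assms by (subst card_image) (auto simp: inj_on_def)
  ultimately show ?thesis by simp
qed

text \<open>The \<open>j\<close>-th set consists of the multiples of a rapidly growing period, with those removed that
  are too close to a multiple of a later period; the removed part has small density.\<close>

lemma separated_sets:
  fixes L :: "nat \<Rightarrow> nat"
  assumes pos: "\<And>k. L k > 0" and mono: "\<And>j k. j \<le> k \<Longrightarrow> L j \<le> L k"
  shows "\<exists>S. (\<forall>k. lower_density (S k) > 0) \<and> (\<forall>k. \<forall>n\<in>S k. L k \<le> n) \<and>
    (\<forall>j k. \<forall>n\<in>S j. \<forall>m\<in>S k. (j, n) \<noteq> (k, m) \<longrightarrow> int (max (L j) (L k)) \<le> \<bar>int n - int m\<bar>)"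
proof -
  define b where "b = period L"
  have b0: "b k > 0" for k unfolding b_def by (rule period_pos[OF pos])
  have bS: "b (Suc k) = 16 * 2 ^ Suc k * L (Suc k) ^ 2 * b k" for k by (simp add: b_def)
  have bL: "L k \<le> b k" for k
  proof (cases k)
    case 0
    then show ?thesis by (simp add: b_def)
  next
    case (Suc i)
    have "L k * 1 \<le> L k * (16 * 2 ^ k * L k * b i)"
      using pos[of k] b0[of i] by (intro mult_left_mono) (auto simp: Suc_le_eq)
    also have "\<dots> = b k" by (simp add: Suc bS power2_eq_square mult_ac)
    finally show ?thesis by simp
  qed
  define S where "S j = {n. 0 < n \<and> b j dvd n \<and>
      (\<forall>k>j. \<forall>m. 0 < m \<and> b k dvd m \<longrightarrow> int (L k) \<le> \<bar>int n - int m\<bar>)}" for j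
  have S1: "L k \<le> n" if "n \<in> S k" for k n
    using that bL[of k] by (auto simp: S_def dest!: dvd_imp_le)
  have lt: "int (max (L j) (L k)) \<le> \<bar>int n - int m\<bar>" if "n \<in> S j" "m \<in> S k" "j < k" for j k n m
    using that mono[of j k] by (auto simp: S_def max_def)
  have S2: "int (max (L j) (L k)) \<le> \<bar>int n - int m\<bar>"
    if n: "n \<in> S j" and m: "m \<in> S k" and ne: "(j, n) \<noteq> (k, m)" for j k n m
  proof (cases j k rule: linorder_cases)
    case less
    then show ?thesis using lt[OF n m] by simp
  next
    case greater
    then show ?thesis using lt[OF m n] by (simp add: max.commute abs_minus_commute)
  next
    case equal
    then have "int (b j) dvd int n - int m" "int n - int m \<noteq> 0" using n m ne by (auto simp: S_def)
    then have "int (b j) \<le> \<bar>int n - int m\<bar>"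
      using dvd_imp_le_int[of "int n - int m" "int (b j)"] by simp
    then show ?thesis using equal bL[of j] by simp
  qed
  have S3: "lower_density (S j) > 0" for j
  proof (rule lower_density_pos)
    show "1 / (4 * real (b j)) > 0" using b0[of j] by simp
    \<comment> \<open>At least x / b_j - 1 multiples of b_j lie up to x, and at most x / (4 b_j) +
      1/4 points are removed; for x at least 8 b_j the difference exceeds (x + 1) / (4 b_j).\<close>
    fix x assume x: "8 * b j \<le> x"
    define M where "M = {n. 0 < n \<and> b j dvd n \<and> n \<le> x}"
    \<comment> \<open>A multiple m can exclude some n up to x only if m < x + L_k.\<close>
    define R where "R k = {m. 0 < m \<and> b k dvd m \<and> m < x + L k}" for k
    define B where "B k = (\<Union>m\<in>R k. {n. \<bar>int n - int m\<bar> < int (L k)})" for k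
    have finR: "finite (R k)" for k unfolding R_def by (rule card_multiples_le(1)[OF b0])
    have cball: "card {n. \<bar>int n - int m\<bar> < int l} \<le> 2 * l" and fball: "finite {n. \<bar>int n - int m\<bar> < int l}" for m l
    proof -
      have sub: "{n. \<bar>int n - int m\<bar> < int l} \<subseteq> {m + 1 - l..<m + l}" by auto
      then show "finite {n. \<bar>int n - int m\<bar> < int l}" by (rule finite_subset) simp
      have "card {n. \<bar>int n - int m\<bar> < int l} \<le> card {m + 1 - l..<m + l}" by (rule card_mono[OF _ sub]) simp
      also have "\<dots> \<le> 2 * l" by simp
      finally show "card {n. \<bar>int n - int m\<bar> < int l} \<le> 2 * l" .
    qed
    have finB: "finite (B k)" for k unfolding B_def using finR fball by auto
    have cB: "real (card (B k)) \<le> real x * (1 / 2) ^ k / (8 * real (b j)) + (1 / 2) ^ k / 8" if jk: "j < k" for k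
    proof -
      obtain i where i: "k = Suc i" using jk not0_implies_Suc[of k] by auto
      have bk: "real (b k) = 16 * 2 ^ k * real (L k) ^ 2 * real (b i)"
        unfolding i bS by simp
      have bi: "real (b j) \<le> real (b i)"
        using period_mono[OF pos, of j i] jk i by (simp add: b_def)
      have bj: "real (b j) \<ge> 1" using b0[of j] by simp
      have Lk: "real (L k) \<ge> 1" using pos[of k] by simp
      have "card (B k) \<le> (\<Sum>m\<in>R k. card {n. \<bar>int n - int m\<bar> < int (L k)})"
        unfolding B_def by (rule card_UN_le[OF finR])
      also have "\<dots> \<le> (\<Sum>m\<in>R k. 2 * L k)" by (intro sum_mono cball)
      also have "\<dots> = card (R k) * (2 * L k)" by simp
      also have "\<dots> \<le> ((x + L k) div b k) * (2 * L k)"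
        unfolding R_def by (intro mult_right_mono card_multiples_le(2) b0) auto
      finally have "real (card (B k)) \<le> real ((x + L k) div b k) * (2 * real (L k))"
        by (metis of_nat_le_iff of_nat_mult of_nat_numeral)
      also have "\<dots> \<le> (real x + real (L k)) / real (b k) * (2 * real (L k))"
        using of_nat_div_le_of_nat[of "x + L k" "b k", where ?'a = real] by (intro mult_right_mono) auto
      also have "\<dots> = (real x / real (L k) + 1) * ((1 / 2) ^ k / (8 * real (b i)))"
        using Lk bj bi unfolding bk by (simp add: field_simps power2_eq_square)
      also have "\<dots> \<le> (real x + 1) * ((1 / 2) ^ k / (8 * real (b i)))"
      proof -
        have "real x / real (L k) \<le> real x / 1" using Lk by (intro divide_left_mono) auto
        then show ?thesis by (intro mult_right_mono) auto
      qed
      also have "\<dots> = real x * ((1 / 2) ^ k / (8 * real (b i))) + (1 / 2) ^ k / (8 * real (b i))"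
        by (simp only: distrib_right mult_1)
      also have "\<dots> \<le> real x * ((1 / 2) ^ k / (8 * real (b j))) + (1 / 2) ^ k / (8 * 1)"
        using bi bj by (intro add_mono mult_left_mono divide_left_mono) auto
      finally show ?thesis by simp
    qed
    \<comment> \<open>Only finitely many k interfere below x: for k > x the period exceeds x + L_k
      because 2^k > x.\<close>
    have Bemp: "B k = {}" if kx: "k > x" and jk: "k > j" for k
    proof -
      obtain i where i: "k = Suc i" using jk not0_implies_Suc[of k] by auto
      have "x < 2 ^ k" using kx less_exp[of k] by (rule less_trans)
      then have "x + L k \<le> 2 ^ k + L k" by simp
      also have "\<dots> \<le> 2 ^ k * L k + 2 ^ k * L k"
        using pos[of k] by (intro add_mono) (auto simp: Suc_le_eq)
      also have "\<dots> = (2 * 2 ^ k * L k) * 1" by simp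
      also have "\<dots> \<le> (2 * 2 ^ k * L k) * (8 * L k * b i)"
        using pos[of k] b0[of i] by (intro mult_left_mono) (auto simp: Suc_le_eq)
      also have "\<dots> = b k" unfolding i bS by (simp add: power2_eq_square)
      finally have "R k = {}" by (auto simp: R_def dest!: dvd_imp_le)
      then show ?thesis by (simp add: B_def)
    qed
    let ?U = "\<Union>k\<in>{j<..x}. B k"
    have sub: "M - ?U \<subseteq> S j \<inter> {..x}"
    proof
      fix n assume n: "n \<in> M - ?U"
      have "int (L k) \<le> \<bar>int n - int m\<bar>" if k: "k > j" "0 < m" "b k dvd m" for k m
      proof (rule ccontr)
        assume "\<not> ?thesis"
        then have d: "\<bar>int n - int m\<bar> < int (L k)" by simp
        then have "m \<in> R k" using n k by (auto simp: M_def R_def)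
        then have "n \<in> B k" using d by (auto simp: B_def)
        then show False using n k Bemp[of k] by (cases "k \<le> x") auto
      qed
      then show "n \<in> S j \<inter> {..x}" using n by (auto simp: S_def M_def)
    qed
    have "real (card ?U) \<le> (\<Sum>k\<in>{j<..x}. real (card (B k)))"
      using card_UN_le[of "{j<..x}" B] by (simp flip: of_nat_sum)
    also have "\<dots> \<le> (\<Sum>k\<in>{j<..x}. (real x / (8 * real (b j)) + 1 / 8) * (1 / 2) ^ k)"
      using cB by (intro sum_mono) (auto simp: algebra_simps)
    also have "\<dots> = (real x / (8 * real (b j)) + 1 / 8) * (\<Sum>k\<in>{j<..x}. (1 / 2) ^ k)"
      by (simp add: sum_distrib_left)
    also have "\<dots> \<le> (real x / (8 * real (b j)) + 1 / 8) * 2"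
    proof (intro mult_left_mono)
      have "(\<Sum>k\<in>{j<..x}. (1 / 2) ^ k) \<le> (\<Sum>k. (1 / 2 :: real) ^ k)"
        by (intro sum_le_suminf summable_geometric) auto
      then show "(\<Sum>k\<in>{j<..x}. (1 / 2 :: real) ^ k) \<le> 2" by (simp add: suminf_geometric)
    qed simp
    also have "\<dots> = real x / (4 * real (b j)) + 1 / 4" by (simp add: distrib_right)
    finally have U: "real (card ?U) \<le> real x / (4 * real (b j)) + 1 / 4" .
    have "real x / real (b j) - 1 \<le> real (x div b j)"
    proof -
      have "x < b j * (x div b j + 1)" using dividend_less_times_div[of "b j" x] b0[of j] by simp
      then have "real x < real (b j) * (real (x div b j) + 1)"
        by (metis of_nat_1 of_nat_add of_nat_less_iff of_nat_mult)
      then show ?thesis using b0[of j] by (simp add: field_simps)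
    qed
    also have "\<dots> \<le> real (card M)" unfolding M_def using card_multiples_ge[OF b0] by simp
    finally have cM: "real x / real (b j) - 1 \<le> real (card M)" .
    have "card M - card ?U \<le> card (M - ?U)" by (rule diff_card_le_card_Diff) (use finB in auto)
    also have "\<dots> \<le> card (S j \<inter> {..x})" by (rule card_mono[OF _ sub]) simp
    finally have "real (card M) - real (card ?U) \<le> real (card (S j \<inter> {..x}))" by linarith
    then have "real x / real (b j) - 1 - (real x / (4 * real (b j)) + 1 / 4) \<le> real (card (S j \<inter> {..x}))"
      using U cM by linarith
    moreover have "1 / (4 * real (b j)) * real (x + 1) \<le> real x / real (b j) - 1 - (real x / (4 * real (b j)) + 1 / 4)"
    proof -
      have "8 * real (b j) \<le> real x" using x by (metis of_nat_le_iff of_nat_mult of_nat_numeral)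
      then have q: "8 \<le> real x / real (b j)" using b0[of j] by (simp add: field_simps)
      define w where "w = 1 / real (b j)"
      define q where "q = real x / real (b j)"
      have "1 / (4 * real (b j)) * real (x + 1) = q / 4 + w / 4"
        unfolding q_def w_def using b0[of j] by (simp add: field_simps)
      moreover have "real x / (4 * real (b j)) = q / 4" unfolding q_def by simp
      moreover have "w \<le> 1" using b0[of j] by (simp add: w_def)
      ultimately show ?thesis using q unfolding q_def[symmetric] by linarith
    qed
    ultimately show "1 / (4 * real (b j)) * real (x + 1) \<le> real (card (S j \<inter> {..x}))" by linarith
  qed
  show ?thesis using S1 S2 S3 by (intro exI[of _ S]) blast
qed

section \<open>Convolution operators\<close>

locale convolution = poly_ideal_space A N E
  for A :: "nat \<Rightarrow> 'u poly_class" and N :: "nat \<Rightarrow> 'u poly_norm" and E :: "'u nspace" +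
  fixes T :: "('u \<Rightarrow> complex) \<Rightarrow> ('u \<Rightarrow> complex)"
  assumes conv: "convolution_operator A N E T"
begin

lemma T_H: "f \<in> H \<Longrightarrow> T f \<in> H"
  and T_add: "f \<in> H \<Longrightarrow> g \<in> H \<Longrightarrow> T (f + g) = T f + T g"
  and T_fscale: "f \<in> H \<Longrightarrow> T (fscale c f) = fscale c (T f)"
  and T_translation: "x \<in> vcarrier E \<Longrightarrow> f \<in> H \<Longrightarrow> T (translation E x f) = translation E x (T f)"
  using conv by (auto simp: convolution_operator_def linear_map_def)

lemma T_zero: "T 0 = 0"
  using T_fscale[OF H_zero, of 0] by simp

lemma T_diff: "f \<in> H \<Longrightarrow> g \<in> H \<Longrightarrow> T (f - g) = T f - T g"
  by (simp only: fun_diff_eq_fscale T_add T_fscale H_fscale)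

lemma T_sum:
  assumes "\<And>i. i \<in> I \<Longrightarrow> f i \<in> H" shows "T (sum f I) = (\<Sum>i\<in>I. T (f i))"
  using assms
proof (induction I rule: infinite_finite_induct)
  case (insert i I)
  have "T (f i + sum f I) = T (f i) + T (sum f I)" using insert by (intro T_add H_sum) auto
  also have "T (sum f I) = (\<Sum>i\<in>I. T (f i))" using insert by (intro insert.IH) auto
  finally show ?case by (simp only: sum.insert[OF insert(1,2)])
qed (auto simp: T_zero)

text \<open>Some ball of a single seminorm is mapped into the unit ball of \<open>sn s\<close>;
  scaling f to seminorm e/2 gives the constant 2/e. When the seminorm of f is 0 there is nothing to
  scale, but then f = 0.\<close>

lemma T_bound:
  assumes s: "s > 0"
  shows "\<exists>t>0. \<exists>C\<ge>0. \<forall>f\<in>H. sn s (T f) \<le> C * sn t f"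
proof -
  let ?\<tau> = "bounded_type_topology A N E"
  let ?U = "{g \<in> H. sn s (g - 0) < 1}"
  define V where "V = {f \<in> topspace ?\<tau>. T f \<in> ?U}"
  have "openin ?\<tau> V"
    unfolding V_def using conv open_ball_H[OF H_zero s, of 1]
    by (intro openin_continuous_map_preimage) (auto simp: convolution_operator_def)
  moreover have "0 \<in> V" unfolding V_def
    using s by (simp add: topspace_H H_zero T_zero)
  ultimately have "\<exists>t>0. \<exists>e>0. \<forall>g\<in>H. sn t (g - 0) < e \<longrightarrow> g \<in> V"
    by (rule openin_H_ball)
  then obtain t e where te: "t > 0" "e > 0" "\<And>g. g \<in> H \<Longrightarrow> sn t (g - 0) < e \<Longrightarrow> g \<in> V"
    by blast
  have "sn s (T f) \<le> 2 / e * sn t f" if f: "f \<in> H" for f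
  proof (cases "sn t f = 0")
    case True
    then have "f = 0" using sn_eq_zero[OF f te(1)] by simp
    then show ?thesis using s te by (simp add: T_zero)
  next
    case False
    then have p: "sn t f > 0" using sn_nonneg[OF f te(1)] by simp
    let ?c = "complex_of_real (e / (2 * sn t f))"
    have c: "cmod ?c = e / (2 * sn t f)" using p te by (simp add: norm_divide norm_mult)
    have "sn t (fscale ?c f) = e / 2" unfolding sn_fscale[OF f te(1)] c using p by simp
    then have "sn t (fscale ?c f - 0) < e" using te(2) by (simp only: diff_zero)
    from te(3)[OF H_fscale[OF f] this] have "sn s (T (fscale ?c f)) < 1" unfolding V_def by (simp only: mem_Collect_eq diff_zero)
    then have "e / (2 * sn t f) * sn s (T f) < 1"
      by (simp only: T_fscale[OF f] sn_fscale[OF T_H[OF f] s] c)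
    then show ?thesis using p te(2) by (simp add: field_simps)
  qed
  then show ?thesis using te by (intro exI[of _ t] conjI exI[of _ "2 / e"]) auto
qed

text \<open>Linearity settles the partial sums. Both tails vanish in \<open>Rep\<close>, one of them
  after applying the continuity of \<open>T\<close>, so the two sides agree in \<open>sn 1\<close>,
  which separates functions.\<close>

lemma T_series:
  assumes R: "\<And>i. Rep r (f i) (\<nu> i)" and \<nu>: "summable \<nu>"
    and R': "\<And>i. Rep r' (T (f i)) (\<mu> i)" and \<mu>: "summable \<mu>"
  shows "T (\<lambda>x. \<Sum>i. f i x) = (\<lambda>x. \<Sum>i. T (f i) x)"
proof -
  define F where "F = (\<lambda>x. \<Sum>i. f i x)"
  define G where "G = (\<lambda>x. \<Sum>i. T (f i) x)"
  define S where "S n = sum f {..<n}" for n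
  define S' where "S' n = (\<Sum>i<n. T (f i))" for n
  have FH: "F \<in> H" unfolding F_def by (rule Rep_H[OF Rep_suminf(1)[OF R \<nu>]])
  have GH: "G \<in> H" unfolding G_def by (rule Rep_H[OF Rep_suminf(1)[OF R' \<mu>]])
  have SH: "S n \<in> H" for n unfolding S_def by (intro H_sum Rep_H[OF R])
  have TS: "T (S n) = S' n" for n unfolding S_def S'_def by (intro T_sum Rep_H[OF R])
  have S'H: "S' n \<in> H" for n using T_H[OF SH[of n]] TS by simp
  obtain t C where tC: "t > 0" "C \<ge> 0" "\<And>f. f \<in> H \<Longrightarrow> sn 1 (T f) \<le> C * sn t f"
    using T_bound[of 1] by auto
  define h where "h = T F - G"
  have "sn 1 h \<le> C * (exp (t * r) * (\<Sum>i. \<nu> (i + n))) + exp (1 * r') * (\<Sum>i. \<mu> (i + n))" for n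
  proof -
    have "sn 1 h \<le> sn 1 (T F - S' n) + sn 1 (S' n - G)"
      unfolding h_def by (intro sn_triangle T_H FH GH S'H) auto
    also have "T F - S' n = T (F - S n)" by (simp only: T_diff[OF FH SH] TS)
    also have "sn 1 (T (F - S n)) \<le> C * sn t (F - S n)" by (intro tC H_diff FH SH)
    also have "sn t (F - S n) \<le> exp (t * r) * (\<Sum>i. \<nu> (i + n))"
      unfolding F_def S_def by (intro Rep_sn[OF Rep_tail[OF R \<nu>]] tC)
    also have "sn 1 (S' n - G) = sn 1 (G - S' n)" by (intro sn_diff_commute GH S'H) auto
    also have "\<dots> \<le> exp (1 * r') * (\<Sum>i. \<mu> (i + n))"
      unfolding G_def S'_def by (intro Rep_sn[OF Rep_tail[OF R' \<mu>]]) auto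
    finally show ?thesis using tC(2) by (simp add: mult_left_mono)
  qed
  moreover have "(\<lambda>n. C * (exp (t * r) * (\<Sum>i. \<nu> (i + n))) + exp (1 * r') * (\<Sum>i. \<mu> (i + n)))
      \<longlonglongrightarrow> C * (exp (t * r) * 0) + exp (1 * r') * 0"
    by (intro tendsto_intros tail_suminf_tendsto_0 \<nu> \<mu>)
  ultimately have "sn 1 h \<le> C * (exp (t * r) * 0) + exp (1 * r') * 0"
    by (intro LIMSEQ_le_const) auto
  moreover have hH: "h \<in> H" unfolding h_def by (intro H_diff T_H FH GH)
  ultimately have "h = 0" using sn_eq_zero[OF hH, of 1] sn_nonneg[OF hH, of 1] by simp
  then have "T F - G = 0" by (simp only: h_def)
  then have "T F = G" by (simp add: fun_eq_iff)
  then show ?thesis by (simp add: F_def G_def)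
qed

definition ev :: "('u \<Rightarrow> complex) \<Rightarrow> complex" where
  "ev f = T f (vzero E)"

lemma ev_bound: "\<exists>t>0. \<exists>C\<ge>0. \<forall>f\<in>H. cmod (ev f) \<le> C * sn t f"
proof -
  obtain t C where "t > 0" "C \<ge> 0" "\<And>f. f \<in> H \<Longrightarrow> sn 1 (T f) \<le> C * sn t f"
    using T_bound[of 1] by auto
  moreover have "cmod (ev f) \<le> sn 1 (T f)" if "f \<in> H" for f
    unfolding ev_def by (intro eval_zero_le_sn T_H that) auto
  ultimately show ?thesis by (meson order.trans)
qed

lemma ev_fscale: "f \<in> H \<Longrightarrow> ev (fscale c f) = c * ev f"
  by (simp add: ev_def T_fscale)

lemma ev_series:
  assumes R: "\<And>i. Rep r (f i) (\<nu> i)" and \<nu>: "summable \<nu>"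
  shows "(\<lambda>i. ev (f i)) sums ev (\<lambda>x. \<Sum>i. f i x)"
proof -
  define F where "F = (\<lambda>x. \<Sum>i. f i x)"
  have FH: "F \<in> H" unfolding F_def by (rule Rep_H[OF Rep_suminf(1)[OF R \<nu>]])
  have SH: "sum f {..<n} \<in> H" for n by (intro H_sum Rep_H[OF R])
  obtain t C where tC: "t > 0" "C \<ge> 0" "\<And>f. f \<in> H \<Longrightarrow> cmod (ev f) \<le> C * sn t f"
    using ev_bound by blast
  have "cmod ((\<Sum>i<n. ev (f i)) - ev F) \<le> C * (exp (t * r) * (\<Sum>i. \<nu> (i + n)))" for n
  proof -
    have "ev (F - sum f {..<n}) = ev F - (\<Sum>i<n. ev (f i))"
      unfolding ev_def T_diff[OF FH SH] by (simp add: T_sum Rep_H[OF R] sum_fun_apply)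
    then have "cmod ((\<Sum>i<n. ev (f i)) - ev F) \<le> C * sn t (F - sum f {..<n})"
      using tC(3)[OF H_diff[OF FH SH]] by (metis norm_minus_commute)
    also have "sn t (F - sum f {..<n}) \<le> exp (t * r) * (\<Sum>i. \<nu> (i + n))"
      unfolding F_def by (intro Rep_sn[OF Rep_tail[OF R \<nu>]] tC)
    finally show ?thesis using tC(2) by (simp add: mult_left_mono)
  qed
  moreover have lim: "(\<lambda>n. C * (exp (t * r) * (\<Sum>i. \<nu> (i + n)))) \<longlonglongrightarrow> 0"
    by (intro tendsto_mult_right_zero tail_suminf_tendsto_0 \<nu>)
  ultimately have "(\<lambda>n. (\<Sum>i<n. ev (f i)) - ev F) \<longlonglongrightarrow> 0"
    by (intro Lim_null_comparison[OF _ lim] always_eventually allI)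
  then show ?thesis by (simp add: sums_def LIM_zero_iff F_def)
qed

text \<open>Since \<open>T f x = T (translation E x f) 0\<close>, the operator acts on the exponential monomials
  like a lower triangular Toeplitz matrix.\<close>

lemma T_atom:
  assumes g: "\<gamma> \<in> dual E" and h: "\<eta> \<in> dual E"
  shows "T (atom \<gamma> \<eta> k) = (\<Sum>i\<le>k. fscale (ev (atom \<gamma> \<eta> i)) (atom \<gamma> \<eta> (k - i)))"
proof (rule scalar_funs_eqI)
  have aH: "atom \<gamma> \<eta> i \<in> H" for i by (rule Rep_H[OF Rep_atom[OF g h order.refl]])
  show "T (atom \<gamma> \<eta> k) \<in> scalar_funs E" by (intro H_scalar_funs T_H aH)
  show "(\<Sum>i\<le>k. fscale (ev (atom \<gamma> \<eta> i)) (atom \<gamma> \<eta> (k - i))) \<in> scalar_funs E"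
    by (intro H_scalar_funs H_sum H_fscale aH)
  fix x assume x: "x \<in> vcarrier E"
  define c where "c i = exp (\<gamma> x) * (\<eta> x ^ (k - i) / fact (k - i))" for i
  have tr: "translation E x (atom \<gamma> \<eta> k) = (\<Sum>i\<le>k. fscale (c i) (atom \<gamma> \<eta> i))"
  proof
    fix y show "translation E x (atom \<gamma> \<eta> k) y = (\<Sum>i\<le>k. fscale (c i) (atom \<gamma> \<eta> i)) y"
    proof (cases "y \<in> vcarrier E")
      case True
      then have "translation E x (atom \<gamma> \<eta> k) y = (\<eta> x + \<eta> y) ^ k / fact k * (exp (\<gamma> x) * exp (\<gamma> y))"
        using x dualD[OF g] dualD[OF h] by (simp add: translation_def atom_def E.add_closed exp_add)
      also have "(\<eta> x + \<eta> y) ^ k / fact k = (\<Sum>i\<le>k. \<eta> y ^ i * \<eta> x ^ (k - i) / (fact i * fact (k - i)))"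
        by (rule binomial_fact_sum[symmetric])
      also have "\<dots> * (exp (\<gamma> x) * exp (\<gamma> y)) = (\<Sum>i\<le>k. c i * atom \<gamma> \<eta> i y)"
        unfolding sum_distrib_right using True by (intro sum.cong) (auto simp: c_def atom_def mult_ac)
      finally show ?thesis by (simp add: sum_fun_apply)
    qed (simp add: translation_def atom_def sum_fun_apply)
  qed
  have "T (atom \<gamma> \<eta> k) x = translation E x (T (atom \<gamma> \<eta> k)) (vzero E)"
    using x by (simp add: translation_def E.zero_closed E.add_zero)
  also have "\<dots> = T (\<Sum>i\<le>k. fscale (c i) (atom \<gamma> \<eta> i)) (vzero E)"
    by (simp only: T_translation[OF x aH, symmetric] tr)
  also have "\<dots> = (\<Sum>i\<le>k. c i * ev (atom \<gamma> \<eta> i))"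
    by (simp add: T_sum H_fscale aH T_fscale sum_fun_apply ev_def)
  also have "\<dots> = (\<Sum>i\<le>k. fscale (ev (atom \<gamma> \<eta> i)) (atom \<gamma> \<eta> (k - i))) x"
    using x by (simp add: sum_fun_apply c_def atom_def mult_ac)
  finally show "T (atom \<gamma> \<eta> k) x = (\<Sum>i\<le>k. fscale (ev (atom \<gamma> \<eta> i)) (atom \<gamma> \<eta> (k - i))) x" .
qed

lemma T_exp_fun: "\<gamma> \<in> dual E \<Longrightarrow> T (exp_fun E \<gamma>) = fscale (ev (exp_fun E \<gamma>)) (exp_fun E \<gamma>)"
  using T_atom[OF _ E.dual_zero, of \<gamma> 0] by (simp add: exp_fun_atom[of _ 0])

text \<open>The coefficients z^k are not summable for |z| at least 1. Hence z is moved into the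
  functional: the line in direction 2 z \<eta> is evaluated at 1/2, with coefficients
  (1/2)^k.\<close>

lemma ev_exp_fun_line:
  assumes g: "\<gamma> \<in> dual E" and h: "\<eta> \<in> dual E"
  shows "(\<lambda>k. ev (atom \<gamma> \<eta> k) * z ^ k) sums ev (exp_fun E (\<gamma> + fscale z \<eta>))"
proof -
  let ?\<eta> = "fscale (2 * z) \<eta>"
  have h': "?\<eta> \<in> dual E" by (rule E.dual_fscale[OF h])
  have eq: "exp_fun E (\<gamma> + fscale z \<eta>) = (\<lambda>x. \<Sum>k. fscale ((1 / 2) ^ k) (atom \<gamma> ?\<eta> k) x)"
    using exp_fun_line[of \<gamma> "1 / 2" ?\<eta>] by simp
  have "Rep (dual_norm E \<gamma> + dual_norm E ?\<eta>) (fscale ((1 / 2) ^ k) (atom \<gamma> ?\<eta> k)) ((1 / 2) ^ k)" for k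
    using Rep_fscale[OF Rep_atom[OF g h' order.refl], of "(1 / 2) ^ k" k] by (simp add: norm_power norm_divide)
  from ev_series[OF this] have "(\<lambda>k. ev (fscale ((1 / 2) ^ k) (atom \<gamma> ?\<eta> k))) sums ev (exp_fun E (\<gamma> + fscale z \<eta>))"
    unfolding eq by (simp add: summable_geometric)
  moreover have "ev (fscale ((1 / 2) ^ k) (atom \<gamma> ?\<eta> k)) = ev (atom \<gamma> \<eta> k) * z ^ k" for k
  proof -
    have pw: "(1 / 2) ^ k * (2 * z) ^ k = z ^ k" unfolding power_mult_distrib[symmetric] by simp
    have "fscale ((1 / 2) ^ k) (atom \<gamma> ?\<eta> k) = fscale (z ^ k) (atom \<gamma> \<eta> k)"
      by (simp only: atom_fscale fscale_fscale pw)
    then show ?thesis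
      using ev_fscale[OF Rep_H[OF Rep_atom[OF g h order.refl]], of "z ^ k" k] by (simp only: mult.commute)
  qed
  ultimately show ?thesis by simp
qed

lemma ev_exp_fun_line_holomorphic:
  assumes "\<gamma> \<in> dual E" "\<eta> \<in> dual E"
  shows "(\<lambda>z. ev (exp_fun E (\<gamma> + fscale z \<eta>))) holomorphic_on UNIV"
proof -
  have "(\<lambda>z. ev (exp_fun E (\<gamma> + fscale z \<eta>))) holomorphic_on ball 0 R" for R
    by (rule power_series_holomorphic) (use ev_exp_fun_line[OF assms] in simp)
  then have "(\<lambda>z. ev (exp_fun E (\<gamma> + fscale z \<eta>))) field_differentiable at z" for z
    by (rule holomorphic_on_imp_differentiable_at[of _ "ball 0 (cmod z + 1)"]) auto
  then show ?thesis by (simp add: holomorphic_on_def field_differentiable_at_within)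
qed

end

section \<open>A frequent hypercyclicity criterion\<close>

text \<open>Quadratic decay is what two integrations by parts yield, and it is summable; the summand
  1 avoids the pole at n = 0.\<close>

definition decay :: "int \<Rightarrow> real" where
  "decay n = 1 / (1 + \<bar>real_of_int n\<bar>) ^ 2"

lemma decay_pos: "0 < decay n" and decay_le_1: "decay n \<le> 1" and decay_minus: "decay (- n) = decay n"
  by (auto simp: decay_def)

lemma decay_antimono: "\<bar>m\<bar> \<le> \<bar>n\<bar> \<Longrightarrow> decay n \<le> decay m"
  unfolding decay_def by (intro divide_left_mono power_mono) auto

lemma summable_decay: "summable (\<lambda>n. decay (int n))"
proof -
  have "summable (\<lambda>n. inverse (real (Suc n) ^ 2))"
    using inverse_power_summable[of 2, where 'a = real] by (subst summable_Suc_iff) simp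
  then show ?thesis by (simp add: decay_def divide_inverse add.commute)
qed

text \<open>From 1 + n \<le> (1 + m) (1 + |n - m|). The constant grows with m, which is harmless
  where only convergence after m steps is at stake.\<close>

lemma decay_shift: "decay (int n - int m) \<le> (1 + real m) ^ 2 * decay (int n)"
proof -
  have "1 + real n \<le> (1 + real m) * (1 + \<bar>real n - real m\<bar>)"
  proof -
    have "real n \<le> real m + \<bar>real n - real m\<bar>" by simp
    also have "\<dots> \<le> real m + \<bar>real n - real m\<bar> + real m * \<bar>real n - real m\<bar>" by simp
    finally show ?thesis by (simp add: algebra_simps)
  qed
  then have "(1 + real n) ^ 2 \<le> ((1 + real m) * (1 + \<bar>real n - real m\<bar>)) ^ 2" by (intro power_mono) auto
  then have "1 * (1 + real n) ^ 2 \<le> (1 + real m) ^ 2 * (1 + \<bar>real n - real m\<bar>) ^ 2"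
    by (simp add: power_mult_distrib)
  moreover have "0 < (1 + real n) ^ 2" "0 < (1 + \<bar>real n - real m\<bar>) ^ 2" by (auto intro!: zero_less_power)
  ultimately show ?thesis unfolding decay_def by (simp add: divide_simps mult.commute)
qed

lemma summable_decay_shift: "summable (\<lambda>n. decay (int n - int m))"
  by (rule summable_comparison_test'[OF summable_mult[OF summable_decay, of "(1 + real m) ^ 2"], of 0])
    (use decay_shift decay_pos in \<open>auto simp: less_imp_le abs_of_pos\<close>)

text \<open>The terms with \<open>n < m\<close> and those with \<open>m \<le> n\<close> each contribute one tail.\<close>

lemma decay_far_sum:
  assumes "\<And>n. n \<in> B \<Longrightarrow> int l \<le> \<bar>int n - int m\<bar>"
  shows "(\<Sum>n. if n \<in> B then decay (int n - int m) else 0) \<le> 2 * (\<Sum>i. decay (int (i + l)))"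
    and "summable (\<lambda>n. if n \<in> B then decay (int n - int m) else 0)"
proof -
  let ?h = "\<lambda>n. if n \<in> B then decay (int n - int m) else 0"
  show sm: "summable ?h"
    by (rule summable_comparison_test'[OF summable_decay_shift[of m], of 0])
      (auto simp: less_imp_le decay_pos abs_of_pos)
  let ?d = "\<lambda>i. if l \<le> i then decay (int i) else 0"
  have dn: "0 \<le> ?d i" for i using decay_pos by (auto simp: less_imp_le)
  have sd: "summable ?d"
    by (rule summable_comparison_test'[OF summable_decay, of 0]) (auto simp: less_imp_le decay_pos abs_of_pos)
  have "suminf ?d = (\<Sum>i. ?d (i + l)) + sum ?d {..<l}"
    using suminf_split_initial_segment[OF sd, of l] by simp
  also have "sum ?d {..<l} = 0" by (intro sum.neutral) auto
  finally have td: "suminf ?d = (\<Sum>i. decay (int (i + l)))" by simp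
  have "suminf ?h = (\<Sum>i. ?h (i + m)) + sum ?h {..<m}"
    by (rule suminf_split_initial_segment[OF sm])
  also have "(\<Sum>i. ?h (i + m)) \<le> suminf ?d"
  proof (rule suminf_le[OF _ summable_ignore_initial_segment[OF sm] sd])
    fix i show "?h (i + m) \<le> ?d i" using assms[of "i + m"] dn[of i] by auto
  qed
  also have "sum ?h {..<m} = (\<Sum>i<m. ?h (m - Suc i))" by (rule sum.nat_diff_reindex[symmetric])
  also have "\<dots> \<le> (\<Sum>i<m. ?d (Suc i))"
  proof (rule sum_mono)
    fix i assume i: "i \<in> {..<m}"
    then have "int (m - Suc i) - int m = - int (Suc i)" by (simp add: of_nat_diff)
    then show "?h (m - Suc i) \<le> ?d (Suc i)"
      using assms[of "m - Suc i"] dn[of "Suc i"] by (auto simp: decay_minus simp del: of_nat_Suc)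
  qed
  also have "\<dots> = sum ?d {1..m}" by (rule sum.reindex_bij_witness[of _ "\<lambda>i. i - 1" Suc]) auto
  also have "\<dots> \<le> suminf ?d" by (intro sum_le_suminf sd dn) auto
  finally show "suminf ?h \<le> 2 * (\<Sum>i. decay (int (i + l)))" using td by simp
qed

context convolution
begin

text \<open>Negative indices are forward iterates of \<open>x 0\<close>, positive indices a chosen
  backward orbit; \<open>C * decay n\<close> controls both directions.\<close>

definition bi_orbit :: "real \<Rightarrow> (int \<Rightarrow> 'u \<Rightarrow> complex) \<Rightarrow> real \<Rightarrow> bool" where
  "bi_orbit r x C \<longleftrightarrow> (\<forall>n. T (x n) = x (n - 1) \<and> Rep r (x n) (C * decay n))"

definition bi_vectors :: "real \<Rightarrow> ('u \<Rightarrow> complex) set" where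
  "bi_vectors r = {f. \<exists>x C. bi_orbit r x C \<and> x 0 = f}"

lemma bi_orbit_nonneg:
  assumes "bi_orbit r x C" shows "0 \<le> C"
proof -
  have "Rep r (x 0) (C * decay 0)" using assms unfolding bi_orbit_def by blast
  then show ?thesis using Rep_nonneg by (fastforce simp: decay_def)
qed

lemma bi_orbit_H: "bi_orbit r x C \<Longrightarrow> x n \<in> H"
  unfolding bi_orbit_def using Rep_H by blast

lemma bi_vectors_subspace:
  assumes "0 \<le> r" shows "subspace_H (bi_vectors r)"
  unfolding subspace_H_def
proof (intro conjI ballI allI)
  show "bi_vectors r \<subseteq> H" using bi_orbit_H by (auto simp: bi_vectors_def)
  have "bi_orbit r (\<lambda>_. 0) 0" using Rep_zero[OF assms] by (simp add: bi_orbit_def T_zero)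
  then show "0 \<in> bi_vectors r" by (auto simp: bi_vectors_def)
  fix f assume f: "f \<in> bi_vectors r"
  then obtain x C where x: "bi_orbit r x C" "x 0 = f" by (auto simp: bi_vectors_def)
  {
    fix g assume "g \<in> bi_vectors r"
    then obtain y D where y: "bi_orbit r y D" "y 0 = g" by (auto simp: bi_vectors_def)
    have "T (x n + y n) = x (n - 1) + y (n - 1)" for n
      using x y T_add[OF bi_orbit_H[OF x(1)] bi_orbit_H[OF y(1)]] by (simp add: bi_orbit_def)
    moreover have "Rep r (x n + y n) ((C + D) * decay n)" for n
      using Rep_add[of r "x n" "C * decay n" "y n" "D * decay n"] x y by (simp add: bi_orbit_def distrib_right)
    ultimately have "bi_orbit r (\<lambda>n. x n + y n) (C + D)" unfolding bi_orbit_def by blast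
    then show "f + g \<in> bi_vectors r" unfolding bi_vectors_def using x(2) y(2) by blast
  }
  fix c
  have "T (fscale c (x n)) = fscale c (x (n - 1))" for n
    using x T_fscale[OF bi_orbit_H[OF x(1)]] by (simp add: bi_orbit_def)
  moreover have "Rep r (fscale c (x n)) ((cmod c * C) * decay n)" for n
    using Rep_fscale[of r "x n" "C * decay n" c] x by (simp add: bi_orbit_def mult.assoc)
  ultimately have "bi_orbit r (\<lambda>n. fscale c (x n)) (cmod c * C)" unfolding bi_orbit_def by blast
  then show "fscale c f \<in> bi_vectors r" unfolding bi_vectors_def using x(2) by blast
qed

text \<open>The vector is the sum over k and over n in S_k of \<open>x k n\<close>, where
  \<open>x k\<close> is a decaying orbit through \<open>y k\<close>. Applying \<open>T\<close> m
  times with m in S_k moves the term (k, m) to \<open>y k\<close>; every other term lands at an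
  index n - m at least max(L_j, L_k) away from 0, so their sum is small. The error tends to 0 with
  k, which is why \<open>dense\<close> must provide arbitrarily late indices.\<close>

lemma frequently_hypercyclic_criterion:
  fixes y :: "nat \<Rightarrow> 'u \<Rightarrow> complex"
  assumes y: "\<And>k. y k \<in> bi_vectors r"
    and dense: "\<And>f s e K. f \<in> H \<Longrightarrow> s > 0 \<Longrightarrow> e > 0 \<Longrightarrow> \<exists>k\<ge>K. sn s (f - y k) < e"
  shows "\<exists>f \<nu>. Rep r f \<nu> \<and> frequently_hypercyclic (bounded_type_topology A N E) T f"
proof -
  have "\<forall>k. \<exists>x C. bi_orbit r x C \<and> x 0 = y k" using y by (auto simp: bi_vectors_def)
  then obtain x C where x: "\<And>k. bi_orbit r (x k) (C k)" "\<And>k. x k 0 = y k" by metis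
  have C: "0 \<le> C k" for k by (rule bi_orbit_nonneg[OF x(1)])
  have Tx: "T (x k n) = x k (n - 1)" and Rx: "Rep r (x k n) (C k * decay n)" for k n
    using x(1)[of k] by (auto simp: bi_orbit_def)
  define tail where "tail l = (\<Sum>i. decay (int (i + l)))" for l
  have tail_lim: "tail \<longlonglongrightarrow> 0"
    unfolding tail_def using tail_suminf_tendsto_0[OF summable_decay] by simp
  have tail_anti: "tail l' \<le> tail l" if "l \<le> l'" for l l'
    unfolding tail_def using that summable_decay
    by (intro suminf_le decay_antimono summable_ignore_initial_segment[of "\<lambda>n. decay (int n)"]) auto
  have tail0: "0 \<le> tail l" for l
    unfolding tail_def using summable_ignore_initial_segment[OF summable_decay, of l] decay_pos
    by (intro suminf_nonneg) (auto simp: less_imp_le)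
  \<comment> \<open>The separation at level k has to tame the constants of all orbits j up to k,
    hence the sum of the C_j.\<close>
  have "\<exists>l>0. (\<Sum>j\<le>k. C j) * (2 * tail l) \<le> (1 / 2) ^ k" for k
  proof -
    have "(\<lambda>l. (\<Sum>j\<le>k. C j) * (2 * tail l)) \<longlonglongrightarrow> (\<Sum>j\<le>k. C j) * (2 * 0)"
      by (intro tendsto_intros tail_lim)
    from order_tendstoD(2)[OF this, of "(1 / 2) ^ k"]
    have "\<forall>\<^sub>F l in sequentially. (\<Sum>j\<le>k. C j) * (2 * tail l) < (1 / 2) ^ k" by simp
    from eventually_conj[OF this eventually_gt_at_top[of 0]] show ?thesis
      by (auto simp: eventually_sequentially intro: less_imp_le)
  qed
  then obtain l where l: "\<And>k. l k > 0" "\<And>k. (\<Sum>j\<le>k. C j) * (2 * tail (l k)) \<le> (1 / 2) ^ k" by metis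
  \<comment> \<open>Partial sums of l make the separations monotone, as
    \<open>separated_sets\<close> requires, without making any of them smaller.\<close>
  define L where "L k = (\<Sum>i\<le>k. l i)" for k
  have Lpos: "L k > 0" for k using l(1)[of k] unfolding L_def by (intro sum_pos) (use l in auto)
  have Lmono: "L j \<le> L k" if "j \<le> k" for j k unfolding L_def using that by (intro sum_mono2) auto
  have lL: "l k \<le> L k" for k unfolding L_def by (intro member_le_sum) auto
  have key: "C j * (2 * tail (L k)) \<le> (1 / 2) ^ k" if "j \<le> k" for j k
  proof -
    have "C j \<le> (\<Sum>j\<le>k. C j)" using that C by (intro member_le_sum) auto
    then have "C j * (2 * tail (L k)) \<le> (\<Sum>j\<le>k. C j) * (2 * tail (l k))"
      using tail_anti[OF lL] tail0 C by (intro mult_mono) (auto intro: sum_nonneg)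
    then show ?thesis using l(2)[of k] by linarith
  qed
  have "\<exists>S. (\<forall>k. lower_density (S k) > 0) \<and> (\<forall>k. \<forall>n\<in>S k. L k \<le> n) \<and>
    (\<forall>j k. \<forall>n\<in>S j. \<forall>m\<in>S k. (j, n) \<noteq> (k, m) \<longrightarrow> int (max (L j) (L k)) \<le> \<bar>int n - int m\<bar>)"
    by (rule separated_sets[of L, OF Lpos]) (rule Lmono)
  then obtain S where S0: "\<forall>k. lower_density (S k) > 0" "\<forall>k. \<forall>n\<in>S k. L k \<le> n"
    "\<forall>j k. \<forall>n\<in>S j. \<forall>m\<in>S k. (j, n) \<noteq> (k, m) \<longrightarrow> int (max (L j) (L k)) \<le> \<bar>int n - int m\<bar>"
    by (elim exE conjE) (rule that)
  note S = S0(1)[rule_format] S0(2)[rule_format] S0(3)[rule_format]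
  \<comment> \<open>The contribution of n in S_k after m applications of \<open>T\<close>; terms
    with n outside S_k are zero, so every sum runs over all naturals.\<close>
  define z where "z m k n = (if n \<in> S k then x k (int n - int m) else 0)" for m k n :: nat
  define \<nu> where "\<nu> m k n = C k * (if n \<in> S k then decay (int n - int m) else 0)" for m k n :: nat
  have r0: "0 \<le> r" using Rep_radius_nonneg[OF Rx] .
  have Rz: "Rep r (z m k n) (\<nu> m k n)" for m k n
    using Rx[of k "int n - int m"] Rep_zero[OF r0] by (simp add: z_def \<nu>_def)
  have Tz: "T (z m k n) = z (Suc m) k n" for m k n
    using Tx[of k "int n - int m"] by (simp add: z_def T_zero algebra_simps)
  have \<nu>0: "0 \<le> \<nu> m k n" for m k n using C decay_pos by (auto simp: \<nu>_def less_imp_le)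
  have s\<nu>: "summable (\<nu> m k)" for m k
    unfolding \<nu>_def using decay_far_sum(2)[of "S k" 0 m] by (intro summable_mult) auto
  have \<nu>_start: "(\<Sum>n. \<nu> 0 k n) \<le> (1 / 2) ^ k" for k
  proof -
    have *: "int (L k) \<le> \<bar>int n - int 0\<bar>" if "n \<in> S k" for n using S(2)[OF that] by simp
    have "(\<Sum>n. \<nu> 0 k n) = C k * (\<Sum>n. if n \<in> S k then decay (int n - int 0) else 0)"
      unfolding \<nu>_def by (rule suminf_mult[OF decay_far_sum(2)[OF *]])
    also have "\<dots> \<le> C k * (2 * tail (L k))"
      unfolding tail_def by (intro mult_left_mono decay_far_sum(1) * C)
    also have "\<dots> \<le> (1 / 2) ^ k" by (rule key) simp
    finally show ?thesis .
  qed
  have \<nu>_shift: "(\<Sum>n. \<nu> m k n) \<le> (1 + real m) ^ 2 * (1 / 2) ^ k" for m k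
  proof -
    have "\<nu> m k n \<le> (1 + real m) ^ 2 * \<nu> 0 k n" for n
      using mult_left_mono[OF decay_shift[of n m] C[of k]] by (simp add: \<nu>_def mult_ac)
    then have "(\<Sum>n. \<nu> m k n) \<le> (\<Sum>n. (1 + real m) ^ 2 * \<nu> 0 k n)"
      by (intro suminf_le s\<nu> summable_mult)
    also have "\<dots> = (1 + real m) ^ 2 * (\<Sum>n. \<nu> 0 k n)" by (rule suminf_mult[OF s\<nu>])
    also have "\<dots> \<le> (1 + real m) ^ 2 * (1 / 2) ^ k" by (intro mult_left_mono \<nu>_start) auto
    finally show ?thesis .
  qed
  have s\<nu>\<nu>: "summable (\<lambda>k. \<Sum>n. \<nu> m k n)" for m
    by (rule summable_comparison_test'[OF summable_mult[OF summable_geometric[of "1/2"], of "(1 + real m) ^ 2"], of 0])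
      (use \<nu>_shift s\<nu> \<nu>0 in \<open>auto simp: suminf_nonneg\<close>)
  define F where "F m k = (\<lambda>x. \<Sum>n. z m k n x)" for m k
  have RF: "Rep r (F m k) (\<Sum>n. \<nu> m k n)" for m k
    unfolding F_def by (rule Rep_suminf(1)[OF Rz s\<nu>])
  have TF: "T (F m k) = F (Suc m) k" for m k
  proof -
    have "T (F m k) = (\<lambda>x. \<Sum>n. T (z m k n) x)"
      unfolding F_def by (rule T_series[OF Rz s\<nu>, where r' = r and \<mu> = "\<nu> (Suc m) k"])
        (simp_all only: Tz Rz s\<nu>)
    then show ?thesis by (simp add: Tz F_def)
  qed
  define f where "f m = (\<lambda>x. \<Sum>k. F m k x)" for m
  have Rf: "Rep r (f m) (\<Sum>k. \<Sum>n. \<nu> m k n)" for m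
    unfolding f_def by (rule Rep_suminf(1)[OF RF s\<nu>\<nu>])
  have Tf: "T (f m) = f (Suc m)" for m
  proof -
    have "T (f m) = (\<lambda>x. \<Sum>k. T (F m k) x)"
      unfolding f_def by (rule T_series[OF RF s\<nu>\<nu>, where r' = r and \<mu> = "\<lambda>k. \<Sum>n. \<nu> (Suc m) k n"])
        (simp_all only: TF RF s\<nu>\<nu>)
    then show ?thesis by (simp add: TF f_def)
  qed
  have Tpow: "(T ^^ m) (f 0) = f m" for m by (induction m) (simp_all add: Tf)
  have close: "Rep r (f m - y k) ((real k + 2) * (1 / 2) ^ k)" if m: "m \<in> S k" for m k
  proof -
    \<comment> \<open>The main term (k, m), equal to \<open>y k\<close>, is deleted; all remaining
      pairs obey the separation.\<close>
    define z' where "z' j n = (if j = k \<and> n = m then 0 else z m j n)" for j n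
    define B where "B j = {n. n \<in> S j \<and> (j, n) \<noteq> (k, m)}" for j
    define \<mu> where "\<mu> j n = C j * (if n \<in> B j then decay (int n - int m) else 0)" for j n
    have Rz': "Rep r (z' j n) (\<mu> j n)" for j n
      using Rz[of m j n] Rep_zero[OF r0] by (auto simp: z'_def \<mu>_def B_def \<nu>_def)
    have far: "int (max (L j) (L k)) \<le> \<bar>int n - int m\<bar>" if "n \<in> B j" for j n
      using S(3)[OF _ m, of n j] that by (auto simp: B_def)
    have s\<mu>: "summable (\<mu> j)" for j
      unfolding \<mu>_def by (intro summable_mult decay_far_sum(2)[OF far])
    have \<mu>_sum: "(\<Sum>n. \<mu> j n) \<le> (1 / 2) ^ max j k" for j
    proof -
      have "(\<Sum>n. \<mu> j n) = C j * (\<Sum>n. if n \<in> B j then decay (int n - int m) else 0)"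
        unfolding \<mu>_def by (rule suminf_mult[OF decay_far_sum(2)[OF far]])
      also have "\<dots> \<le> C j * (2 * tail (max (L j) (L k)))"
        unfolding tail_def by (intro mult_left_mono decay_far_sum(1) far C)
      also have "max (L j) (L k) = L (max j k)"
        using Lmono[of j k] Lmono[of k j] by (cases "j \<le> k") (auto simp: max_def)
      also have "C j * (2 * tail (L (max j k))) \<le> (1 / 2) ^ max j k" by (rule key) simp
      finally show ?thesis .
    qed
    have \<mu>_nonneg: "0 \<le> (\<Sum>n. \<mu> j n)" for j
      by (intro suminf_nonneg s\<mu>) (use C decay_pos in \<open>auto simp: \<mu>_def less_imp_le\<close>)
    \<comment> \<open>The k indices j < k contribute (1/2)^k each and the indices j \<ge> k a
      geometric series with sum 2 (1/2)^k.\<close>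
    let ?g = "\<lambda>j. (1 / 2 :: real) ^ max j k"
    have gs: "?g sums (real k * (1 / 2) ^ k + 2 * (1 / 2) ^ k)"
    proof -
      have "(\<lambda>i. (1 / 2 :: real) ^ k * (1 / 2) ^ i) sums ((1 / 2) ^ k * (1 / (1 - 1 / 2)))"
        by (intro sums_mult geometric_sums) simp
      moreover have "?g (i + k) = (1 / 2) ^ k * (1 / 2) ^ i" for i
        by (simp add: power_add mult.commute max_absorb1)
      ultimately have "(\<lambda>i. ?g (i + k)) sums (2 * (1 / 2) ^ k)" by (simp add: mult.commute)
      moreover have "(\<Sum>j<k. ?g j) = real k * (1 / 2) ^ k" by (simp add: max_def)
      ultimately show ?thesis using sums_iff_shift[of ?g k] by (simp add: add.commute)
    qed
    have s\<mu>\<mu>: "summable (\<lambda>j. \<Sum>n. \<mu> j n)"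
      by (rule summable_comparison_test'[of ?g 0]) (use gs \<mu>_sum \<mu>_nonneg in \<open>auto simp: sums_iff\<close>)
    define F' where "F' j = (\<lambda>x. \<Sum>n. z' j n x)" for j
    have RF': "Rep r (F' j) (\<Sum>n. \<mu> j n)" for j
      unfolding F'_def by (rule Rep_suminf(1)[OF Rz' s\<mu>])
    have FF': "F' j t = F m j t - (if j = k then y k t else 0)" for j t
    proof -
      have sz: "(\<lambda>n. z m j n t) sums F m j t"
        unfolding F_def by (rule summable_sums[OF summable_norm_cancel[OF Rep_suminf(2)[OF Rz s\<nu>]]])
      have sy: "(\<lambda>n. if n = m then (if j = k then y k t else 0) else 0) sums (if j = k then y k t else 0)"
        using sums_single[of m "\<lambda>_. if j = k then y k t else 0"] by simp
      have "z' j n t = z m j n t - (if n = m then (if j = k then y k t else 0) else 0)" for n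
        using m x(2)[of k] by (auto simp: z'_def z_def)
      then show ?thesis using sums_diff[OF sz sy] by (simp add: F'_def sums_iff)
    qed
    have "(\<lambda>t. \<Sum>j. F' j t) = f m - y k"
    proof
      fix t
      have sF: "(\<lambda>j. F m j t) sums f m t"
        unfolding f_def by (rule summable_sums[OF summable_norm_cancel[OF Rep_suminf(2)[OF RF s\<nu>\<nu>]]])
      have sy: "(\<lambda>j. if j = k then y k t else 0) sums y k t"
        using sums_single[of k "\<lambda>_. y k t"] by simp
      show "(\<Sum>j. F' j t) = (f m - y k) t"
        using sums_diff[OF sF sy] by (simp add: FF' sums_iff)
    qed
    then have "Rep r (f m - y k) (\<Sum>j. \<Sum>n. \<mu> j n)"
      using Rep_suminf(1)[OF RF' s\<mu>\<mu>] by simp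
    moreover have "(\<Sum>j. \<Sum>n. \<mu> j n) \<le> (real k + 2) * (1 / 2) ^ k"
    proof -
      have "(\<Sum>j. \<Sum>n. \<mu> j n) \<le> suminf ?g"
        using gs by (intro suminf_le \<mu>_sum s\<mu>\<mu>) (simp add: sums_iff)
      then show ?thesis using gs by (simp add: sums_iff distrib_right)
    qed
    ultimately show ?thesis by (rule Rep_mono[OF _ order.refl])
  qed
  have "frequently_hypercyclic (bounded_type_topology A N E) T (f 0)"
    unfolding frequently_hypercyclic_def topspace_H
  proof (intro conjI allI impI)
    show "f 0 \<in> H" by (rule Rep_H[OF Rf])
    fix U assume U: "openin (bounded_type_topology A N E) U \<and> U \<noteq> {}"
    then obtain h where h: "h \<in> U" by blast
    then have hH: "h \<in> H" using U openin_subset topspace_H by blast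
    have "\<exists>s>0. \<exists>e>0. \<forall>g\<in>H. sn s (g - h) < e \<longrightarrow> g \<in> U" using U h by (intro openin_H_ball) auto
    then obtain s e where se: "s > 0" "e > 0" "\<And>g. g \<in> H \<Longrightarrow> sn s (g - h) < e \<Longrightarrow> g \<in> U" by blast
    have "(\<lambda>k. (real k + 2) * (1 / 2) ^ k) \<longlonglongrightarrow> 0" by real_asymp
    from order_tendstoD(2)[OF tendsto_mult_right_zero[OF this, of "exp (s * r)"], of "e / 2"]
    have "\<forall>\<^sub>F k in sequentially. exp (s * r) * ((real k + 2) * (1 / 2) ^ k) < e / 2"
      using se by simp
    then obtain K where K: "\<And>k. k \<ge> K \<Longrightarrow> exp (s * r) * ((real k + 2) * (1 / 2) ^ k) < e / 2"
      by (auto simp: eventually_sequentially)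
    obtain k where k: "k \<ge> K" "sn s (h - y k) < e / 2" using dense[OF hH se(1), of "e / 2" K] se by auto
    have yH: "y k \<in> H" using bi_orbit_H[OF x(1), of k 0] x(2) by simp
    have "S k \<subseteq> {n. (T ^^ n) (f 0) \<in> U}"
    proof
      fix m assume m: "m \<in> S k"
      have fH: "f m \<in> H" by (rule Rep_H[OF Rf])
      have "sn s (f m - h) \<le> sn s (f m - y k) + sn s (y k - h)" by (rule sn_triangle[OF fH yH hH se(1)])
      also have "sn s (y k - h) = sn s (h - y k)" by (rule sn_diff_commute[OF yH hH se(1)])
      also have "sn s (f m - y k) \<le> exp (s * r) * ((real k + 2) * (1 / 2) ^ k)"
        by (rule Rep_sn[OF close[OF m] se(1)])
      finally have "sn s (f m - h) < e" using K[OF k(1)] k(2) by linarith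
      then have "f m \<in> U" by (rule se(3)[OF fH])
      then show "m \<in> {n. (T ^^ n) (f 0) \<in> U}" using Tpow by simp
    qed
    then have "lower_density (S k) \<le> lower_density {n. (T ^^ n) (f 0) \<in> U}" by (rule lower_density_mono)
    then show "lower_density {n. (T ^^ n) (f 0) \<in> U} > 0" using S(1)[of k] by (rule less_le_trans[rotated])
  qed
  then show ?thesis using Rf by blast
qed

end

section \<open>Oscillatory integrals\<close>

text \<open>Two integrations by parts, without boundary terms because of the double zeros at the end points.\<close>

lemma oscillatory_integral_bound:
  fixes K :: "complex \<Rightarrow> complex" and n :: int
  assumes hol: "K holomorphic_on ball 0 (2 * \<delta>)" and \<delta>: "0 < \<delta>"
    and B: "\<And>z. z \<in> ball 0 (2 * \<delta>) \<Longrightarrow> cmod (K z) \<le> B"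
    and zero: "K (of_real \<delta>) = 0" "K (of_real (- \<delta>)) = 0"
      "deriv K (of_real \<delta>) = 0" "deriv K (of_real (- \<delta>)) = 0"
  shows "cmod (integral {-\<delta>..\<delta>} (\<lambda>t. K (of_real t) * exp (- (of_int n * \<i> * of_real t))))
    \<le> (2 * \<delta> + 64 / \<delta>) * B * decay n"
proof -
  let ?S = "ball 0 (2 * \<delta>) :: complex set"
  define \<mu> where "\<mu> = - (of_int n * \<i>)"
  define e where "e z = exp (\<mu> * z)" for z
  let ?I = "integral {-\<delta>..\<delta>} (\<lambda>t. K (of_real t) * e (of_real t))"
  have B0: "0 \<le> B" using B[of 0] \<delta> by (auto intro: order.trans[OF norm_ge_zero])
  have mem: "complex_of_real t \<in> ?S" if "t \<in> {-\<delta>..\<delta>}" for t using that \<delta> by auto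
  have ne: "cmod (e (of_real t)) = 1" for t by (simp add: e_def \<mu>_def norm_exp_eq_Re)
  have hol1: "deriv K holomorphic_on ?S" and hol2: "deriv (deriv K) holomorphic_on ?S"
    using hol by (auto intro!: holomorphic_deriv)
  have cont: "continuous_on {-\<delta>..\<delta>} (\<lambda>t. f (of_real t) * e (of_real t))"
    if "f holomorphic_on ?S" for f
    unfolding e_def
    by (intro continuous_intros continuous_on_compose2[OF holomorphic_on_imp_continuous_on[OF that]])
      (use mem in auto)
  \<comment> \<open>The Cauchy estimate on circles of radius \<delta>/2, which stay in the ball of
    radius 2 \<delta>: 2 B / (\<delta>/2)^2.\<close>
  have K2: "cmod (deriv (deriv K) (of_real t)) \<le> 8 * B / \<delta> ^ 2" if t: "t \<in> {-\<delta>..\<delta>}" for t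
  proof -
    have sub: "cball (complex_of_real t) (\<delta> / 2) \<subseteq> ?S"
    proof
      fix x assume "x \<in> cball (complex_of_real t) (\<delta> / 2)"
      then have "cmod x \<le> \<bar>t\<bar> + \<delta> / 2"
        using norm_triangle_sub[of x "complex_of_real t"] by (simp add: dist_norm norm_minus_commute)
      then show "x \<in> ?S" using t \<delta> by auto
    qed
    have "cmod ((deriv ^^ 2) K (of_real t)) \<le> fact 2 * B / (\<delta> / 2) ^ 2"
    proof (rule Cauchy_inequality)
      show "K holomorphic_on ball (of_real t) (\<delta> / 2)"
        using hol sub by (meson ball_subset_cball holomorphic_on_subset order.trans)
      show "continuous_on (cball (of_real t) (\<delta> / 2)) K"
        using holomorphic_on_imp_continuous_on[OF hol] sub continuous_on_subset by blast
      show "cmod (K x) \<le> B" if "cmod (of_real t - x) = \<delta> / 2" for x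
        using B sub that by (auto simp: dist_norm subset_iff)
    qed (use \<delta> in auto)
    then show ?thesis by (simp add: numeral_2_eq_2 power2_eq_square field_simps)
  qed
  show ?thesis
  proof (cases "n = 0")
    case True
    \<comment> \<open>For n = 0 nothing oscillates; the summand 2 \<delta> of the constant is the
      length of the interval.\<close>
    have "cmod ?I \<le> B * (\<delta> - (- \<delta>))"
      by (rule integral_bound) (use \<delta> B mem ne cont[OF hol] in \<open>auto simp: norm_mult\<close>)
    also have "\<dots> \<le> (2 * \<delta> + 64 / \<delta>) * B * decay n"
      using True \<delta> B0 by (simp add: decay_def algebra_simps)
    finally show ?thesis by (simp add: e_def \<mu>_def)
  next
    case False
    then have \<mu>: "\<mu> \<noteq> 0" and n\<mu>: "cmod \<mu> = \<bar>of_int n\<bar>" by (auto simp: \<mu>_def norm_mult)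
    have ck: "continuous_on {-\<delta>..\<delta>} (\<lambda>t. deriv (deriv K) (of_real t) * e (of_real t) / \<mu> ^ 2)"
      by (rule continuous_on_divide[OF cont[OF hol2] continuous_on_const]) (use \<mu> in auto)
    \<comment> \<open>A primitive of K e - K'' e / \<mu>^2 collecting the boundary terms of both
      integrations by parts; it vanishes at both end points.\<close>
    define F where "F z = K z * e z / \<mu> - deriv K z * e z / \<mu> ^ 2" for z
    have dF: "((\<lambda>t. F (of_real t)) has_vector_derivative
        (K (of_real t) * e (of_real t) - deriv (deriv K) (of_real t) * e (of_real t) / \<mu> ^ 2)) (at t within {-\<delta>..\<delta>})"
      if t: "t \<in> {-\<delta>..\<delta>}" for t
    proof (rule has_vector_derivative_real_field)
      have d1: "(K has_field_derivative deriv K (of_real t)) (at (of_real t))"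
        and d2: "(deriv K has_field_derivative deriv (deriv K) (of_real t)) (at (of_real t))"
        using hol hol1 mem[OF t] by (auto intro!: holomorphic_derivI[of _ ?S])
      have d3: "(e has_field_derivative \<mu> * e (of_real t)) (at (of_real t))"
        unfolding e_def by (auto intro!: derivative_eq_intros)
      show "(F has_field_derivative K (of_real t) * e (of_real t)
          - deriv (deriv K) (of_real t) * e (of_real t) / \<mu> ^ 2) (at (of_real t))"
        unfolding F_def using \<mu>
        by (auto intro!: derivative_eq_intros d1 d2 d3 simp: field_simps power2_eq_square)
    qed
    have "((\<lambda>t. K (of_real t) * e (of_real t) - deriv (deriv K) (of_real t) * e (of_real t) / \<mu> ^ 2)
        has_integral (F (of_real \<delta>) - F (of_real (- \<delta>)))) {-\<delta>..\<delta>}"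
      by (rule fundamental_theorem_of_calculus[OF _ dF]) (use \<delta> in auto)
    then have "integral {-\<delta>..\<delta>} (\<lambda>t. K (of_real t) * e (of_real t) - deriv (deriv K) (of_real t) * e (of_real t) / \<mu> ^ 2) = 0"
      using zero by (simp add: F_def integral_unique)
    moreover have "integral {-\<delta>..\<delta>} (\<lambda>t. K (of_real t) * e (of_real t) - deriv (deriv K) (of_real t) * e (of_real t) / \<mu> ^ 2)
        = ?I - integral {-\<delta>..\<delta>} (\<lambda>t. deriv (deriv K) (of_real t) * e (of_real t) / \<mu> ^ 2)"
      by (intro integral_diff integrable_continuous_interval cont[OF hol] ck)
    ultimately have "?I = integral {-\<delta>..\<delta>} (\<lambda>t. deriv (deriv K) (of_real t) * e (of_real t) / \<mu> ^ 2)" by simp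
    also have "cmod \<dots> \<le> (8 * B / \<delta> ^ 2 / of_int n ^ 2) * (\<delta> - (- \<delta>))"
    proof (rule integral_bound[OF _ ck])
      show "cmod (deriv (deriv K) (of_real t) * e (of_real t) / \<mu> ^ 2) \<le> 8 * B / \<delta> ^ 2 / of_int n ^ 2"
        if "t \<in> {-\<delta>..\<delta>}" for t
        using divide_right_mono[OF K2[OF that], of "of_int n ^ 2"]
        by (simp add: norm_mult norm_divide norm_power ne n\<mu>)
    qed (use \<delta> in auto)
    also have "\<dots> = 16 * B / \<delta> * (1 / of_int n ^ 2)" using \<delta> by (simp add: power2_eq_square field_simps)
    \<comment> \<open>For |n| at least 1 one has (1 + |n|)^2 \<le> 4 n^2, which is how 16 becomes
      64.\<close>
    also have "\<dots> \<le> 16 * B / \<delta> * (4 * decay n)"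
    proof (intro mult_left_mono)
      have n1: "1 \<le> \<bar>real_of_int n\<bar>" using False by (simp flip: of_int_abs)
      then have "(1 + \<bar>real_of_int n\<bar>) ^ 2 \<le> (2 * \<bar>real_of_int n\<bar>) ^ 2" by (intro power_mono) auto
      then have "(1 + \<bar>real_of_int n\<bar>) ^ 2 \<le> 4 * real_of_int n ^ 2" by (simp add: power_mult_distrib)
      moreover have "0 < (1 + \<bar>real_of_int n\<bar>) ^ 2" by (intro zero_less_power) auto
      moreover have "0 < real_of_int n ^ 2" using False by simp
      ultimately show "1 / of_int n ^ 2 \<le> 4 * decay n" unfolding decay_def by (simp add: divide_simps)
    qed (use B0 \<delta> in auto)
    also have "\<dots> \<le> (2 * \<delta> + 64 / \<delta>) * B * decay n"
      using \<delta> B0 decay_pos[of n] by (simp add: algebra_simps)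
    finally show ?thesis by (simp add: e_def \<mu>_def)
  qed
qed

text \<open>The weight has the double zeros at the end points that the oscillatory estimate needs,
  and mass 1, so that averages over short arcs approximate the central eigenvector.\<close>

lemma bump_integral:
  fixes \<delta> :: real
  assumes "0 < \<delta>"
  shows "((\<lambda>t. 15 / (16 * \<delta> ^ 5) * (\<delta> ^ 2 - t ^ 2) ^ 2) has_integral 1) {-\<delta>..\<delta>}"
proof -
  let ?F = "\<lambda>t. 15 / (16 * \<delta> ^ 5) * (\<delta> ^ 4 * t - 2 * \<delta> ^ 2 * t ^ 3 / 3 + t ^ 5 / 5)"
  have "((\<lambda>t. 15 / (16 * \<delta> ^ 5) * (\<delta> ^ 2 - t ^ 2) ^ 2) has_integral (?F \<delta> - ?F (- \<delta>))) {-\<delta>..\<delta>}"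
  proof (rule fundamental_theorem_of_calculus)
    fix t
    have "((\<lambda>t. \<delta> ^ 4 * t - 2 * \<delta> ^ 2 * t ^ 3 / 3 + t ^ 5 / 5) has_real_derivative (\<delta> ^ 2 - t ^ 2) ^ 2)
        (at t within {-\<delta>..\<delta>})"
      by (rule derivative_eq_intros refl | simp)+
        (simp add: power2_eq_square power4_eq_xxxx algebra_simps)
    then have "(?F has_real_derivative 15 / (16 * \<delta> ^ 5) * (\<delta> ^ 2 - t ^ 2) ^ 2) (at t within {-\<delta>..\<delta>})"
      by (rule DERIV_cmult)
    then show "(?F has_vector_derivative 15 / (16 * \<delta> ^ 5) * (\<delta> ^ 2 - t ^ 2) ^ 2) (at t within {-\<delta>..\<delta>})"
      by (simp add: has_real_derivative_iff_has_vector_derivative)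
  qed (use assms in auto)
  moreover have "?F \<delta> - ?F (- \<delta>) = 1" using assms by (simp add: field_simps power_numeral_reduce)
  ultimately show ?thesis by simp
qed

text \<open>The bijection (k, i) -> (k - i, i) between the triangle and all pairs, under a geometric
  majorant that makes every rearrangement legitimate.\<close>

lemma suminf_triangle:
  fixes h :: "nat \<Rightarrow> nat \<Rightarrow> complex"
  assumes "\<And>m j. cmod (h m j) \<le> C * (1 / 2) ^ m * (1 / 2) ^ j"
  shows "(\<Sum>k. \<Sum>i\<le>k. h (k - i) i) = (\<Sum>m. \<Sum>j. h m j)"
proof -
  have C: "0 \<le> C" using assms[of 0 0] by (auto intro: order.trans[OF norm_ge_zero])
  have g: "(\<lambda>n. (1 / 2 :: real) ^ n) sums 2" using geometric_sums[of "1 / 2 :: real"] by simp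
  have "(\<lambda>x. C * (1 / 2) ^ fst x * (1 / 2) ^ snd x) summable_on Sigma UNIV (\<lambda>_. UNIV)"
  proof (rule summable_on_SigmaI)
    show "((\<lambda>j. C * (1 / 2) ^ fst (m, j) * (1 / 2) ^ snd (m, j)) has_sum (C * (1 / 2) ^ m * 2)) UNIV" for m
      using C g by (auto intro!: sums_nonneg_imp_has_sum sums_mult)
    show "(\<lambda>m. C * (1 / 2) ^ m * 2) summable_on UNIV"
      using C by (subst summable_on_UNIV_nonneg_real_iff) (auto intro!: summable_mult summable_mult2 summable_geometric)
  qed (use C in auto)
  then have "(\<lambda>x. norm (h (fst x) (snd x))) summable_on UNIV \<times> UNIV"
    by (rule summable_on_comparison_test) (use assms in auto)
  then have s: "(\<lambda>x. h (fst x) (snd x)) summable_on UNIV \<times> UNIV" by (rule abs_summable_summable)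
  let ?p = "\<lambda>(k, i). (k - i, i) :: nat \<times> nat"
  have bij: "bij_betw ?p (Sigma UNIV (\<lambda>k. {..k})) (UNIV \<times> UNIV)"
    by (rule bij_betw_byWitness[where f' = "\<lambda>(m, j). (m + j, j)"]) auto
  have s': "(\<lambda>x. h (fst (?p x)) (snd (?p x))) summable_on Sigma UNIV (\<lambda>k. {..k})"
    using s summable_on_reindex_bij_betw[OF bij, of "\<lambda>x. h (fst x) (snd x)"] by simp
  have row: "summable (\<lambda>j. cmod (h m j))" for m
    by (rule summable_comparison_test'[OF summable_mult[OF sums_summable[OF g], of "C * (1 / 2) ^ m"], of 0])
      (use assms in auto)
  have rowb: "cmod (\<Sum>j. h m j) \<le> C * (1 / 2) ^ m * 2" for m
  proof -
    have "cmod (\<Sum>j. h m j) \<le> (\<Sum>j. cmod (h m j))" by (rule summable_norm[OF row])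
    also have "\<dots> \<le> (\<Sum>j. C * (1 / 2) ^ m * (1 / 2) ^ j)"
      by (intro suminf_le assms row summable_mult sums_summable[OF g])
    finally show ?thesis using sums_mult[OF g, of "C * (1 / 2) ^ m"] by (simp add: sums_iff)
  qed
  have sr: "summable (\<lambda>m. cmod (\<Sum>j. h m j))"
    by (rule summable_comparison_test'[OF summable_mult2[OF summable_mult[OF sums_summable[OF g], of C], of 2], of 0])
      (use rowb in auto)
  have triB: "cmod (\<Sum>i\<le>k. h (k - i) i) \<le> real (k + 1) * (C * (1 / 2) ^ k)" for k
  proof -
    have "cmod (\<Sum>i\<le>k. h (k - i) i) \<le> (\<Sum>i\<le>k. C * (1 / 2) ^ k)"
    proof (intro order.trans[OF norm_sum] sum_mono)
      fix i assume "i \<in> {..k}"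
      then show "cmod (h (k - i) i) \<le> C * (1 / 2) ^ k"
        using assms[of "k - i" i] by (simp add: mult.assoc flip: power_add)
    qed
    then show ?thesis by simp
  qed
  have "summable (\<lambda>k. real (k + 1) * (C * (1 / 2) ^ k))"
  proof -
    have "summable (\<lambda>k. of_nat (Suc k) * (1 / 2 :: real) ^ k)"
      using geometric_deriv_sums[of "1 / 2 :: real"] by (simp add: sums_iff)
    from summable_mult[OF this, of C] show ?thesis by (simp add: mult_ac)
  qed
  then have st: "summable (\<lambda>k. cmod (\<Sum>i\<le>k. h (k - i) i))"
    by (rule summable_comparison_test'[of _ 0]) (use triB in auto)
  have "(\<Sum>k. \<Sum>i\<le>k. h (k - i) i) = infsum (\<lambda>k. \<Sum>i\<le>k. h (k - i) i) UNIV"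
    by (intro infsumI[symmetric] norm_summable_imp_has_sum st summable_sums summable_norm_cancel[OF st])
  also have "\<dots> = infsum (\<lambda>k. infsum (\<lambda>i. h (k - i) i) {..k}) UNIV" by simp
  also have "\<dots> = infsum (\<lambda>x. h (fst (?p x)) (snd (?p x))) (Sigma UNIV (\<lambda>k. {..k}))"
    using infsum_Sigma_banach[OF s'] by simp
  also have "\<dots> = infsum (\<lambda>x. h (fst x) (snd x)) (UNIV \<times> UNIV)" by (rule infsum_reindex_bij_betw[OF bij])
  also have "\<dots> = infsum (\<lambda>m. infsum (h m) UNIV) UNIV" using infsum_Sigma_banach[OF s] by simp
  also have "(\<lambda>m. infsum (h m) UNIV) = (\<lambda>m. \<Sum>j. h m j)"
    by (intro ext infsumI norm_summable_imp_has_sum row summable_sums summable_norm_cancel[OF row])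
  also have "infsum (\<lambda>m. \<Sum>j. h m j) UNIV = (\<Sum>m. \<Sum>j. h m j)"
    by (intro infsumI norm_summable_imp_has_sum sr summable_sums summable_norm_cancel[OF sr])
  finally show ?thesis .
qed

section \<open>Superpositions of eigenvectors along an arc of the unit circle\<close>

context convolution
begin

text \<open>All atoms for fixed \<gamma> and \<eta> lie in the unit ball of one \<open>Rep\<close>
  radius, on which the continuous functional \<open>ev\<close> is bounded.\<close>

lemma ev_atom_bound:
  assumes "\<gamma> \<in> dual E" "\<eta> \<in> dual E"
  shows "\<exists>K\<ge>0. \<forall>k. cmod (ev (atom \<gamma> \<eta> k)) \<le> K"
proof -
  obtain t C where tC: "t > 0" "C \<ge> 0" "\<And>f. f \<in> H \<Longrightarrow> cmod (ev f) \<le> C * sn t f"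
    using ev_bound by blast
  let ?r = "dual_norm E \<gamma> + dual_norm E \<eta>"
  have "cmod (ev (atom \<gamma> \<eta> k)) \<le> C * exp (t * ?r)" for k
  proof -
    have R: "Rep ?r (atom \<gamma> \<eta> k) 1" by (rule Rep_atom[OF assms order.refl])
    have "cmod (ev (atom \<gamma> \<eta> k)) \<le> C * sn t (atom \<gamma> \<eta> k)" by (rule tC(3)[OF Rep_H[OF R]])
    also have "\<dots> \<le> C * exp (t * ?r)" using Rep_sn[OF R tC(1)] tC(2) by (simp add: mult_left_mono)
    finally show ?thesis .
  qed
  then show ?thesis using tC(2) by (intro exI[of _ "C * exp (t * ?r)"]) auto
qed

text \<open>The numbers \<open>ev (atom \<gamma> \<eta> j)\<close> are the Taylor coefficients of \<open>z \<mapsto> T(e\<^bsup>\<gamma>+z\<eta>\<^esup>)(0)\<close>.\<close>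

lemma T_atom_series:
  assumes g: "\<gamma> \<in> dual E" and h: "\<eta> \<in> dual E" and r: "dual_norm E \<gamma> + dual_norm E \<eta> \<le> r"
    and c: "\<And>k. cmod (c k) \<le> M * (1 / 2) ^ k"
    and d: "\<And>i. (\<lambda>j. ev (atom \<gamma> \<eta> j) * c (i + j)) sums d i"
  shows "T (\<lambda>x. \<Sum>k. c k * atom \<gamma> \<eta> k x) = (\<lambda>x. \<Sum>k. d k * atom \<gamma> \<eta> k x)"
proof -
  let ?l = "\<lambda>j. ev (atom \<gamma> \<eta> j)"
  obtain K where K: "K \<ge> 0" "\<And>j. cmod (?l j) \<le> K" using ev_atom_bound[OF g h] by blast
  have M: "0 \<le> M" using c[of 0] by (auto intro: order.trans[OF norm_ge_zero])
  have r0: "0 \<le> r" using r E.dual_norm_nonneg[OF g] E.dual_norm_nonneg[OF h] by linarith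
  have Ra: "Rep r (atom \<gamma> \<eta> k) 1" for k by (rule Rep_atom[OF g h r])
  have R1: "Rep r (fscale (c k) (atom \<gamma> \<eta> k)) (M * (1 / 2) ^ k)" for k
    using Rep_mono[OF Rep_fscale[OF Ra] order.refl] c by simp
  \<comment> \<open>By \<open>T_atom\<close> the image of the k-th atom has k + 1 terms with
    coefficients bounded by K; the decay of c absorbs the linear factor.\<close>
  have R2: "Rep r (T (fscale (c k) (atom \<gamma> \<eta> k))) (M * (1 / 2) ^ k * (real (k + 1) * K))" for k
  proof -
    have "Rep r (T (atom \<gamma> \<eta> k)) (\<Sum>i\<le>k. K)"
      unfolding T_atom[OF g h]
      by (intro Rep_sum r0) (use Rep_mono[OF Rep_fscale[OF Ra] order.refl] K in auto)
    then have "Rep r (fscale (c k) (T (atom \<gamma> \<eta> k))) (cmod (c k) * (\<Sum>i\<le>k. K))" by (rule Rep_fscale)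
    then have "Rep r (T (fscale (c k) (atom \<gamma> \<eta> k))) (cmod (c k) * (\<Sum>i\<le>k. K))"
      by (simp only: T_fscale[OF Rep_H[OF Ra]])
    then show ?thesis
      by (rule Rep_mono[OF _ order.refl])
        (use mult_right_mono[OF c[of k], of "real (k + 1) * K"] K in simp)
  qed
  have s1: "summable (\<lambda>k. M * (1 / 2 :: real) ^ k)" by (intro summable_mult summable_geometric) simp
  have s2: "summable (\<lambda>k. M * (1 / 2) ^ k * (real (k + 1) * K))"
  proof -
    have "summable (\<lambda>k. of_nat (Suc k) * (1 / 2 :: real) ^ k)"
      using geometric_deriv_sums[of "1 / 2 :: real"] by (simp add: sums_iff)
    from summable_mult[OF this, of "M * K"] show ?thesis by (simp add: mult_ac)
  qed
  have "T (\<lambda>x. \<Sum>k. fscale (c k) (atom \<gamma> \<eta> k) x) = (\<lambda>x. \<Sum>k. T (fscale (c k) (atom \<gamma> \<eta> k)) x)"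
    by (rule T_series[OF R1 s1 R2 s2])
  also have "\<dots> = (\<lambda>x. \<Sum>k. d k * atom \<gamma> \<eta> k x)"
  proof
    fix x
    \<comment> \<open>Of the k = m + j powers of \<eta>, \<open>ev\<close> consumes j and m remain;
      summing by m instead of k produces the coefficients d.\<close>
    define h where "h m j = ?l j * c (m + j) * atom \<gamma> \<eta> m x" for m j
    have "(\<Sum>k. T (fscale (c k) (atom \<gamma> \<eta> k)) x) = (\<Sum>k. \<Sum>i\<le>k. h (k - i) i)"
      unfolding T_fscale[OF Rep_H[OF Ra]] T_atom[OF g assms(2)]
      by (intro suminf_cong) (auto simp: h_def sum_fun_apply sum_distrib_left mult_ac intro!: sum.cong)
    also have "\<dots> = (\<Sum>m. \<Sum>j. h m j)"
    proof (rule suminf_triangle)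
      fix m j
      have "cmod (h m j) \<le> K * (M * (1 / 2) ^ (m + j)) * exp (r * vnorm E x)"
        unfolding h_def norm_mult using K M c atom_eval_bound[OF g assms(2) r]
        by (intro mult_mono mult_nonneg_nonneg) auto
      then show "cmod (h m j) \<le> (K * M * exp (r * vnorm E x)) * (1 / 2) ^ m * (1 / 2) ^ j"
        by (simp add: power_add mult_ac)
    qed
    also have "\<dots> = (\<Sum>m. d m * atom \<gamma> \<eta> m x)"
      using sums_mult2[OF d] by (simp add: h_def sums_iff)
    finally show "(\<Sum>k. T (fscale (c k) (atom \<gamma> \<eta> k)) x) = (\<Sum>m. d m * atom \<gamma> \<eta> m x)" .
  qed
  finally show ?thesis by simp
qed

text \<open>With \<lambda>(t) = w exp(i t), the orbit is meant to be x_n = integral of G(t)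
  \<lambda>(t)^(-n) exp(\<gamma> + \<psi>(t) \<eta>) dt. The exponential in the integrand is an
  eigenvector for \<lambda>(t), so \<open>T\<close> lowers n by one, and the dependence on n is that
  of Fourier coefficients. Expansion in powers of \<psi>(t) gives the scalar coefficients
  \<open>c n k\<close> of the atoms.\<close>

lemma local_orbit:
  assumes g: "\<gamma> \<in> dual E" and h: "\<eta> \<in> dual E" and r: "dual_norm E \<gamma> + dual_norm E \<eta> \<le> r"
    and \<delta>: "0 < \<delta>" and hol: "\<psi> holomorphic_on ball 0 (2 * \<delta>)"
    and half: "\<And>z. z \<in> ball 0 (2 * \<delta>) \<Longrightarrow> cmod (\<psi> z) \<le> 1 / 2"
    and w: "cmod w = 1"
    and eig: "\<And>z. z \<in> ball 0 (2 * \<delta>) \<Longrightarrow> ev (exp_fun E (\<gamma> + fscale (\<psi> z) \<eta>)) = w * exp (\<i> * z)"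
    and \<sigma>: "\<And>t. t \<in> {-\<delta>..\<delta>} \<Longrightarrow> cmod (\<psi> (of_real t)) \<le> \<sigma>" "\<sigma> \<le> 1 / 2"
  shows "\<exists>f\<in>bi_vectors r. Rep r (f - exp_fun E \<gamma>) (2 * \<sigma>)"
proof -
  let ?S = "ball 0 (2 * \<delta>) :: complex set"
  let ?l = "\<lambda>j. ev (atom \<gamma> \<eta> j)"
  define G where "G t = 15 / (16 * \<delta> ^ 5) * (\<delta> ^ 2 - t ^ 2) ^ 2" for t :: real
  \<comment> \<open>The holomorphic extension of G(t) \<psi>(t)^k, required by the Cauchy estimates
    behind the oscillatory bound.\<close>
  define Kf where "Kf k z = of_real (15 / (16 * \<delta> ^ 5)) * (of_real (\<delta> ^ 2) - z ^ 2) ^ 2 * \<psi> z ^ k" for k z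
  define e where "e n t = exp (- (of_int n * \<i> * of_real t))" for n and t :: real
  define c where "c n k = w powi (- n) * integral {-\<delta>..\<delta>} (\<lambda>t. Kf k (of_real t) * e n t)" for n k
  \<comment> \<open>On the ball of radius 2 \<delta> the factor \<delta>^2 - z^2 has modulus at most
    5 \<delta>^2.\<close>
  define B where "B = 15 / (16 * \<delta> ^ 5) * (5 * \<delta> ^ 2) ^ 2"
  define M where "M = (2 * \<delta> + 64 / \<delta>) * B"
  have B0: "0 \<le> B" using \<delta> by (simp add: B_def)
  have M0: "0 \<le> M" using \<delta> B0 by (simp add: M_def)
  have w0: "w \<noteq> 0" using w by auto
  have nw: "cmod (w powi m) = 1" for m by (simp add: norm_power_int w)
  have ne: "cmod (e n t) = 1" for n t by (simp add: e_def norm_exp_eq_Re)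
  have mem: "complex_of_real t \<in> ?S" if "t \<in> {-\<delta>..\<delta>}" for t using that \<delta> by auto
  have holK: "Kf k holomorphic_on ?S" for k
    unfolding Kf_def by (intro holomorphic_intros hol)
  have bK: "cmod (Kf k z) \<le> B * (1 / 2) ^ k" if z: "z \<in> ?S" for k z
  proof -
    have "cmod (of_real (\<delta> ^ 2) - z ^ 2) \<le> \<delta> ^ 2 + cmod z ^ 2"
      using norm_triangle_ineq4[of "of_real (\<delta> ^ 2)" "z ^ 2"] by (simp add: norm_power)
    also have "\<dots> \<le> \<delta> ^ 2 + (2 * \<delta>) ^ 2" using z \<delta> by (intro add_mono power_mono) auto
    finally have "cmod (of_real (\<delta> ^ 2) - z ^ 2) \<le> 5 * \<delta> ^ 2" by (simp add: power_mult_distrib)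
    then have "cmod (of_real (\<delta> ^ 2) - z ^ 2) ^ 2 \<le> (5 * \<delta> ^ 2) ^ 2" by (intro power_mono) auto
    then have s1: "15 / (16 * \<delta> ^ 5) * cmod (of_real (\<delta> ^ 2) - z ^ 2) ^ 2 \<le> B"
      unfolding B_def using \<delta> by (intro mult_left_mono) auto
    have s2: "cmod (\<psi> z) ^ k \<le> (1 / 2) ^ k" using half[OF z] by (intro power_mono) auto
    have "15 / (16 * \<delta> ^ 5) * cmod (of_real (\<delta> ^ 2) - z ^ 2) ^ 2 * cmod (\<psi> z) ^ k \<le> B * (1 / 2) ^ k"
      by (rule mult_mono[OF s1 s2 B0]) simp
    moreover have "cmod (Kf k z) = 15 / (16 * \<delta> ^ 5) * cmod (of_real (\<delta> ^ 2) - z ^ 2) ^ 2 * cmod (\<psi> z) ^ k"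
      unfolding Kf_def norm_mult norm_power norm_of_real using \<delta> by simp
    ultimately show ?thesis by simp
  qed
  have contK: "continuous_on {-\<delta>..\<delta>} (\<lambda>t. Kf k (of_real t) * e n t)" for k n
    unfolding e_def
    by (intro continuous_intros continuous_on_compose2[OF holomorphic_on_imp_continuous_on[OF holK]])
      (use mem in auto)
  have cont\<psi>: "continuous_on {-\<delta>..\<delta>} (\<lambda>t. \<psi> (of_real t))"
    by (intro continuous_intros continuous_on_compose2[OF holomorphic_on_imp_continuous_on[OF hol]])
      (use mem in auto)
  have zK: "Kf k z = 0" "deriv (Kf k) z = 0" if z: "z = of_real \<delta> \<or> z = of_real (- \<delta>)" for k z
  proof -
    have zz: "z ^ 2 = of_real (\<delta> ^ 2)" using z by auto
    then show "Kf k z = 0" by (simp add: Kf_def)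
    have "z \<in> ?S" using z \<delta> by auto
    then have d: "(\<psi> has_field_derivative deriv \<psi> z) (at z)" using hol by (auto intro!: holomorphic_derivI[of _ ?S])
    have "(Kf k has_field_derivative 0) (at z)"
      unfolding Kf_def by (rule derivative_eq_intros d refl | simp add: zz)+
    then show "deriv (Kf k) z = 0" by (rule DERIV_imp_deriv)
  qed
  have c_bound: "cmod (c n k) \<le> M * decay n * (1 / 2) ^ k" for n k
  proof -
    have "cmod (integral {-\<delta>..\<delta>} (\<lambda>t. Kf k (of_real t) * exp (- (of_int n * \<i> * of_real t))))
        \<le> (2 * \<delta> + 64 / \<delta>) * (B * (1 / 2) ^ k) * decay n"
      by (rule oscillatory_integral_bound[OF holK \<delta> bK]) (use zK in auto)
    then show ?thesis unfolding c_def norm_mult nw by (simp add: e_def M_def mult_ac)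
  qed
  obtain K where K: "K \<ge> 0" "\<And>j. cmod (?l j) \<le> K" using ev_atom_bound[OF g h] by blast
  \<comment> \<open>Under the integral the sum over j is the Taylor series of the eigenvalue at
    \<psi>(t), equal to w exp(i t); multiplication by it turns n into n - 1. Truncation at J costs
    at most 2 K (1/2)^J uniformly on the arc, which allows passing to the limit.\<close>
  have shift: "(\<lambda>j. ?l j * c n (i + j)) sums c (n - 1) i" for n i
  proof -
    have "cmod ((\<Sum>j<J. ?l j * c n (i + j)) - c (n - 1) i) \<le> (B * (1 / 2) ^ i * (2 * \<delta>) * (2 * K)) * (1 / 2) ^ J" for J
    proof -
      define p where "p t = (\<Sum>j<J. ?l j * \<psi> (of_real t) ^ j)" for t :: real
      define q where "q t = w * exp (\<i> * of_real t)" for t :: real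
      have pq: "cmod (p t - q t) \<le> 2 * K * (1 / 2) ^ J" if t: "t \<in> {-\<delta>..\<delta>}" for t
      proof -
        let ?z = "\<psi> (of_real t)"
        have sms: "(\<lambda>j. ?l j * ?z ^ j) sums q t"
          using ev_exp_fun_line[OF g h, of ?z] eig[OF mem[OF t]] by (simp add: q_def)
        have le: "cmod (?l (j + J) * ?z ^ (j + J)) \<le> K * (1 / 2) ^ J * (1 / 2) ^ j" for j
        proof -
          have "cmod (?l (j + J)) * cmod ?z ^ (j + J) \<le> K * (1 / 2) ^ (j + J)"
            using K half[OF mem[OF t]] by (intro mult_mono power_mono) auto
          then show ?thesis by (simp add: norm_mult norm_power power_add mult_ac)
        qed
        have gs: "(\<lambda>j. K * (1 / 2) ^ J * (1 / 2) ^ j) sums (K * (1 / 2) ^ J * 2)"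
          using geometric_sums[of "1 / 2 :: real"] by (intro sums_mult) simp
        have ab: "summable (\<lambda>j. cmod (?l (j + J) * ?z ^ (j + J)))"
          by (rule summable_comparison_test'[OF sums_summable[OF gs], of 0]) (use le in auto)
        have "q t - p t = (\<Sum>j. ?l (j + J) * ?z ^ (j + J))"
          using suminf_minus_initial_segment[OF sums_summable[OF sms], of J] sms by (simp add: p_def sums_iff)
        then have "cmod (q t - p t) \<le> (\<Sum>j. K * (1 / 2) ^ J * (1 / 2) ^ j)"
          using summable_norm[OF ab] suminf_le[OF le ab sums_summable[OF gs]] by simp
        then show ?thesis using gs by (simp add: sums_iff norm_minus_commute)
      qed
      have contp: "continuous_on {-\<delta>..\<delta>} p" and contq: "continuous_on {-\<delta>..\<delta>} q"
        unfolding p_def q_def by (intro continuous_intros cont\<psi>)+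
      have int: "(\<lambda>t. Kf i (of_real t) * e n t * f t) integrable_on {-\<delta>..\<delta>}" if "continuous_on {-\<delta>..\<delta>} f" for f
        by (intro integrable_continuous_interval continuous_on_mult contK that)
      have "(\<Sum>j<J. ?l j * c n (i + j)) = w powi (- n) * (\<Sum>j<J. integral {-\<delta>..\<delta>} (\<lambda>t. ?l j * (Kf (i + j) (of_real t) * e n t)))"
        unfolding c_def sum_distrib_left by (intro sum.cong) auto
      also have "(\<Sum>j<J. integral {-\<delta>..\<delta>} (\<lambda>t. ?l j * (Kf (i + j) (of_real t) * e n t)))
          = integral {-\<delta>..\<delta>} (\<lambda>t. \<Sum>j<J. ?l j * (Kf (i + j) (of_real t) * e n t))"
        by (intro integral_sum[symmetric] integrable_continuous_interval continuous_on_mult_left contK) auto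
      also have "(\<lambda>t. \<Sum>j<J. ?l j * (Kf (i + j) (of_real t) * e n t)) = (\<lambda>t. Kf i (of_real t) * e n t * p t)"
        unfolding p_def sum_distrib_left Kf_def by (intro ext sum.cong) (auto simp: power_add)
      finally have 1: "(\<Sum>j<J. ?l j * c n (i + j)) = w powi (- n) * integral {-\<delta>..\<delta>} (\<lambda>t. Kf i (of_real t) * e n t * p t)" .
      have "e (n - 1) t = e n t * exp (\<i> * of_real t)" for t
        unfolding e_def by (simp add: algebra_simps flip: exp_add)
      moreover have "w powi (- (n - 1)) = w powi (- n) * w" using power_int_add_1[of w "- n"] w0 by simp
      ultimately have "c (n - 1) i = w powi (- n) * (w * integral {-\<delta>..\<delta>} (\<lambda>t. Kf i (of_real t) * (e n t * exp (\<i> * of_real t))))"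
        unfolding c_def by (simp only: mult.assoc)
      also have "w * integral {-\<delta>..\<delta>} (\<lambda>t. Kf i (of_real t) * (e n t * exp (\<i> * of_real t)))
          = integral {-\<delta>..\<delta>} (\<lambda>t. w * (Kf i (of_real t) * (e n t * exp (\<i> * of_real t))))"
        by (rule integral_mult_right[symmetric])
      also have "(\<lambda>t. w * (Kf i (of_real t) * (e n t * exp (\<i> * of_real t)))) = (\<lambda>t. Kf i (of_real t) * e n t * q t)"
        unfolding q_def by (intro ext) (simp only: mult_ac)
      finally have 2: "c (n - 1) i = w powi (- n) * integral {-\<delta>..\<delta>} (\<lambda>t. Kf i (of_real t) * e n t * q t)" .
      have "(\<Sum>j<J. ?l j * c n (i + j)) - c (n - 1) i
          = w powi (- n) * integral {-\<delta>..\<delta>} (\<lambda>t. Kf i (of_real t) * e n t * p t - Kf i (of_real t) * e n t * q t)"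
        unfolding 1 2 integral_diff[OF int[OF contp] int[OF contq]] by (simp only: right_diff_distrib)
      then have "cmod ((\<Sum>j<J. ?l j * c n (i + j)) - c (n - 1) i)
          = cmod (integral {-\<delta>..\<delta>} (\<lambda>t. Kf i (of_real t) * e n t * p t - Kf i (of_real t) * e n t * q t))"
        by (simp only: norm_mult nw mult_1)
      also have "\<dots> \<le> (B * (1 / 2) ^ i * (2 * K * (1 / 2) ^ J)) * (\<delta> - (- \<delta>))"
      proof (rule integral_bound)
        show "continuous_on {-\<delta>..\<delta>} (\<lambda>t. Kf i (of_real t) * e n t * p t - Kf i (of_real t) * e n t * q t)"
          by (intro continuous_on_diff continuous_on_mult contK contp contq)
        fix t assume t: "t \<in> {-\<delta>..\<delta>}"
        have "cmod (Kf i (of_real t) * e n t * p t - Kf i (of_real t) * e n t * q t)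
            = cmod (Kf i (of_real t)) * cmod (p t - q t)"
          by (simp only: right_diff_distrib[symmetric] norm_mult ne mult_1_right)
        also have "\<dots> \<le> (B * (1 / 2) ^ i) * (2 * K * (1 / 2) ^ J)"
          using bK[OF mem[OF t]] pq[OF t] B0 by (intro mult_mono) auto
        finally show "cmod (Kf i (of_real t) * e n t * p t - Kf i (of_real t) * e n t * q t)
            \<le> B * (1 / 2) ^ i * (2 * K * (1 / 2) ^ J)" .
      qed (use \<delta> in auto)
      finally show ?thesis by (simp add: mult_ac)
    qed
    moreover have lim: "(\<lambda>J. (B * (1 / 2) ^ i * (2 * \<delta>) * (2 * K)) * (1 / 2) ^ J) \<longlonglongrightarrow> 0"
      by (intro tendsto_mult_right_zero LIMSEQ_power_zero) auto
    ultimately have "(\<lambda>J. (\<Sum>j<J. ?l j * c n (i + j)) - c (n - 1) i) \<longlonglongrightarrow> 0"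
      by (intro Lim_null_comparison[OF _ lim] always_eventually allI)
    then show ?thesis by (simp add: sums_def LIM_zero_iff)
  qed
  define x where "x n = (\<lambda>y. \<Sum>k. c n k * atom \<gamma> \<eta> k y)" for n
  have Ra: "Rep r (atom \<gamma> \<eta> k) 1" for k by (rule Rep_atom[OF g h r])
  have gs: "(\<lambda>k. (1 / 2 :: real) ^ k) sums 2" using geometric_sums[of "1 / 2 :: real"] by simp
  have sc: "summable (\<lambda>k. cmod (c n k))" for n
    by (rule summable_comparison_test'[OF summable_mult[OF sums_summable[OF gs], of "M * decay n"], of 0])
      (use c_bound in auto)
  have Rx: "Rep r (x n) ((2 * M) * decay n)" for n
  proof -
    have "(\<Sum>k. cmod (c n k)) \<le> (\<Sum>k. M * decay n * (1 / 2) ^ k)"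
      by (intro suminf_le c_bound sc summable_mult sums_summable[OF gs])
    then have "(\<Sum>k. cmod (c n k)) * 1 \<le> (2 * M) * decay n"
      using sums_mult[OF gs, of "M * decay n"] by (simp add: sums_iff)
    then show ?thesis unfolding x_def by (rule Rep_mono[OF Rep_series[OF Ra sc] order.refl])
  qed
  have Tx: "T (x n) = x (n - 1)" for n
    unfolding x_def
    by (rule T_atom_series[OF g h r _ shift, of n "M * decay n"]) (rule c_bound)
  have "bi_orbit r x (2 * M)" unfolding bi_orbit_def using Rx Tx by blast
  then have xb: "x 0 \<in> bi_vectors r" by (auto simp: bi_vectors_def)
  have KG: "Kf k (of_real t) = of_real (G t) * \<psi> (of_real t) ^ k" for k t
    by (simp add: Kf_def G_def)
  have G0: "0 \<le> G t" for t using \<delta> by (simp add: G_def)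
  have Gint: "(G has_integral 1) {-\<delta>..\<delta>}" unfolding G_def by (rule bump_integral[OF \<delta>])
  have c0: "c 0 k = integral {-\<delta>..\<delta>} (\<lambda>t. Kf k (of_real t))" for k by (simp add: c_def e_def)
  have c00: "c 0 0 = 1"
  proof -
    have "((\<lambda>t. complex_of_real (G t)) has_integral of_real 1) {-\<delta>..\<delta>}"
      by (rule has_integral_of_real[OF Gint])
    then show ?thesis unfolding c0 KG by (simp add: integral_unique)
  qed
  \<comment> \<open>G is non-negative of mass 1 and |\<psi>| is at most \<sigma> on the arc. With
    \<open>c 0 0 = 1\<close>, the vector \<open>x 0\<close> differs from the exponential of \<gamma>
    by at most the sum of \<sigma>^k over k \<ge> 1.\<close>
  have c0k: "cmod (c 0 k) \<le> \<sigma> ^ k" for k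
  proof -
    have "cmod (integral {-\<delta>..\<delta>} (\<lambda>t. Kf k (of_real t))) \<le> integral {-\<delta>..\<delta>} (\<lambda>t. \<sigma> ^ k * G t)"
    proof (rule integral_norm_bound_integral)
      show "(\<lambda>t. Kf k (of_real t)) integrable_on {-\<delta>..\<delta>}"
        using contK[of k 0] by (intro integrable_continuous_interval) (simp add: e_def)
      show "(\<lambda>t. \<sigma> ^ k * G t) integrable_on {-\<delta>..\<delta>}"
        using Gint by (intro integrable_on_mult_right) (rule has_integral_integrable)
      fix t assume "t \<in> {-\<delta>..\<delta>}"
      then have "cmod (\<psi> (of_real t)) ^ k \<le> \<sigma> ^ k" using \<sigma> by (intro power_mono) auto
      then show "cmod (Kf k (of_real t)) \<le> \<sigma> ^ k * G t"
        unfolding KG norm_mult norm_power using G0[of t] by (simp add: mult.commute mult_left_mono)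
    qed
    also have "\<dots> = \<sigma> ^ k" using Gint by (simp add: integral_unique)
    finally show ?thesis unfolding c0 .
  qed
  have \<sigma>0: "0 \<le> \<sigma>" using \<sigma>(1)[of 0] \<delta> by (auto intro: order.trans[OF norm_ge_zero])
  have R0: "Rep r (fscale (c 0 k) (atom \<gamma> \<eta> k)) (\<sigma> ^ k)" for k
    using Rep_mono[OF Rep_fscale[OF Ra] order.refl] c0k by simp
  have s\<sigma>: "summable (\<lambda>k. \<sigma> ^ k)" using \<sigma> \<sigma>0 by (intro summable_geometric) auto
  have t1: "Rep r ((\<lambda>y. \<Sum>k. fscale (c 0 k) (atom \<gamma> \<eta> k) y) - (\<Sum>k<1. fscale (c 0 k) (atom \<gamma> \<eta> k))) (\<Sum>k. \<sigma> ^ (k + 1))"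
    by (rule Rep_tail[OF R0 s\<sigma>])
  have t2: "(\<lambda>y. \<Sum>k. fscale (c 0 k) (atom \<gamma> \<eta> k) y) = x 0" by (simp add: x_def)
  have t3: "(\<Sum>k<1. fscale (c 0 k) (atom \<gamma> \<eta> k)) = exp_fun E \<gamma>"
    by (simp add: c00 exp_fun_atom[of \<gamma> \<eta>])
  have t4: "(\<Sum>k. \<sigma> ^ (k + 1)) \<le> 2 * \<sigma>"
  proof -
    have "(\<Sum>k. \<sigma> ^ (k + 1)) = \<sigma> * (\<Sum>k. \<sigma> ^ k)" using suminf_mult[OF s\<sigma>, of \<sigma>] by simp
    also have "(\<Sum>k. \<sigma> ^ k) = 1 / (1 - \<sigma>)" using \<sigma> \<sigma>0 by (simp add: suminf_geometric)
    also have "\<sigma> * (1 / (1 - \<sigma>)) \<le> \<sigma> * 2" using \<sigma> \<sigma>0 by (intro mult_left_mono) (auto simp: field_simps)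
    finally show ?thesis by (simp only: mult.commute)
  qed
  have "Rep r (x 0 - exp_fun E \<gamma>) (2 * \<sigma>)"
    by (rule Rep_mono[OF _ order.refl t4]) (rule t1[unfolded t2 t3])
  then show ?thesis using xb by blast
qed

text \<open>The eigenvectors over a regular unimodular point of the eigenvalue function are limits of
  smooth superpositions of eigenvectors along shrinking arcs of the unit circle.\<close>

lemma exp_fun_cl_bi_vectors:
  assumes g: "\<gamma> \<in> dual E" and h: "\<eta> \<in> dual E" and r: "dual_norm E \<gamma> < r"
    and uni: "cmod (ev (exp_fun E \<gamma>)) = 1"
    and reg: "deriv (\<lambda>z. ev (exp_fun E (\<gamma> + fscale z \<eta>))) 0 \<noteq> 0"
  shows "exp_fun E \<gamma> \<in> cl (bi_vectors r)"
proof -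
  \<comment> \<open>The direction \<eta> is shrunk so that the norms of \<gamma> and \<rho> \<eta>
    together stay within r.\<close>
  define \<rho> where "\<rho> = (r - dual_norm E \<gamma>) / (dual_norm E \<eta> + 1)"
  have h1: "dual_norm E \<eta> + 1 > 0" using E.dual_norm_nonneg[OF h] by simp
  have \<rho>: "\<rho> > 0" using r h1 by (simp add: \<rho>_def)
  let ?h = "fscale (of_real \<rho>) \<eta>"
  have h': "?h \<in> dual E" by (rule E.dual_fscale[OF h])
  have r': "dual_norm E \<gamma> + dual_norm E ?h \<le> r"
  proof -
    have "\<rho> * dual_norm E \<eta> \<le> \<rho> * (dual_norm E \<eta> + 1)" using \<rho> by (intro mult_left_mono) auto
    also have "\<dots> = r - dual_norm E \<gamma>" using h1 by (simp add: \<rho>_def)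
    finally show ?thesis using \<rho> by (simp add: E.dual_norm_fscale[OF h])
  qed
  have r0: "0 \<le> r" using r E.dual_norm_nonneg[OF g] by simp
  define \<Lambda> where "\<Lambda> z = ev (exp_fun E (\<gamma> + fscale z ?h))" for z
  define w where "w = \<Lambda> 0"
  have hol: "\<Lambda> holomorphic_on UNIV" unfolding \<Lambda>_def by (rule ev_exp_fun_line_holomorphic[OF g h'])
  have w: "w = ev (exp_fun E \<gamma>)" by (simp add: w_def \<Lambda>_def)
  have nw: "cmod w = 1" using uni w by simp
  have w0: "w \<noteq> 0" using nw by auto
  have d0: "deriv \<Lambda> 0 \<noteq> 0"
  proof -
    let ?L = "\<lambda>z. ev (exp_fun E (\<gamma> + fscale z \<eta>))"
    have "(?L has_field_derivative deriv ?L 0) (at (of_real \<rho> * 0))"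
      using ev_exp_fun_line_holomorphic[OF g h] by (auto intro: holomorphic_derivI[of _ UNIV])
    from DERIV_chain'[OF DERIV_cmult[OF DERIV_ident] this]
    have "((\<lambda>z. ?L (of_real \<rho> * z)) has_field_derivative deriv ?L 0 * (of_real \<rho> * 1)) (at 0)" by simp
    moreover have "(\<lambda>z. ?L (of_real \<rho> * z)) = \<Lambda>" by (intro ext) (simp add: \<Lambda>_def mult.commute)
    ultimately have "deriv \<Lambda> 0 = deriv ?L 0 * of_real \<rho>" by (simp add: DERIV_imp_deriv)
    then show ?thesis using reg \<rho> by simp
  qed
  obtain R where R: "R > 0" "inj_on \<Lambda> (ball 0 R)"
    by (rule has_complex_derivative_locally_invertible[OF hol UNIV_I open_UNIV d0]) (rule that)
  \<comment> \<open>The radius 1/2 later gives the bound on \<psi> that makes the series in its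
    powers converge geometrically.\<close>
  define V where "V = ball (0 :: complex) (min R (1 / 2))"
  have "V \<subseteq> ball 0 R" by (auto simp: V_def)
  then have "inj_on \<Lambda> V" using R(2) by (rule inj_on_subset[rotated])
  moreover have "\<Lambda> holomorphic_on V" by (rule holomorphic_on_subset[OF hol]) simp
  moreover have "open V" "0 \<in> V" using R(1) by (simp_all add: V_def)
  ultimately have V: "open V" "0 \<in> V" "inj_on \<Lambda> V" "\<Lambda> holomorphic_on V" by blast+
  obtain \<theta> where \<theta>: "\<theta> holomorphic_on \<Lambda> ` V" "\<And>z. z \<in> V \<Longrightarrow> \<theta> (\<Lambda> z) = z"
    by (rule holomorphic_has_inverse[OF V(4,1,3)]) (rule that)
  have oV: "open (\<Lambda> ` V)" by (rule open_mapping_thm3[OF V(4,1,3)])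
  have "continuous_on UNIV (\<lambda>z. w * exp (\<i> * z))" by (intro continuous_intros)
  then have "open ((\<lambda>z. w * exp (\<i> * z)) -` (\<Lambda> ` V))" using oV by (auto intro: open_vimage)
  moreover have "0 \<in> (\<lambda>z. w * exp (\<i> * z)) -` (\<Lambda> ` V)" using V(2) by (simp add: w_def)
  ultimately obtain d where d: "d > 0" "ball 0 d \<subseteq> (\<lambda>z. w * exp (\<i> * z)) -` (\<Lambda> ` V)"
    using open_contains_ball by blast
  \<comment> \<open>The local inverse of the eigenvalue function, read along the arc: the eigenvalue
    at \<psi>(z) is w exp(i z).\<close>
  define \<psi> where "\<psi> z = \<theta> (w * exp (\<i> * z))" for z
  have \<psi>V: "\<psi> z \<in> V" "\<Lambda> (\<psi> z) = w * exp (\<i> * z)" if z: "z \<in> ball 0 d" for z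
  proof -
    obtain v where "v \<in> V" "w * exp (\<i> * z) = \<Lambda> v" using d(2) z by blast
    then show "\<psi> z \<in> V" "\<Lambda> (\<psi> z) = w * exp (\<i> * z)" using \<theta>(2) by (auto simp: \<psi>_def)
  qed
  have hol\<psi>: "\<psi> holomorphic_on ball 0 d"
  proof -
    have "(\<theta> \<circ> (\<lambda>z. w * exp (\<i> * z))) holomorphic_on ball 0 d"
      by (rule holomorphic_on_compose_gen[OF _ \<theta>(1)]) (use d(2) in \<open>auto intro!: holomorphic_intros\<close>)
    then show ?thesis by (simp add: \<psi>_def[abs_def] o_def)
  qed
  have \<psi>0: "\<psi> 0 = 0" using \<theta>(2)[OF V(2)] by (simp add: \<psi>_def w_def)
  show ?thesis
  proof (rule Rep_limit_cl[where r = r])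
    show "bi_vectors r \<subseteq> H" using bi_vectors_subspace[OF r0] by (simp add: subspace_H_def)
    show "exp_fun E \<gamma> \<in> H" by (rule exp_fun_H[OF g])
    fix \<epsilon> :: real assume \<epsilon>: "\<epsilon> > 0"
    define \<sigma> where "\<sigma> = min (1 / 2) (\<epsilon> / 2)"
    have \<sigma>: "0 < \<sigma>" "\<sigma> \<le> 1 / 2" "2 * \<sigma> \<le> \<epsilon>" using \<epsilon> by (auto simp: \<sigma>_def)
    have "continuous (at 0) \<psi>"
      using holomorphic_on_imp_continuous_on[OF hol\<psi>] d(1) by (simp add: continuous_on_eq_continuous_at)
    then obtain d' where d': "d' > 0" "\<And>z. dist z 0 < d' \<Longrightarrow> dist (\<psi> z) (\<psi> 0) < \<sigma>"
      using \<sigma>(1) unfolding continuous_at_eps_delta by (metis)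
    define \<delta> where "\<delta> = min d d' / 2"
    have \<delta>: "0 < \<delta>" "2 * \<delta> \<le> d" "\<delta> < d'" using d d' by (auto simp: \<delta>_def)
    have "\<exists>f\<in>bi_vectors r. Rep r (f - exp_fun E \<gamma>) (2 * \<sigma>)"
    proof (rule local_orbit[OF g h' r' \<delta>(1) _ _ nw])
      show "\<psi> holomorphic_on ball 0 (2 * \<delta>)" using hol\<psi> \<delta>(2) by (auto intro: holomorphic_on_subset)
      fix z :: complex assume "z \<in> ball 0 (2 * \<delta>)"
      then have z: "z \<in> ball 0 d" using \<delta>(2) by auto
      show "cmod (\<psi> z) \<le> 1 / 2" using \<psi>V(1)[OF z] by (simp add: V_def)
      show "ev (exp_fun E (\<gamma> + fscale (\<psi> z) ?h)) = w * exp (\<i> * z)" using \<psi>V(2)[OF z] by (simp add: \<Lambda>_def)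
    next
      fix t assume "t \<in> {-\<delta>..\<delta>}"
      then have "dist (complex_of_real t) 0 < d'" using \<delta>(3) by auto
      from d'(2)[OF this] show "cmod (\<psi> (of_real t)) \<le> \<sigma>" by (simp add: \<psi>0)
    qed (rule \<sigma>(2))
    then obtain f where f: "f \<in> bi_vectors r" "Rep r (f - exp_fun E \<gamma>) (2 * \<sigma>)" by blast
    have "Rep r (fscale (-1) (f - exp_fun E \<gamma>)) (cmod (-1) * (2 * \<sigma>))" by (rule Rep_fscale[OF f(2)])
    moreover have "fscale (-1) (f - exp_fun E \<gamma>) = exp_fun E \<gamma> - f" by (simp add: fun_eq_iff)
    ultimately have "Rep r (exp_fun E \<gamma> - f) (cmod (-1) * (2 * \<sigma>))" by (simp only:)
    then have "Rep r (exp_fun E \<gamma> - f) \<epsilon>" by (rule Rep_mono) (use \<sigma> in auto)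
    moreover have "f \<in> cl (bi_vectors r)"
      using f(1) cl_superset bi_vectors_subspace[OF r0] by (auto simp: subspace_H_def)
    ultimately show "\<exists>g\<in>cl (bi_vectors r). Rep r (exp_fun E \<gamma> - g) \<epsilon>" by blast
  qed
qed

end

section \<open>Density and separability\<close>

context poly_ideal_space
begin

text \<open>The line is parametrised by the normalised direction \<delta> / |\<delta>|, so the
  radius |\<gamma>| + 1 does not depend on \<delta>, and dropping the constant term leaves a
  geometric series in |\<delta>|.\<close>

lemma exp_fun_close:
  assumes g: "\<gamma> \<in> dual E" and d: "\<delta> \<in> dual E" "dual_norm E \<delta> \<le> 1 / 2"
  shows "Rep (dual_norm E \<gamma> + 1) (exp_fun E (\<gamma> + \<delta>) - exp_fun E \<gamma>) (2 * dual_norm E \<delta>)"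
proof (cases "dual_norm E \<delta> = 0")
  case True
  then have "\<delta> = 0" using E.dual_norm_eq_zero d by blast
  then have "exp_fun E (\<gamma> + \<delta>) - exp_fun E \<gamma> = 0" by simp
  then show ?thesis using Rep_zero[of "dual_norm E \<gamma> + 1"] E.dual_norm_nonneg[OF g] True by simp
next
  case False
  define \<rho> where "\<rho> = dual_norm E \<delta>"
  have \<rho>: "0 < \<rho>" "\<rho> \<le> 1 / 2" using False E.dual_norm_nonneg[OF d(1)] d(2) by (auto simp: \<rho>_def)
  define \<eta> where "\<eta> = fscale (of_real (1 / \<rho>)) \<delta>"
  have h: "\<eta> \<in> dual E" unfolding \<eta>_def by (rule E.dual_fscale[OF d(1)])
  have nh: "dual_norm E \<eta> = 1"
    using \<rho>(1) E.dual_norm_fscale[OF d(1), of "of_real (1 / \<rho>)"] by (simp add: \<eta>_def \<rho>_def norm_divide)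
  have \<delta>: "\<delta> = fscale (of_real \<rho>) \<eta>" using \<rho>(1) by (simp add: \<eta>_def)
  let ?f = "\<lambda>k. fscale (of_real \<rho> ^ k) (atom \<gamma> \<eta> k)"
  have R: "Rep (dual_norm E \<gamma> + 1) (?f k) (\<rho> ^ k)" for k
    using Rep_fscale[OF Rep_atom[OF g h, of "dual_norm E \<gamma> + 1" k], of "of_real \<rho> ^ k"] nh \<rho>(1)
    by (simp add: norm_power)
  have s: "summable (\<lambda>k. \<rho> ^ k)" using \<rho> by (intro summable_geometric) auto
  have "Rep (dual_norm E \<gamma> + 1) ((\<lambda>x. \<Sum>k. ?f k x) - (\<Sum>k<1. ?f k)) (\<Sum>k. \<rho> ^ (k + 1))"
    by (rule Rep_tail[OF R s])
  moreover have "(\<lambda>x. \<Sum>k. ?f k x) = exp_fun E (\<gamma> + \<delta>)"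
    unfolding \<delta> exp_fun_line by simp
  moreover have "(\<Sum>k<1. ?f k) = exp_fun E \<gamma>" by (simp add: exp_fun_atom[of \<gamma> \<eta>])
  ultimately have "Rep (dual_norm E \<gamma> + 1) (exp_fun E (\<gamma> + \<delta>) - exp_fun E \<gamma>) (\<Sum>k. \<rho> ^ (k + 1))"
    by (simp only:)
  moreover have "(\<Sum>k. \<rho> ^ (k + 1)) \<le> 2 * \<rho>"
  proof -
    have "(\<Sum>k. \<rho> ^ (k + 1)) = \<rho> * (\<Sum>k. \<rho> ^ k)" using suminf_mult[OF s, of \<rho>] by simp
    also have "(\<Sum>k. \<rho> ^ k) = 1 / (1 - \<rho>)" using \<rho> by (simp add: suminf_geometric)
    also have "\<rho> * (1 / (1 - \<rho>)) \<le> \<rho> * 2" using \<rho> by (intro mult_left_mono) (auto simp: field_simps)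
    finally show ?thesis by (simp only: mult.commute)
  qed
  ultimately show ?thesis unfolding \<rho>_def by (rule Rep_mono[OF _ order.refl])
qed

lemma exp_fun_limit_cl:
  assumes S: "S \<subseteq> H" and g: "\<gamma> \<in> dual E"
    and lim: "\<And>e. e > 0 \<Longrightarrow> \<exists>\<delta>\<in>dual E. dual_norm E \<delta> < e \<and> exp_fun E (\<gamma> + \<delta>) \<in> cl S"
  shows "exp_fun E \<gamma> \<in> cl S"
proof (rule Rep_limit_cl[OF S exp_fun_H[OF g]])
  fix e :: real assume e: "e > 0"
  then obtain \<delta> where d: "\<delta> \<in> dual E" "dual_norm E \<delta> < min (1 / 2) (e / 2)" "exp_fun E (\<gamma> + \<delta>) \<in> cl S"
    using lim[of "min (1 / 2) (e / 2)"] by auto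
  have "Rep (dual_norm E \<gamma> + 1) (exp_fun E (\<gamma> + \<delta>) - exp_fun E \<gamma>) (2 * dual_norm E \<delta>)"
    using d by (intro exp_fun_close g) auto
  then have "Rep (dual_norm E \<gamma> + 1) (fscale (-1) (exp_fun E (\<gamma> + \<delta>) - exp_fun E \<gamma>)) (cmod (-1) * (2 * dual_norm E \<delta>))"
    by (rule Rep_fscale)
  moreover have "fscale (-1) (exp_fun E (\<gamma> + \<delta>) - exp_fun E \<gamma>) = exp_fun E \<gamma> - exp_fun E (\<gamma> + \<delta>)"
    by (simp add: fun_eq_iff)
  ultimately have "Rep (dual_norm E \<gamma> + 1) (exp_fun E \<gamma> - exp_fun E (\<gamma> + \<delta>)) (cmod (-1) * (2 * dual_norm E \<delta>))"
    by (simp only:)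
  then have "Rep (dual_norm E \<gamma> + 1) (exp_fun E \<gamma> - exp_fun E (\<gamma> + \<delta>)) e"
    by (rule Rep_mono) (use d in auto)
  then show "\<exists>g\<in>cl S. Rep (dual_norm E \<gamma> + 1) (exp_fun E \<gamma> - g) e" using d(3) by blast
qed

text \<open>Gaussian rational combinations of the exponentials of a dense sequence in the dual form
  a countable set. It is not a complex subspace, but its closure is; the closure contains all
  exponentials by norm continuity, hence everything.\<close>

lemma H_separable:
  assumes "separable_space (vtopology (dual_space E))"
  shows "\<exists>q :: nat \<Rightarrow> 'u \<Rightarrow> complex. range q \<subseteq> H \<and> cl (range q) = H"
proof -
  interpret D: complex_normed_space "dual_space E" by (rule E.dual_space_normed)
  interpret M: Metric_space "dual E" "vdist (dual_space E)" using D.metric by (simp add: dual_space_def)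
  have carrier: "vcarrier (dual_space E) = dual E" by (simp add: dual_space_def)
  have "separable_space M.mtopology" using assms by (simp only: carrier)
  then have "\<exists>C. countable C \<and> C \<subseteq> dual E \<and> M.mtopology closure_of C = dual E"
    by (simp only: separable_space_def M.topspace_mtopology)
  then obtain C where C: "countable C" "C \<subseteq> dual E" "M.mtopology closure_of C = dual E"
    by (elim exE conjE)
  have "0 \<in> M.mtopology closure_of C" using C(3) E.dual_zero by simp
  then have "C \<noteq> {}" by auto
  define \<gamma> where "\<gamma> = from_nat_into C"
  have \<gamma>: "range \<gamma> = C" unfolding \<gamma>_def by (rule range_from_nat_into[OF \<open>C \<noteq> {}\<close> C(1)])
  \<comment> \<open>Combinations are coded by lists of (real part, imaginary part, index), a
    countable type; addition is then concatenation.\<close>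
  define item where "item = (\<lambda>(a :: rat, b :: rat, i :: nat). fscale (Complex (of_rat a) (of_rat b)) (exp_fun E (\<gamma> i)))"
  define val where "val l = sum_list (map item l)" for l
  define Q where "Q = range val"
  have \<gamma>d: "\<gamma> i \<in> dual E" for i using \<gamma> C(2) by auto
  have itemH: "item t \<in> H" for t
    by (cases t) (auto simp: item_def intro!: H_fscale exp_fun_H \<gamma>d)
  have valN: "val [] = 0" and valC: "val (t # l) = item t + val l" for t l by (simp_all add: val_def)
  have valH: "val l \<in> H" for l
  proof (induction l)
    case Nil
    show ?case unfolding valN by (rule H_zero)
  next
    case (Cons t l)
    then show ?case unfolding valC by (intro H_add itemH)
  qed
  have QH: "Q \<subseteq> H" unfolding Q_def using valH by auto
  have Qadd: "f + g \<in> Q" if fg: "f \<in> Q" "g \<in> Q" for f g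
  proof -
    obtain l l' where "f = val l" "g = val l'" using fg by (auto simp: Q_def)
    then have "f + g = val (l @ l')" by (simp add: val_def)
    then show ?thesis by (simp add: Q_def)
  qed
  have Qscale: "fscale (Complex (of_rat a) (of_rat b)) f \<in> Q" if f: "f \<in> Q" for a b f
  proof -
    obtain l where l: "f = val l" using f by (auto simp: Q_def)
    have "fscale (Complex (of_rat a) (of_rat b)) (val l)
        = val (map (\<lambda>(c, d, i). (a * c - b * d, a * d + b * c, i)) l)" for l
    proof (induction l)
      case Nil
      then show ?case by (simp add: val_def)
    next
      case (Cons t l)
      obtain c d i where t: "t = (c, d, i)" by (cases t)
      have "fscale (Complex (of_rat a) (of_rat b)) (item t) = item (a * c - b * d, a * d + b * c, i)"
      proof -
        have "Complex (of_rat a) (of_rat b) * Complex (of_rat c) (of_rat d)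
            = Complex (of_rat (a * c - b * d)) (of_rat (a * d + b * c))"
          by (simp add: complex_eq_iff of_rat_mult of_rat_add of_rat_diff)
        then show ?thesis by (simp add: t item_def)
      qed
      moreover have "fscale (Complex (of_rat a) (of_rat b)) (item t + val l)
          = fscale (Complex (of_rat a) (of_rat b)) (item t) + fscale (Complex (of_rat a) (of_rat b)) (val l)"
        by (simp add: fun_eq_iff distrib_left)
      ultimately show ?case using Cons by (simp only: valC list.map t prod.case)
    qed
    then show ?thesis by (auto simp: Q_def l)
  qed
  have clscale: "fscale c f \<in> cl Q" if f: "f \<in> cl Q" for c f
    unfolding cl_def
  proof (intro CollectI conjI allI impI)
    show "fscale c f \<in> H" by (rule H_fscale[OF cl_H[OF f]])
    fix s e :: real assume s: "s > 0" and e: "e > 0"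
    define m where "m = sn s f + 1"
    have m: "m > 0" "sn s f \<le> m" using sn_nonneg[OF cl_H[OF f] s] by (auto simp: m_def)
    \<comment> \<open>The errors |c - z| \<open>sn s f\<close> and |z| \<open>sn s (f - q)\<close>
      are allotted e/2 each; z is fixed first because the tolerance for q depends on it.\<close>
    define \<epsilon> where "\<epsilon> = e / (4 * m)"
    have \<epsilon>: "\<epsilon> > 0" using e m by (simp add: \<epsilon>_def)
    have rat: "\<exists>a. \<bar>x - of_rat a\<bar> < \<epsilon>" for x :: real
    proof -
      obtain a where "x - \<epsilon> < of_rat a" "of_rat a < x + \<epsilon>" using of_rat_dense[of "x - \<epsilon>" "x + \<epsilon>"] \<epsilon> by auto
      then show ?thesis by (intro exI[of _ a]) (simp add: abs_less_iff)
    qed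
    obtain a where a: "\<bar>Re c - of_rat a\<bar> < \<epsilon>" using rat by blast
    obtain b where b: "\<bar>Im c - of_rat b\<bar> < \<epsilon>" using rat by blast
    define z where "z = Complex (of_rat a) (of_rat b)"
    have "cmod (c - z) \<le> \<bar>Re (c - z)\<bar> + \<bar>Im (c - z)\<bar>" by (rule cmod_le)
    also have "\<dots> < 2 * \<epsilon>" using a b by (simp add: z_def)
    finally have cz: "cmod (c - z) < 2 * \<epsilon>" .
    obtain q where q: "q \<in> Q" "sn s (f - q) < e / (2 * (cmod z + 1))"
      using cl_D[OF f s, of "e / (2 * (cmod z + 1))"] e by (auto simp: add_nonneg_pos)
    have qH: "q \<in> H" using q QH by blast
    define h where "h = fscale c f - fscale z q"
    have eq: "h = fscale (c - z) f + fscale z (f - q)"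
      by (simp add: h_def fun_eq_iff algebra_simps)
    have "sn s h \<le> sn s (fscale (c - z) f) + sn s (fscale z (f - q))"
      unfolding eq by (intro sn_add H_fscale H_diff cl_H[OF f] qH s)
    also have "sn s (fscale (c - z) f) = cmod (c - z) * sn s f" by (rule sn_fscale[OF cl_H[OF f] s])
    also have "sn s (fscale z (f - q)) = cmod z * sn s (f - q)" by (rule sn_fscale[OF H_diff[OF cl_H[OF f] qH] s])
    also have "cmod (c - z) * sn s f \<le> (2 * \<epsilon>) * m" using cz m \<epsilon> sn_nonneg[OF cl_H[OF f] s] by (intro mult_mono) auto
    also have "(2 * \<epsilon>) * m = e / 2" using m by (simp add: \<epsilon>_def)
    also have "cmod z * sn s (f - q) < e / 2"
    proof -
      have "cmod z * sn s (f - q) \<le> cmod z * (e / (2 * (cmod z + 1)))" using q by (intro mult_left_mono) auto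
      also have "\<dots> = e / 2 * (cmod z / (cmod z + 1))" by (simp add: field_simps)
      also have "\<dots> < e / 2 * 1" using e by (intro mult_strict_left_mono) (auto simp: add_nonneg_pos)
      finally show ?thesis by simp
    qed
    finally have "sn s h < e" by simp
    then show "\<exists>g\<in>Q. sn s (fscale c f - g) < e" using Qscale[OF q(1), of a b] unfolding z_def h_def by blast
  qed
  have sub: "subspace_H (cl Q)"
    unfolding subspace_H_def
  proof (intro conjI ballI allI)
    show "cl Q \<subseteq> H" using cl_H by blast
    have "val [] \<in> cl Q" using cl_superset[OF QH] by (auto simp: Q_def)
    then show "0 \<in> cl Q" by (simp add: val_def)
  qed (use clscale cl_add[OF QH Qadd] in auto)
  have "cl (cl Q) = H"
  proof (rule exp_funs_cl[OF sub])
    fix \<delta> assume d: "\<delta> \<in> dual E"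
    show "exp_fun E \<delta> \<in> cl (cl Q)"
    proof (rule exp_fun_limit_cl[OF _ d])
      show "cl Q \<subseteq> H" using cl_H by blast
      fix e :: real assume "e > 0"
      then obtain \<beta> where \<beta>: "\<beta> \<in> C" "\<beta> \<in> M.mball \<delta> e"
        using C(3) d unfolding M.metric_closure_of by blast
      then obtain i where i: "\<beta> = \<gamma> i" using \<gamma> by auto
      have bd: "\<beta> \<in> dual E" using \<beta> C by auto
      have "vdist (dual_space E) \<delta> \<beta> = dual_norm E (\<delta> - \<beta>)"
        using d bd by (simp add: vdist_def dual_space_def)
      then have n: "dual_norm E (\<delta> - \<beta>) < e" using \<beta>(2) unfolding M.in_mball by metis
      have "dual_norm E (\<beta> + fscale (-1) \<delta>) < e"
      proof -
        have "\<beta> + fscale (-1) \<delta> = fscale (-1) (\<delta> - \<beta>)" by (simp add: fun_eq_iff)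
        moreover have "\<delta> - \<beta> \<in> dual E" unfolding fun_diff_eq_fscale by (intro E.dual_plus E.dual_fscale d bd)
        ultimately show ?thesis using E.dual_norm_fscale[of "\<delta> - \<beta>" "-1"] n by simp
      qed
      moreover have "\<beta> + fscale (-1) \<delta> \<in> dual E" by (intro E.dual_plus E.dual_fscale d bd)
      moreover have "exp_fun E (\<delta> + (\<beta> + fscale (-1) \<delta>)) \<in> cl (cl Q)"
      proof -
        have "\<delta> + (\<beta> + fscale (-1) \<delta>) = \<gamma> i" by (simp add: fun_eq_iff i)
        moreover have "exp_fun E (\<gamma> i) = val [(1, 0, i)]"
          by (simp add: val_def item_def complex_eq_iff fun_eq_iff)
        ultimately show ?thesis
          using cl_superset[OF QH] cl_superset[of "cl Q"] cl_H by (auto simp: Q_def)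
      qed
      ultimately show "\<exists>\<alpha>\<in>dual E. dual_norm E \<alpha> < e \<and> exp_fun E (\<delta> + \<alpha>) \<in> cl (cl Q)" by blast
    qed
  qed
  moreover have "cl (cl Q) \<subseteq> cl Q" by (rule cl_mono_cl[OF QH order.refl])
  moreover have "cl Q \<subseteq> H" using cl_H by blast
  ultimately have "cl Q = H" by blast
  moreover have "Q = range (\<lambda>n. val (from_nat n))"
    unfolding Q_def by (metis image_image surj_from_nat)
  ultimately show ?thesis using QH by metis
qed

end

section \<open>Density of the vectors with decaying two-sided orbits\<close>

context convolution
begin

text \<open>By the open mapping theorem the values \<Lambda>(0) exp(i t) for small t > 0 are
  attained near 0. They differ from \<Lambda>(0), so the points found are not 0, and in a small
  punctured disc the derivative has no zeros.\<close>

lemma unimodular_points_accumulate: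
  assumes hol: "\<Lambda> holomorphic_on UNIV" and uni: "cmod (\<Lambda> 0) = 1" and nc: "\<Lambda> \<zeta> \<noteq> \<Lambda> 0" and e: "(e::real) > 0"
  shows "\<exists>z. z \<noteq> 0 \<and> cmod z < e \<and> cmod (\<Lambda> z) = 1 \<and> deriv \<Lambda> z \<noteq> 0"
proof -
  have hold: "deriv \<Lambda> holomorphic_on UNIV" using hol by (intro holomorphic_deriv) auto
  have nconst: "\<not> \<Lambda> constant_on UNIV" using nc by (metis UNIV_I constant_on_def)
  obtain \<beta> where \<beta>: "deriv \<Lambda> \<beta> \<noteq> 0"
  proof (rule ccontr)
    assume "\<not> thesis"
    then have "deriv \<Lambda> z = 0" for z using that by blast
    then have "(\<Lambda> has_field_derivative 0) (at z)" for z
      using holomorphic_derivI[OF hol open_UNIV UNIV_I, of z] by simp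
    then have "\<Lambda> constant_on UNIV"
      by (intro has_field_derivative_0_imp_constant_on) auto
    then show False using nconst by blast
  qed
  obtain R where R: "R > 0" "\<And>z. z \<in> ball 0 R - {0} \<Longrightarrow> deriv \<Lambda> z \<noteq> 0"
  proof (cases "deriv \<Lambda> 0 = 0")
    case True
    then show ?thesis
      by (rule isolated_zeros[OF hold open_UNIV connected_UNIV UNIV_I _ UNIV_I \<beta>]) (rule that)
  next
    case False
    have "continuous (at 0) (deriv \<Lambda>)"
      using holomorphic_on_imp_continuous_on[OF hold] by (simp add: continuous_on_eq_continuous_at)
    then obtain d where "d > 0" "\<And>y. dist 0 y < d \<Longrightarrow> deriv \<Lambda> y \<noteq> 0"
      using continuous_at_avoid[of 0 "deriv \<Lambda>" 0] False by auto
    then show ?thesis by (intro that[of d]) auto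
  qed
  define \<rho> where "\<rho> = min R e"
  have \<rho>: "\<rho> > 0" using R e by (simp add: \<rho>_def)
  have "open (\<Lambda> ` ball 0 \<rho>)"
    by (rule open_mapping_thm[OF hol open_UNIV connected_UNIV _ _ nconst]) auto
  moreover have "continuous_on UNIV (\<lambda>t. \<Lambda> 0 * exp (\<i> * of_real t))" by (intro continuous_intros)
  ultimately have "open ((\<lambda>t. \<Lambda> 0 * exp (\<i> * of_real t)) -` (\<Lambda> ` ball 0 \<rho>))" by (auto intro: open_vimage)
  moreover have "0 \<in> (\<lambda>t. \<Lambda> 0 * exp (\<i> * of_real t)) -` (\<Lambda> ` ball 0 \<rho>)" using \<rho> by auto
  ultimately obtain d where d: "d > 0" "ball 0 d \<subseteq> (\<lambda>t. \<Lambda> 0 * exp (\<i> * of_real t)) -` (\<Lambda> ` ball 0 \<rho>)"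
    using open_contains_ball by blast
  \<comment> \<open>The bound 1 keeps t below pi, so that exp(i t) differs from 1.\<close>
  define t where "t = min (d / 2) 1"
  have t: "0 < t" "t \<le> 1" "t \<in> ball 0 d" using d(1) by (auto simp: t_def)
  obtain z where z: "z \<in> ball 0 \<rho>" "\<Lambda> z = \<Lambda> 0 * exp (\<i> * of_real t)" using d(2) t(3) by auto
  have "exp (\<i> * of_real t) \<noteq> 1"
  proof
    assume "exp (\<i> * of_real t) = 1"
    then have "Im (exp (\<i> * of_real t)) = 0" by simp
    then have "sin t = 0" by (simp add: Im_exp)
    then show False using sin_gt_zero[of t] t pi_gt3 by simp
  qed
  moreover have "\<Lambda> 0 \<noteq> 0" using uni by auto
  ultimately have "z \<noteq> 0" using z(2) by auto
  moreover have "cmod (\<Lambda> z) = 1" using uni z(2) by (simp add: norm_mult norm_exp_eq_Re)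
  ultimately show ?thesis using z(1) R(2)[of z] by (intro exI[of _ z]) (auto simp: \<rho>_def)
qed

text \<open>Regular unimodular points accumulate at \<gamma> on the line, and their exponentials lie
  in the closure. \<open>power_series_coeffs_cl\<close> then extracts all atoms along the line, and
  summing these up reaches \<gamma> + \<eta> however large its norm is.\<close>

lemma exp_fun_line_cl_bi_vectors:
  assumes g: "\<gamma> \<in> dual E" and h: "\<eta> \<in> dual E" and r: "dual_norm E \<gamma> < r"
    and uni: "cmod (ev (exp_fun E \<gamma>)) = 1"
    and nc: "ev (exp_fun E (\<gamma> + \<eta>)) \<noteq> ev (exp_fun E \<gamma>)"
  shows "exp_fun E (\<gamma> + \<eta>) \<in> cl (bi_vectors r)"
proof -
  have r0: "0 \<le> r" using r E.dual_norm_nonneg[OF g] by simp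
  note sub = bi_vectors_subspace[OF r0]
  define \<Lambda> where "\<Lambda> z = ev (exp_fun E (\<gamma> + fscale z \<eta>))" for z
  have hol: "\<Lambda> holomorphic_on UNIV" unfolding \<Lambda>_def by (rule ev_exp_fun_line_holomorphic[OF g h])
  \<comment> \<open>The first bound forces the points to tend to 0; the second keeps the norm of
    \<gamma> + z \<eta> below r.\<close>
  define e where "e n = min (1 / real (n + 2)) ((r - dual_norm E \<gamma>) / (dual_norm E \<eta> + 1))" for n
  have h1: "dual_norm E \<eta> + 1 > 0" using E.dual_norm_nonneg[OF h] by simp
  have e: "e n > 0" for n using r h1 by (simp add: e_def)
  have "\<exists>z. z \<noteq> 0 \<and> cmod z < e n \<and> cmod (\<Lambda> z) = 1 \<and> deriv \<Lambda> z \<noteq> 0" for n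
    by (rule unimodular_points_accumulate[OF hol _ _ e, of 1]) (use uni nc in \<open>auto simp: \<Lambda>_def\<close>)
  then obtain z where z: "\<And>n. z n \<noteq> 0" "\<And>n. cmod (z n) < e n" "\<And>n. cmod (\<Lambda> (z n)) = 1" "\<And>n. deriv \<Lambda> (z n) \<noteq> 0"
    by metis
  have inV: "exp_fun E (\<gamma> + fscale (z n) \<eta>) \<in> cl (bi_vectors r)" for n
  proof (rule exp_fun_cl_bi_vectors[OF _ h])
    have zd: "fscale (z n) \<eta> \<in> dual E" by (rule E.dual_fscale[OF h])
    show "\<gamma> + fscale (z n) \<eta> \<in> dual E" by (rule E.dual_plus[OF g zd])
    define \<zeta> where "\<zeta> = \<gamma> + fscale (z n) \<eta>"
    have "dual_norm E \<zeta> \<le> dual_norm E \<gamma> + cmod (z n) * dual_norm E \<eta>"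
      using E.dual_norm_triangle[OF g zd] unfolding \<zeta>_def by (simp only: E.dual_norm_fscale[OF h])
    also have "cmod (z n) * dual_norm E \<eta> \<le> cmod (z n) * (dual_norm E \<eta> + 1)" by (intro mult_left_mono) auto
    also have "\<dots> < (r - dual_norm E \<gamma>) / (dual_norm E \<eta> + 1) * (dual_norm E \<eta> + 1)"
      using z(2)[of n] h1 by (intro mult_strict_right_mono) (auto simp: e_def)
    also have "\<dots> = r - dual_norm E \<gamma>" using h1 by simp
    finally have "dual_norm E \<zeta> < r" by simp
    then show "dual_norm E (\<gamma> + fscale (z n) \<eta>) < r" by (simp only: \<zeta>_def)
    show "cmod (ev (exp_fun E (\<gamma> + fscale (z n) \<eta>))) = 1" using z(3)[of n] by (simp add: \<Lambda>_def)
    have "(\<Lambda> has_field_derivative deriv \<Lambda> (z n)) (at (z n + 0))"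
      using holomorphic_derivI[OF hol open_UNIV UNIV_I] by simp
    from DERIV_chain'[OF DERIV_add[OF DERIV_const DERIV_ident] this]
    have "((\<lambda>y. \<Lambda> (z n + y)) has_field_derivative deriv \<Lambda> (z n) * (0 + 1)) (at 0)" .
    moreover have "(\<lambda>y. \<Lambda> (z n + y)) = (\<lambda>y. ev (exp_fun E (\<gamma> + fscale (z n) \<eta> + fscale y \<eta>)))"
    proof
      fix y
      have "fscale (z n + y) \<eta> = fscale (z n) \<eta> + fscale y \<eta>" by (simp add: fun_eq_iff distrib_right)
      then show "\<Lambda> (z n + y) = ev (exp_fun E (\<gamma> + fscale (z n) \<eta> + fscale y \<eta>))" by (simp add: \<Lambda>_def add.assoc)
    qed
    ultimately show "deriv (\<lambda>y. ev (exp_fun E (\<gamma> + fscale (z n) \<eta> + fscale y \<eta>))) 0 \<noteq> 0"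
      using z(4)[of n] by (simp add: DERIV_imp_deriv)
  qed
  have atoms: "atom \<gamma> \<eta> k \<in> cl (bi_vectors r)" for k
  proof (rule power_series_coeffs_cl[OF sub])
    show "Rep (dual_norm E \<gamma> + dual_norm E \<eta>) (atom \<gamma> \<eta> k) 1" for k by (rule Rep_atom[OF g h order.refl])
    have zb: "cmod (z n) \<le> 1 / real (n + 2)" for n using z(2)[of n] by (simp add: e_def)
    have "(\<lambda>n. 1 / real (n + 2)) \<longlonglongrightarrow> 0"
      using LIMSEQ_ignore_initial_segment[OF lim_1_over_n, of 2] by simp
    then show "z \<longlonglongrightarrow> 0" by (rule Lim_null_comparison[OF always_eventually[OF allI[OF zb]]])
    show "z n \<noteq> 0" for n by (rule z)
    show "cmod (z n) < 1" for n
    proof -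
      have "1 / real (n + 2) < 1" by simp
      then show ?thesis using zb[of n] by linarith
    qed
    show "(\<lambda>x. \<Sum>k. z n ^ k * atom \<gamma> \<eta> k x) \<in> cl (bi_vectors r)" for n
      using inV[of n] by (simp only: exp_fun_line)
  qed
  \<comment> \<open>Doubling the direction and evaluating at 1/2 makes the coefficients summable,
    which they are not at z = 1.\<close>
  let ?h = "fscale 2 \<eta>"
  have h2: "?h \<in> dual E" by (rule E.dual_fscale[OF h])
  have "exp_fun E (\<gamma> + fscale (1 / 2) ?h) = (\<lambda>x. \<Sum>k. fscale ((1 / 2) ^ k) (atom \<gamma> ?h k) x)"
    unfolding exp_fun_line by simp
  also have "\<dots> \<in> cl (bi_vectors r)"
  proof (rule cl_suminf[OF sub])
    show "Rep (dual_norm E \<gamma> + dual_norm E ?h) (fscale ((1 / 2) ^ k) (atom \<gamma> ?h k)) ((1 / 2) ^ k)" for k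
      using Rep_fscale[OF Rep_atom[OF g h2 order.refl], of "(1 / 2) ^ k" k] by (simp add: norm_power norm_divide)
    show "summable (\<lambda>k. (1 / 2 :: real) ^ k)" by (rule summable_geometric) simp
    show "fscale ((1 / 2) ^ k) (atom \<gamma> ?h k) \<in> cl (bi_vectors r)" for k
      unfolding atom_fscale by (intro subspace_cl(2)[OF sub] atoms)
  qed
  finally show ?thesis by simp
qed

text \<open>Lines through \<gamma>0 reach every functional with a different eigenvalue. A functional
  with the same eigenvalue is a limit of such ones along the segment towards \<gamma>1, because the
  coincidences of eigenvalues on that line are isolated.\<close>

lemma bi_vectors_dense:
  assumes g0: "\<gamma>0 \<in> dual E" and r: "dual_norm E \<gamma>0 < r" and uni: "cmod (ev (exp_fun E \<gamma>0)) = 1"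
    and g1: "\<gamma>1 \<in> dual E" and nc: "ev (exp_fun E \<gamma>1) \<noteq> ev (exp_fun E \<gamma>0)"
  shows "cl (bi_vectors r) = H"
proof (rule exp_funs_cl)
  have r0: "0 \<le> r" using r E.dual_norm_nonneg[OF g0] by simp
  show sub: "subspace_H (bi_vectors r)" by (rule bi_vectors_subspace[OF r0])
  have 1: "exp_fun E \<gamma> \<in> cl (bi_vectors r)"
    if g: "\<gamma> \<in> dual E" and ne: "ev (exp_fun E \<gamma>) \<noteq> ev (exp_fun E \<gamma>0)" for \<gamma>
  proof -
    have eq: "\<gamma>0 + (\<gamma> + fscale (-1) \<gamma>0) = \<gamma>" by (simp add: fun_eq_iff)
    have "\<gamma> + fscale (-1) \<gamma>0 \<in> dual E" by (intro E.dual_plus E.dual_fscale g g0)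
    from exp_fun_line_cl_bi_vectors[OF g0 this r uni] show ?thesis using ne unfolding eq by blast
  qed
  fix \<gamma> assume g: "\<gamma> \<in> dual E"
  show "exp_fun E \<gamma> \<in> cl (bi_vectors r)"
  proof (cases "ev (exp_fun E \<gamma>) = ev (exp_fun E \<gamma>0)")
    case True
    define \<eta> where "\<eta> = \<gamma>1 + fscale (-1) \<gamma>"
    have h: "\<eta> \<in> dual E" unfolding \<eta>_def by (intro E.dual_plus E.dual_fscale g g1)
    have g1eq: "\<gamma> + fscale 1 \<eta> = \<gamma>1" by (simp add: \<eta>_def fun_eq_iff)
    define \<Phi> where "\<Phi> z = ev (exp_fun E (\<gamma> + fscale z \<eta>)) - ev (exp_fun E \<gamma>0)" for z
    have hol: "\<Phi> holomorphic_on UNIV"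
      unfolding \<Phi>_def by (intro holomorphic_intros ev_exp_fun_line_holomorphic g h)
    have \<Phi>0: "\<Phi> 0 = 0" using True by (simp add: \<Phi>_def)
    have \<Phi>1: "\<Phi> 1 \<noteq> 0" using nc unfolding \<Phi>_def g1eq by simp
    obtain R where R: "R > 0" "\<And>z. z \<in> ball 0 R - {0} \<Longrightarrow> \<Phi> z \<noteq> 0"
      by (rule isolated_zeros[OF hol open_UNIV connected_UNIV UNIV_I \<Phi>0 UNIV_I \<Phi>1]) (rule that)
    show ?thesis
    proof (rule exp_fun_limit_cl[OF _ g])
      show "bi_vectors r \<subseteq> H" using sub by (simp add: subspace_H_def)
      fix e :: real assume e: "e > 0"
      have h1: "dual_norm E \<eta> + 1 > 0" using E.dual_norm_nonneg[OF h] by simp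
      define t where "t = min (R / 2) (e / (2 * (dual_norm E \<eta> + 1)))"
      have t: "t > 0" "t < R" using R e h1 by (auto simp: t_def)
      have te: "t * dual_norm E \<eta> < e"
      proof -
        have "t * dual_norm E \<eta> \<le> t * (dual_norm E \<eta> + 1)" using t by (intro mult_left_mono) auto
        also have "\<dots> \<le> e / (2 * (dual_norm E \<eta> + 1)) * (dual_norm E \<eta> + 1)"
          using h1 by (intro mult_right_mono) (auto simp: t_def)
        also have "\<dots> = e / 2"
        proof -
          have "e / (2 * X) * X = e / 2" if "X > 0" for X :: real using that by simp
          then show ?thesis using h1 by blast
        qed
        finally show ?thesis using e by simp
      qed
      have td: "fscale (of_real t) \<eta> \<in> dual E" by (rule E.dual_fscale[OF h])
      have "\<Phi> (of_real t) \<noteq> 0" using t by (intro R(2)) auto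
      then have "exp_fun E (\<gamma> + fscale (of_real t) \<eta>) \<in> cl (bi_vectors r)"
        by (intro 1 E.dual_plus g td) (simp add: \<Phi>_def)
      moreover have "dual_norm E (fscale (of_real t) \<eta>) < e" using te t by (simp add: E.dual_norm_fscale[OF h])
      ultimately show "\<exists>\<delta>\<in>dual E. dual_norm E \<delta> < e \<and> exp_fun E (\<gamma> + \<delta>) \<in> cl (bi_vectors r)"
        using td by blast
    qed
  qed (use 1 g in blast)
qed

text \<open>\<open>T\<close> and multiplication by c agree on the exponentials, hence on their dense
  span, hence everywhere by continuity. Used in contrapositive form to obtain two distinct
  eigenvalues.\<close>

lemma constant_ev_imp_trivial:
  assumes "\<And>\<gamma>. \<gamma> \<in> dual E \<Longrightarrow> ev (exp_fun E \<gamma>) = c"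
  shows "trivial_operator H T"
proof -
  define S where "S = {f \<in> H. T f = fscale c f}"
  have add: "fscale c (f + g) = fscale c f + fscale c g" for f g :: "'u \<Rightarrow> complex"
    by (simp add: fun_eq_iff distrib_left)
  have sub: "subspace_H S"
    unfolding subspace_H_def S_def
    by (auto simp: H_zero T_zero H_add T_add add H_fscale T_fscale mult.commute)
  have SH: "S \<subseteq> H" by (auto simp: S_def)
  have "exp_fun E \<gamma> \<in> S" if "\<gamma> \<in> dual E" for \<gamma>
    using that T_exp_fun[OF that] exp_fun_H[OF that] assms[OF that] by (simp add: S_def)
  then have clS: "cl S = H" by (intro exp_funs_cl sub) (use cl_superset[OF SH] in blast)
  obtain t C where tC: "t > 0" "C \<ge> 0" "\<And>f. f \<in> H \<Longrightarrow> sn 1 (T f) \<le> C * sn t f"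
    using T_bound[of 1] by auto
  have "T f = fscale c f" if f: "f \<in> H" for f
  proof -
    define h where "h = T f - fscale c f"
    have hH: "h \<in> H" unfolding h_def by (intro H_diff T_H H_fscale f)
    have "sn 1 h \<le> 0 + e" if e: "e > 0" for e
    proof -
      \<comment> \<open>This one index dominates both \<open>sn t\<close>, which controls
        \<open>T\<close>, and \<open>sn 1\<close>, in which the difference is measured.\<close>
      let ?t = "max t 1"
      have tt: "?t > 0" by simp
      have fS: "f \<in> cl S" using clS f by simp
      have ep: "0 < e / (C + cmod c + 1)" using e tC(2) by (simp add: add_nonneg_pos)
      obtain g where g: "g \<in> S" "sn ?t (f - g) < e / (C + cmod c + 1)"
        using cl_D[OF fS tt ep] by blast
      have gH: "g \<in> H" and Tg: "T g = fscale c g" using g(1) by (auto simp: S_def)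
      have fg: "f - g \<in> H" by (intro H_diff f gH)
      have "h = T (f - g) - fscale c (f - g)"
        unfolding h_def T_diff[OF f gH] Tg by (simp add: fun_eq_iff algebra_simps)
      then have "h = T (f - g) + fscale (- c) (f - g)" by (simp add: fun_eq_iff algebra_simps)
      then have "sn 1 h \<le> sn 1 (T (f - g)) + sn 1 (fscale (- c) (f - g))"
        using sn_add[OF T_H[OF fg] H_fscale[OF fg], of 1] by simp
      also have "\<dots> \<le> C * sn t (f - g) + cmod c * sn 1 (f - g)"
        using tC(3)[OF fg] sn_fscale[OF fg, of 1 "- c"] by simp
      also have "\<dots> \<le> C * sn ?t (f - g) + cmod c * sn ?t (f - g)"
        using tC fg by (intro add_mono mult_left_mono sn_mono) auto
      also have "\<dots> \<le> (C + cmod c + 1) * sn ?t (f - g)"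
        using sn_nonneg[OF fg tt] by (simp add: algebra_simps)
      also have "\<dots> \<le> (C + cmod c + 1) * (e / (C + cmod c + 1))"
        using g(2) tC(2) by (intro mult_left_mono) auto
      also have "\<dots> = e" using tC(2) by (simp add: add_nonneg_pos less_imp_neq[symmetric])
      finally show ?thesis by simp
    qed
    then have "sn 1 h \<le> 0" by (rule field_le_epsilon)
    then have "h = 0" using sn_eq_zero[OF hH, of 1] sn_nonneg[OF hH, of 1] by simp
    then have "T f - fscale c f = 0" by (simp only: h_def)
    then show ?thesis by (simp add: fun_eq_iff)
  qed
  then show ?thesis by (auto simp: trivial_operator_def)
qed

lemma frequently_hypercyclic_exp_type:
  assumes sep: "separable_space (vtopology (dual_space E))" and nt: "\<not> trivial_operator H T" and \<epsilon>: "\<epsilon> > 0"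
  shows "\<exists>f\<in>exp_type_funs A N E (conv_alpha E T + \<epsilon>). frequently_hypercyclic (bounded_type_topology A N E) T f"
proof -
  have ev_alpha: "T (exp_fun E \<gamma>) (vzero E) = ev (exp_fun E \<gamma>)" for \<gamma> by (simp add: ev_def)
  obtain \<beta> where b: "\<beta> \<in> dual E" "ev (exp_fun E \<beta>) \<noteq> ev (exp_fun E 0)"
    using constant_ev_imp_trivial nt by blast
  let ?\<Lambda> = "\<lambda>z. ev (exp_fun E (0 + fscale z \<beta>))"
  \<comment> \<open>Missing the unit circle would mean omitting the two values 1 and -1, which
    Picard's theorem allows only to constants.\<close>
  have "\<exists>z. cmod (?\<Lambda> z) = 1"
  proof (rule ccontr)
    assume "\<nexists>z. cmod (?\<Lambda> z) = 1"
    then have "range ?\<Lambda> \<inter> {1, -1} = {}" by auto (metis norm_one norm_minus_cancel)+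
    then obtain c where "?\<Lambda> = (\<lambda>z. c)"
      by (rule little_Picard[OF ev_exp_fun_line_holomorphic[OF E.dual_zero b(1)], rotated]) auto
    then have "?\<Lambda> 1 = ?\<Lambda> 0" by metis
    then show False using b(2) by simp
  qed
  then obtain z where z: "cmod (?\<Lambda> z) = 1" by blast
  let ?A = "{dual_norm E \<gamma> | \<gamma>. \<gamma> \<in> dual E \<and> cmod (T (exp_fun E \<gamma>) (vzero E)) = 1}"
  have "0 + fscale z \<beta> \<in> dual E" by (intro E.dual_plus E.dual_zero E.dual_fscale b)
  then have ne: "?A \<noteq> {}" using z by (auto simp: ev_alpha)
  have "Inf ?A < conv_alpha E T + \<epsilon>" using \<epsilon> by (simp add: conv_alpha_def)
  from cInf_lessD[OF ne this] obtain \<gamma>0 where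
    g0: "\<gamma>0 \<in> dual E" "cmod (ev (exp_fun E \<gamma>0)) = 1" "dual_norm E \<gamma>0 < conv_alpha E T + \<epsilon>"
    by (auto simp: ev_alpha)
  define r where "r = conv_alpha E T + \<epsilon>"
  obtain \<gamma>1 where g1: "\<gamma>1 \<in> dual E" "ev (exp_fun E \<gamma>1) \<noteq> ev (exp_fun E \<gamma>0)"
    using b E.dual_zero by metis
  have dense: "cl (bi_vectors r) = H"
    by (rule bi_vectors_dense[OF g0(1) _ g0(2) g1]) (use g0(3) in \<open>simp add: r_def\<close>)
  obtain q :: "nat \<Rightarrow> 'u \<Rightarrow> complex" where q: "range q \<subseteq> H" "cl (range q) = H"
    using H_separable[OF sep] by blast
  have qH: "q i \<in> H" for i using q(1) by auto
  \<comment> \<open>Indexing both seminorm and accuracy by j turns a dense sequence of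
    \<open>H\<close> into a dense double sequence of \<open>bi_vectors r\<close>.\<close>
  have "\<forall>i j. \<exists>y. y \<in> bi_vectors r \<and> sn (real j + 1) (q i - y) < 1 / (real j + 1)"
    using cl_D[of "q _" "bi_vectors r" "real _ + 1" "1 / (real _ + 1)"] dense qH by fastforce
  then obtain d where d: "\<And>i j. d i j \<in> bi_vectors r" "\<And>i j. sn (real j + 1) (q i - d i j) < 1 / (real j + 1)"
    by metis
  have bH: "bi_vectors r \<subseteq> H" using bi_orbit_H by (auto simp: bi_vectors_def)
  define y where "y k = d (fst (prod_decode k)) (snd (prod_decode k))" for k
  have "\<exists>f \<nu>. Rep r f \<nu> \<and> frequently_hypercyclic (bounded_type_topology A N E) T f"
  proof (rule frequently_hypercyclic_criterion)
    show "y k \<in> bi_vectors r" for k by (simp add: y_def d)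
    fix f s e and K :: nat assume f: "f \<in> H" and s: "(s::real) > 0" and e: "(e::real) > 0"
    obtain i where i: "sn s (f - q i) < e / 2"
      using cl_D[of f "range q" s "e / 2"] q(2) f s e by auto
    obtain j where j: "real j \<ge> max (max s (2 / e)) (real K)" using real_arch_simple by blast
    \<comment> \<open>The paired index is at least j, so enlarging j improves the approximation and
      passes the threshold K as well.\<close>
    have jK: "K \<le> prod_encode (i, j)" using j le_prod_encode_2[of j i] by simp
    have "2 / e < real j + 1" using j by simp
    then have je: "1 / (real j + 1) < e / 2" using e by (simp add: field_simps)
    have dH: "d i j \<in> H" using d(1) bH by blast
    have "sn s (f - d i j) \<le> sn s (f - q i) + sn s (q i - d i j)" by (rule sn_triangle[OF f qH dH s])
    also have "sn s (q i - d i j) \<le> sn (real j + 1) (q i - d i j)"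
      using j by (intro sn_mono H_diff qH dH s) auto
    finally have "sn s (f - d i j) < e" using i d(2)[where i = i and j = j] je by linarith
    then show "\<exists>k\<ge>K. sn s (f - y k) < e"
      using jK by (intro exI[of _ "prod_encode (i, j)"]) (simp add: y_def)
  qed
  then show ?thesis using Rep_exp_type unfolding r_def by blast
qed

end

text \<open>Functions on the zero space are determined by their value at the origin, so the function
  space has dimension at most one and a linear operator on it is a scalar.\<close>

lemma trivial_operator_zero_space:
  assumes E: "complex_banach_space E" and zero: "\<And>x. x \<in> vcarrier E \<Longrightarrow> x = vzero E"
    and T: "convolution_operator A N E T"
  shows "trivial_operator (bounded_type_funs A N E) T"
proof (cases "\<exists>f\<in>bounded_type_funs A N E. f (vzero E) \<noteq> 0")
  case True
  interpret complex_banach_space E by fact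
  let ?H = "bounded_type_funs A N E"
  have scalar: "f \<in> scalar_funs E" if "f \<in> ?H" for f
    using that by (simp add: bounded_type_funs_def holomorphic_funs_def)
  have eqI: "f = g" if "f \<in> scalar_funs E" "g \<in> scalar_funs E" "f (vzero E) = g (vzero E)" for f g
    by (rule scalar_funs_eqI[OF that(1,2)]) (use zero that(3) in metis)
  have TH: "T f \<in> ?H" and Ts: "T (fscale c f) = fscale c (T f)" if "f \<in> ?H" for f c
    using T that by (auto simp: convolution_operator_def linear_map_def)
  from True obtain u where u: "u \<in> ?H" "u (vzero E) \<noteq> 0" by blast
  define c where "c = T u (vzero E) / u (vzero E)"
  have "T f = fscale c f" if f: "f \<in> ?H" for f
  proof -
    define a where "a = f (vzero E) / u (vzero E)"
    have fu: "f = fscale a u"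
      by (rule eqI) (use u f in \<open>auto simp: a_def scalar scalar_funs_fscale\<close>)
    have "T f = fscale a (T u)" unfolding fu by (rule Ts[OF u(1)])
    also have "\<dots> = fscale c f"
      by (rule eqI) (use u f TH in \<open>auto simp: a_def c_def scalar scalar_funs_fscale\<close>)
    finally show ?thesis .
  qed
  then show ?thesis by (auto simp: trivial_operator_def)
next
  case False
  let ?H = "bounded_type_funs A N E"
  have z: "f = 0" if f: "f \<in> ?H" for f
  proof
    fix x
    have "f \<in> scalar_funs E" using f by (simp add: bounded_type_funs_def holomorphic_funs_def)
    moreover have "f (vzero E) = 0" using f False by blast
    ultimately show "f x = 0 x" using zero[of x] by (cases "x \<in> vcarrier E") (auto simp: scalar_funs_def)
  qed
  have "T f \<in> ?H" if "f \<in> ?H" for f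
    using T that by (auto simp: convolution_operator_def linear_map_def)
  then have "\<forall>f\<in>?H. T f = fscale 0 f" using z by simp
  then show ?thesis unfolding trivial_operator_def ..
qed

theorem theorem3p11:
  fixes A :: "nat \<Rightarrow> 'u poly_class"
    and N :: "nat \<Rightarrow> 'u poly_norm"
    and E :: "'u nspace"
    and c :: "nat \<Rightarrow> nat \<Rightarrow> real"
    and T :: "('u \<Rightarrow> complex) \<Rightarrow> ('u \<Rightarrow> complex)"
    and \<epsilon> :: real
  assumes "holomorphy_type A N"
    and "complex_banach_space E"
    and "separable_space (vtopology (dual_space E))"
    and "\<And>k. finite_type_dense A N k E"
    and "weakly_differentiable A N E c"
    and "\<And>k l. l \<le> k \<Longrightarrow>
           c k l \<le> (real (k + l) ^ (k + l) / fact (k + l)) * (fact k / real k ^ k) * (fact l / real l ^ l)"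
    and "convolution_operator A N E T"
    and "\<not> trivial_operator (bounded_type_funs A N E) T"
    and "\<epsilon> > 0"
  shows "\<exists>f \<in> exp_type_funs A N E (conv_alpha E T + \<epsilon>).
           frequently_hypercyclic (bounded_type_topology A N E) T f"
proof -
  have ideal: "\<And>k. banach_ideal k (A k) (N k)" using assms(1) by (simp add: holomorphy_type_def)
  have "\<exists>x\<in>vcarrier E. x \<noteq> vzero E"
    using trivial_operator_zero_space[OF assms(2) _ assms(7)] assms(8) by blast
  then interpret convolution A N E T
    by (intro convolution.intro convolution_axioms.intro poly_ideal_space.intro ideal assms(2,4,7))
  show ?thesis by (rule frequently_hypercyclic_exp_type[OF assms(3,8,9)])
qed

end
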